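(* For any constants $C$ and $\delta\in(0,1)$, there are $4$-CNF formulas $F_N$ of size $S(F_N)=\Theta(N)$ over $N$ variables which have resolution refutations of width $w=\lfloor\frac{n}{2\ln n}\rfloor+3$, with either of the following properties: (1) $N=\mathrm{poly}(n)$ and any resolution refutation of $F_N$ of width at most $w+C$ has depth exponential in $\mathrm{poly}(S(F_N))$; (2) $N=o(2^{n/2})$ and any resolution refutation of $F_N$ of width at most $(1+\delta)w$ has depth super-linear in $S(F_N)$.
   Context: A clause is a disjunction of literals over distinct variables; its width is its number of literals. A $4$-CNF is a set of clauses of width at most $4$; the size $S(F)$ of a CNF is the sum of widths of its clauses. A resolution refutation is a sequence of clauses ending in the empty clause, each clause being in $F$ or derived from two earlier clauses $C\lor x$, $D\lor\neg x$ as $C\lor D$. Width is the maximum clause width; depth is the number of edges on the longest path in the DAG having an edge from each premise to each clause derived from it. Here $n$ is the parameter indexing the family and each of (1), (2) is achieved by some family. *)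

theory Defs
  imports Complex_Main "HOL-Library.Landau_Symbols"
begin

datatype 'a literal = Pos (var: 'a) | Neg (var: 'a)

type_synonym 'a clause = "'a literal set"

definition is_clause :: "'a clause \<Rightarrow> bool" where
  "is_clause C \<longleftrightarrow> finite C \<and> inj_on var C"

definition width :: "'a clause \<Rightarrow> nat" where
  "width C = card C"

type_synonym 'a cnf = "'a clause set"

definition is_kcnf :: "nat \<Rightarrow> 'a cnf \<Rightarrow> bool" where
  "is_kcnf k F \<longleftrightarrow> finite F \<and> (\<forall>C\<in>F. is_clause C \<and> width C \<le> k)"

definition cnf_vars :: "'a cnf \<Rightarrow> 'a set" where
  "cnf_vars F = (\<Union>C\<in>F. var ` C)"

definition cnf_size :: "'a cnf \<Rightarrow> nat" where
  "cnf_size F = (\<Sum>C\<in>F. width C)"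

text \<open>
  The side conditions \<open>x \<notin> var ` C\<close>, \<open>x \<notin> var ` D\<close> express that the disjunctions
  C or x, and D or not x, are over distinct variables; without them \<open>insert\<close> would allow
  the pivot literal to be kept in the conclusion.
\<close>

definition resolves :: "'a clause \<Rightarrow> 'a clause \<Rightarrow> 'a clause \<Rightarrow> bool" where
  "resolves A B R \<longleftrightarrow>
     (\<exists>x C D. x \<notin> var ` C \<and> x \<notin> var ` D \<and>
        A = insert (Pos x) C \<and> B = insert (Neg x) D \<and> R = C \<union> D)"

text \<open>
  A derivation is a sequence of lines, each a clause with its justification: \<open>None\<close> for a
  clause of the formula, \<open>Some (i, j)\<close> for the resolvent of the earlier lines \<open>i\<close> and \<open>j\<close>.
  Recording the premises makes the DAG, and hence the depth, well defined when a clause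
  could be derived in several ways.  Its vertices are the positions in the sequence.
  There is no weakening rule.
\<close>

type_synonym 'a derivation = "('a clause \<times> (nat \<times> nat) option) list"

definition is_refutation :: "'a cnf \<Rightarrow> 'a derivation \<Rightarrow> bool" where
  "is_refutation F \<pi> \<longleftrightarrow>
     \<pi> \<noteq> [] \<and> fst (last \<pi>) = {} \<and>
     (\<forall>k < length \<pi>. is_clause (fst (\<pi> ! k)) \<and>
        (case snd (\<pi> ! k) of
           None \<Rightarrow> fst (\<pi> ! k) \<in> F
         | Some (i, j) \<Rightarrow>
             i < k \<and> j < k \<and> resolves (fst (\<pi> ! i)) (fst (\<pi> ! j)) (fst (\<pi> ! k))))"

definition ref_width :: "'a derivation \<Rightarrow> nat" where
  "ref_width \<pi> = Max ((\<lambda>l. width (fst l)) ` set \<pi>)"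

definition premise_edge :: "'a derivation \<Rightarrow> nat \<Rightarrow> nat \<Rightarrow> bool" where
  "premise_edge \<pi> i k \<longleftrightarrow>
     k < length \<pi> \<and> (\<exists>j. snd (\<pi> ! k) = Some (i, j) \<or> snd (\<pi> ! k) = Some (j, i))"

definition is_dag_path :: "'a derivation \<Rightarrow> nat list \<Rightarrow> bool" where
  "is_dag_path \<pi> p \<longleftrightarrow>
     p \<noteq> [] \<and> set p \<subseteq> {..<length \<pi>} \<and> successively (premise_edge \<pi>) p"

definition ref_depth :: "'a derivation \<Rightarrow> nat" where
  "ref_depth \<pi> = Max {length p - 1 | p. is_dag_path \<pi> p}"

definition w_param :: "nat \<Rightarrow> nat" where
  "w_param n = nat \<lfloor>real n / (2 * ln (real n))\<rfloor> + 3"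

text \<open>
  \<open>N n\<close> is the number of variables of the formula with index \<open>n\<close>; since the asymptotic
  statements are about growing formulas, it is required to tend to infinity.  The bound
  \<open>n \<ge> 2\<close> is where the logarithm in \<open>w_param\<close> is positive.
\<close>

definition linear_size_4cnf_family :: "(nat \<Rightarrow> 'a cnf) \<Rightarrow> (nat \<Rightarrow> nat) \<Rightarrow> bool" where
  "linear_size_4cnf_family F N \<longleftrightarrow>
     (\<forall>n. is_kcnf 4 (F n) \<and> card (cnf_vars (F n)) = N n) \<and>
     filterlim N at_top sequentially \<and>
     (\<lambda>n. real (cnf_size (F n))) \<in> \<Theta>(\<lambda>n. real (N n))"

definition has_width_w_refutations :: "(nat \<Rightarrow> 'a cnf) \<Rightarrow> bool" where
  "has_width_w_refutations F \<longleftrightarrow>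
     (\<forall>n\<ge>2. \<exists>\<pi>. is_refutation (F n) \<pi> \<and> ref_width \<pi> = w_param n)"

end

theory Submission
  imports Defs "HOL-Library.Z2" "HOL-Library.Nat_Bijection"
    "HOL-Number_Theory.Number_Theory" "HOL-Real_Asymp.Real_Asymp"
begin

text \<open>
  Both parts use a compressed Tseitin formula.  Take a cylinder with \<open>k\<close> rows, cyclically
  adjacent, and exponentially many columns; the charge is arranged so that the parity of the
  horizontal edges is \<open>0\<close> in the first column and \<open>1\<close> in the last.  Sweeping over the
  columns refutes this in width \<open>k + 3\<close>.  To make the formula small, the horizontal edges of row
  \<open>i\<close> are identified modulo a number \<open>p\<^sub>i\<close>, and the vertical edges between two rows modulo a
  common divisor of their moduli.  All \<open>p\<^sub>i\<close> are products of some of the pairwise coprime numbers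
  \<open>g\<^sub>0, g\<^sub>1, \<dots>\<close>, whose product \<open>G\<close> bounds the number of columns; \<open>g\<^sub>0\<close> divides every modulus.

  A set of at most \<open>k + s\<close> variables that separates the two ends of the cylinder meets every row,
  and meets all but \<open>s\<close> rows in a single edge.  The columns of these single edges agree, up to
  \<open>s\<close>, modulo every common factor of the moduli of two rows.  As each factor occurs in more
  than \<open>s\<close> rows, they determine a time modulo \<open>G\<close>, up to \<open>2s\<close>, by the Chinese remainder theorem.
  One query changes this time by at most \<open>2s\<close>, so that an adversary who keeps the violated
  constraints at the far end survives for about \<open>G / s\<close> rounds.

  For constant slack every row gets one factor besides \<open>g\<^sub>0\<close>, shared by \<open>s + 1\<close> rows, so there are
  \<open>k / (s + 1)\<close> factors, each polynomially bounded.  For slack \<open>\<delta> k\<close> there is a number of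
  factors that depends only on \<open>\<delta>\<close>, and every row omits just one of them, so that \<open>G\<close> exceeds each modulus by a large factor.
\<close>

section \<open>Resolution\<close>

text \<open>The parity of a column of horizontal edges can switch from 0 to 1 only at a violated
  vertex. Such a vertex cannot sit in a compressed column, where its constraint would recur with
  period \<open>p i\<close>; hence two uncompressed tails, each with more columns than there are
  remembered variables, so that some column has none of its vertical edges queried. Identification
  also destroys the geometry: one queried edge stands for many columns. Separating the two ends is
  therefore expressed by linear algebra, through odd homogeneous solutions that vanish on the
  queried set. The rows agree only up to a shift of at most \<open>s\<close>, and different factors
  might come with different shifts; the common factor \<open>g0 > 4 * s\<close> fixes the shift, so
  that Chinese remaindering applies. The two ends are about \<open>G / 2\<close> apart, which keeps
  them far from each other in both directions modulo \<open>G\<close>. Finally, the width has to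
  equal \<open>w\<close> exactly and there is no weakening, so satisfiable clauses on fresh
  variables are added from which a clause of width \<open>w\<close> can be derived.\<close>

declare add_bit_eq_xor [simp del] mult_bit_eq_and [simp del]

lemma bit_add_self [simp]: "(x::bit) + x = 0"
  by (cases x) auto

lemma bit_add_eq_0_iff: "(x::bit) + y = 0 \<longleftrightarrow> x = y"
  by (cases x; cases y) auto

definition lit_false :: "('a \<Rightarrow> bit) \<Rightarrow> 'a literal \<Rightarrow> bool" where
  "lit_false \<sigma> l \<longleftrightarrow> (case l of Pos x \<Rightarrow> \<sigma> x = 0 | Neg x \<Rightarrow> \<sigma> x = 1)"

definition falsified :: "('a \<Rightarrow> bit) \<Rightarrow> 'a clause \<Rightarrow> bool" where
  "falsified \<sigma> C \<longleftrightarrow> (\<forall>l\<in>C. lit_false \<sigma> l)"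

lemma lit_false_simps [simp]:
  "lit_false \<sigma> (Pos x) \<longleftrightarrow> \<sigma> x = 0" "lit_false \<sigma> (Neg x) \<longleftrightarrow> \<sigma> x = 1"
  by (auto simp: lit_false_def)

lemma falsified_simps [simp]:
  "falsified \<sigma> {}" "falsified \<sigma> (insert l C) \<longleftrightarrow> lit_false \<sigma> l \<and> falsified \<sigma> C"
  "falsified \<sigma> (C \<union> D) \<longleftrightarrow> falsified \<sigma> C \<and> falsified \<sigma> D"
  by (auto simp: falsified_def)

lemma falsified_cong:
  assumes "\<And>x. x \<in> var ` C \<Longrightarrow> \<sigma> x = \<tau> x"
  shows "falsified \<sigma> C \<longleftrightarrow> falsified \<tau> C"
proof -
  have "lit_false \<sigma> l \<longleftrightarrow> lit_false \<tau> l" if "l \<in> C" for l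
    using assms[of "var l"] that by (cases l) force+
  then show ?thesis by (auto simp: falsified_def)
qed

text \<open>Opposite literals are never falsified together, so a falsified set of literals is no
  larger than its set of variables; this turns bounds on the number of remembered variables into
  bounds on width.\<close>

lemma falsified_inj_var: "falsified \<sigma> C \<Longrightarrow> inj_on var C"
  unfolding falsified_def inj_on_def
  by (metis lit_false_simps literal.exhaust_sel zero_neq_one)

subsection \<open>Derivability in bounded width\<close>

text \<open>Upper bounds put no limit on length or depth, so the order of the lines is dropped here;
  \<open>derivable_imp_derivation\<close> linearises a derivation again.\<close>

inductive derivable :: "'a cnf \<Rightarrow> nat \<Rightarrow> 'a clause \<Rightarrow> bool" for F W where
  axiom_clause: "C \<in> F \<Longrightarrow> is_clause C \<Longrightarrow> width C \<le> W \<Longrightarrow> derivable F W C"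
| resolvent: "derivable F W A \<Longrightarrow> derivable F W B \<Longrightarrow> resolves A B R \<Longrightarrow> is_clause R \<Longrightarrow>
    width R \<le> W \<Longrightarrow> derivable F W R"

definition valid_line :: "'a cnf \<Rightarrow> 'a derivation \<Rightarrow> nat \<Rightarrow> bool" where
  "valid_line F \<pi> k \<longleftrightarrow> is_clause (fst (\<pi> ! k)) \<and>
        (case snd (\<pi> ! k) of
           None \<Rightarrow> fst (\<pi> ! k) \<in> F
         | Some (i, j) \<Rightarrow>
             i < k \<and> j < k \<and> resolves (fst (\<pi> ! i)) (fst (\<pi> ! j)) (fst (\<pi> ! k)))"

definition valid_derivation :: "'a cnf \<Rightarrow> nat \<Rightarrow> 'a derivation \<Rightarrow> bool" where
  "valid_derivation F W \<pi> \<longleftrightarrow>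
     (\<forall>k<length \<pi>. valid_line F \<pi> k) \<and> (\<forall>l\<in>set \<pi>. width (fst l) \<le> W)"

text \<open>Justifications refer to absolute positions, so a derivation appended after
  \<open>d\<close> lines has to be renumbered.\<close>

definition shift_line :: "nat \<Rightarrow> 'a clause \<times> (nat \<times> nat) option \<Rightarrow> 'a clause \<times> (nat \<times> nat) option" where
  "shift_line d l = (fst l, map_option (\<lambda>(i, j). (i + d, j + d)) (snd l))"

lemma fst_shift_line [simp]: "fst (shift_line d l) = fst l"
  by (simp add: shift_line_def)

lemma valid_derivation_append:
  assumes "valid_derivation F W \<pi>" "valid_derivation F W \<rho>"
  shows "valid_derivation F W (\<pi> @ map (shift_line (length \<pi>)) \<rho>)"
  unfolding valid_derivation_def
proof (intro conjI allI impI)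
  let ?\<tau> = "\<pi> @ map (shift_line (length \<pi>)) \<rho>"
  fix k assume k: "k < length ?\<tau>"
  show "valid_line F ?\<tau> k"
  proof (cases "k < length \<pi>")
    case True
    with assms(1) have "valid_line F \<pi> k" by (simp add: valid_derivation_def)
    with True show ?thesis
      unfolding valid_line_def by (auto simp: nth_append split: option.splits)
  next
    case False
    then obtain k' where k': "k = length \<pi> + k'" "k' < length \<rho>"
      using k by (metis add_diff_inverse_nat length_append length_map nat_add_left_cancel_less)
    with assms(2) have "valid_line F \<rho> k'" by (simp add: valid_derivation_def)
    with k' show ?thesis
      unfolding valid_line_def
      by (auto simp: nth_append shift_line_def split: option.splits)
  qed
qed (use assms in \<open>auto simp: valid_derivation_def\<close>)

lemma valid_derivation_snoc:
  assumes "valid_derivation F W \<pi>" "valid_line F (\<pi> @ [l]) (length \<pi>)" "width (fst l) \<le> W"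
  shows "valid_derivation F W (\<pi> @ [l])"
  unfolding valid_derivation_def
proof (intro conjI allI impI)
  fix k assume "k < length (\<pi> @ [l])"
  then consider "k < length \<pi>" | "k = length \<pi>" by force
  then show "valid_line F (\<pi> @ [l]) k"
  proof cases
    case 1
    with assms(1) have "valid_line F \<pi> k" by (simp add: valid_derivation_def)
    with 1 show ?thesis
      unfolding valid_line_def by (auto simp: nth_append split: option.splits)
  qed (use assms(2) in simp)
qed (use assms in \<open>auto simp: valid_derivation_def\<close>)

lemma derivable_imp_derivation:
  assumes "derivable F W C"
  shows "\<exists>\<pi>. valid_derivation F W \<pi> \<and> \<pi> \<noteq> [] \<and> fst (last \<pi>) = C"
  using assms
proof induction
  case (axiom_clause C)
  then show ?case
    by (intro exI[of _ "[(C, None)]"]) (auto simp: valid_derivation_def valid_line_def)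
next
  case (resolvent A B R)
  then obtain \<pi> \<rho> where \<pi>: "valid_derivation F W \<pi>" "\<pi> \<noteq> []" "fst (last \<pi>) = A"
    and \<rho>: "valid_derivation F W \<rho>" "\<rho> \<noteq> []" "fst (last \<rho>) = B" by blast
  define \<tau> where "\<tau> = \<pi> @ map (shift_line (length \<pi>)) \<rho>"
  have \<tau>: "valid_derivation F W \<tau>"
    unfolding \<tau>_def using \<pi> \<rho> by (intro valid_derivation_append)
  have A: "length \<pi> - 1 < length \<tau>" "fst (\<tau> ! (length \<pi> - 1)) = A"
    using \<pi> by (auto simp: \<tau>_def nth_append last_conv_nth Suc_le_eq intro: trans_less_add1)
  have B: "length \<tau> - 1 < length \<tau>" "fst (\<tau> ! (length \<tau> - 1)) = B"
  proof -
    have "last \<tau> = shift_line (length \<pi>) (last \<rho>)"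
      using \<rho> by (simp add: \<tau>_def last_map)
    moreover have "\<tau> \<noteq> []" using \<pi> by (simp add: \<tau>_def)
    ultimately show "length \<tau> - 1 < length \<tau>" "fst (\<tau> ! (length \<tau> - 1)) = B"
      using \<rho> last_conv_nth[of \<tau>] by simp_all
  qed
  let ?l = "(R, Some (length \<pi> - 1, length \<tau> - 1))"
  have "valid_line F (\<tau> @ [?l]) (length \<tau>)"
    unfolding valid_line_def using A B resolvent by (simp add: nth_append)
  then have "valid_derivation F W (\<tau> @ [?l])"
    using \<tau> resolvent by (intro valid_derivation_snoc) auto
  then show ?case by (intro exI[of _ "\<tau> @ [?l]"]) auto
qed

text \<open>A refutation may contain lines on which the empty clause does not depend, so a
  derivation of some clause with exactly \<open>W\<close> literals is placed in front.\<close>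

lemma refutation_of_width:
  assumes "derivable F W {}" "derivable F W D" "width D = W"
  shows "\<exists>\<pi>. is_refutation F \<pi> \<and> ref_width \<pi> = W"
proof -
  obtain \<pi> \<rho> where \<pi>: "valid_derivation F W \<pi>" "\<pi> \<noteq> []" "fst (last \<pi>) = D"
    and \<rho>: "valid_derivation F W \<rho>" "\<rho> \<noteq> []" "fst (last \<rho>) = {}"
    using derivable_imp_derivation[OF assms(1)] derivable_imp_derivation[OF assms(2)] by blast
  define \<tau> where "\<tau> = \<pi> @ map (shift_line (length \<pi>)) \<rho>"
  have \<tau>: "valid_derivation F W \<tau>"
    unfolding \<tau>_def using \<pi> \<rho> by (intro valid_derivation_append)
  have "is_refutation F \<tau>"
    using \<tau> \<rho> \<pi> unfolding is_refutation_def valid_derivation_def valid_line_def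
    by (auto simp: \<tau>_def last_map)
  moreover have "ref_width \<tau> = W"
    unfolding ref_width_def
  proof (rule Max_eqI)
    have "last \<pi> \<in> set \<tau>" using \<pi> by (simp add: \<tau>_def)
    then show "W \<in> (\<lambda>l. width (fst l)) ` set \<tau>" using \<pi> assms by force
  qed (use \<tau> in \<open>auto simp: valid_derivation_def\<close>)
  ultimately show ?thesis by blast
qed

subsection \<open>Refuting partial assignments\<close>

text \<open>The partial assignment meant here is the restriction of \<open>\<sigma>\<close> to \<open>A\<close>.\<close>

definition refutable :: "'a cnf \<Rightarrow> nat \<Rightarrow> 'a set \<Rightarrow> ('a \<Rightarrow> bit) \<Rightarrow> bool" where
  "refutable F W A \<sigma> \<longleftrightarrow> (\<exists>C. derivable F W C \<and> falsified \<sigma> C \<and> var ` C \<subseteq> A)"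

lemma refutable_mono: "refutable F W A \<sigma> \<Longrightarrow> A \<subseteq> B \<Longrightarrow> refutable F W B \<sigma>"
  unfolding refutable_def by blast

lemma refutable_axiom:
  assumes "C \<in> F" "finite C" "falsified \<sigma> C" "var ` C \<subseteq> A" "card C \<le> W"
  shows "refutable F W A \<sigma>"
  using assms falsified_inj_var[of \<sigma> C] unfolding refutable_def is_clause_def width_def
  by (intro exI[of _ C]) (auto intro!: axiom_clause simp: is_clause_def width_def)

lemma derivable_is_clause: "derivable F W C \<Longrightarrow> is_clause C"
  by (induction rule: derivable.induct)

text \<open>If one of the clauses for the two answers misses \<open>x\<close>, it already serves;
  otherwise they contain \<open>x\<close> with opposite signs and are resolved on it. The resolvent
  is falsified and has its variables in \<open>A\<close>, hence at most \<open>W\<close> literals. A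
  query strategy that remembers at most \<open>W\<close> variables before each query thus becomes a
  derivation of width \<open>W\<close>.\<close>

lemma refutable_query:
  assumes A: "finite A" "card A \<le> W"
    and r: "\<And>b. refutable F W (insert x A) (\<sigma>(x := b))"
  shows "refutable F W A \<sigma>"
proof (cases "x \<in> A")
  case True
  then show ?thesis using r[of "\<sigma> x"] by (simp add: insert_absorb)
next
  case False
  obtain C where C: "derivable F W C" "falsified (\<sigma>(x := 0)) C" "var ` C \<subseteq> insert x A"
    using r[of 0] unfolding refutable_def by auto
  obtain D where D: "derivable F W D" "falsified (\<sigma>(x := 1)) D" "var ` D \<subseteq> insert x A"
    using r[of 1] unfolding refutable_def by auto
  consider "x \<notin> var ` C" | "x \<notin> var ` D" | "x \<in> var ` C" "x \<in> var ` D" by blast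
  then show ?thesis
  proof cases
    case 1
    then have "falsified \<sigma> C"
      using C(2) by (subst falsified_cong[of C \<sigma> "\<sigma>(x := 0)"]) auto
    with 1 C show ?thesis unfolding refutable_def by blast
  next
    case 2
    then have "falsified \<sigma> D"
      using D(2) by (subst falsified_cong[of D \<sigma> "\<sigma>(x := 1)"]) auto
    with 2 D show ?thesis unfolding refutable_def by blast
  next
    case 3
    have lits: "l \<in> C \<Longrightarrow> var l = x \<Longrightarrow> l = Pos x" "l \<in> D \<Longrightarrow> var l = x \<Longrightarrow> l = Neg x" for l
      using C(2) D(2) by (cases l; force simp: falsified_def)+
    define C' where "C' = C - {Pos x}"
    define D' where "D' = D - {Neg x}"
    have "Pos x \<in> C" "Neg x \<in> D" using 3 lits by auto
    then have CD: "C = insert (Pos x) C'" "D = insert (Neg x) D'"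
      by (auto simp: C'_def D'_def)
    have x: "x \<notin> var ` C'" "x \<notin> var ` D'"
      using lits by (auto simp: C'_def D'_def)
    have res: "resolves C D (C' \<union> D')"
      unfolding resolves_def using CD x by blast
    have "falsified (\<sigma>(x := 0)) C'" "falsified (\<sigma>(x := 1)) D'"
      using C(2) D(2) CD by auto
    then have f: "falsified \<sigma> (C' \<union> D')"
      using x falsified_cong[of C' \<sigma> "\<sigma>(x := 0)"] falsified_cong[of D' \<sigma> "\<sigma>(x := 1)"]
      by (metis falsified_simps(3) fun_upd_other)
    have sub: "var ` (C' \<union> D') \<subseteq> A" using C(3) D(3) x CD by auto
    have fin: "finite (C' \<union> D')"
      using derivable_is_clause[OF C(1)] derivable_is_clause[OF D(1)] CD
      by (auto simp: is_clause_def)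
    have "card (C' \<union> D') = card (var ` (C' \<union> D'))"
      using falsified_inj_var[OF f] by (simp add: card_image)
    also have "\<dots> \<le> W" using card_mono[OF A(1) sub] A(2) by linarith
    finally have "derivable F W (C' \<union> D')"
      using res f fin falsified_inj_var[OF f]
      by (intro resolvent[OF C(1) D(1)]) (auto simp: is_clause_def width_def)
    with f sub show ?thesis unfolding refutable_def by blast
  qed
qed

text \<open>Only the values on \<open>A\<close> are remembered, so both answers are covered by an
  arbitrary \<tau> that agrees with \<sigma> there.\<close>

lemma refutable_query_extend:
  assumes "finite A" "card A \<le> W"
    and "\<And>\<tau>. (\<forall>y\<in>A. \<tau> y = \<sigma> y) \<Longrightarrow> refutable F W (insert x A) \<tau>"
  shows "refutable F W A \<sigma>"
proof (cases "x \<in> A")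
  case True
  then show ?thesis using assms(3)[of \<sigma>] by (simp add: insert_absorb)
next
  case False
  then show ?thesis using assms by (intro refutable_query[of A W F x]) auto
qed

lemma refutable_empty: "refutable F W {} \<sigma> \<Longrightarrow> derivable F W {}"
  unfolding refutable_def by auto

subsection \<open>Depth\<close>

lemma refutation_path_increasing:
  assumes "is_refutation F \<pi>" "is_dag_path \<pi> p"
  shows "sorted_wrt (<) p"
proof -
  have "premise_edge \<pi> i k \<Longrightarrow> i < k" for i k
    using assms(1) unfolding is_refutation_def premise_edge_def by (auto split: option.splits)
  then have "successively (<) p"
    using assms(2) unfolding is_dag_path_def by (auto intro: successively_mono)
  then show ?thesis by (simp add: successively_conv_sorted_wrt)
qed

text \<open>A single path bounds the maximum from below only if the set of path lengths is finite;
  it is, because paths are strictly increasing lists of positions.\<close>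

lemma ref_depth_ge:
  assumes "is_refutation F \<pi>" "is_dag_path \<pi> p"
  shows "length p - 1 \<le> ref_depth \<pi>"
proof -
  have "length p \<le> length \<pi>" if "is_dag_path \<pi> p" for p
  proof -
    have "distinct p" using refutation_path_increasing[OF assms(1) that]
      by (simp add: strict_sorted_iff)
    moreover have "set p \<subseteq> {..<length \<pi>}" using that by (simp add: is_dag_path_def)
    ultimately show ?thesis
      by (metis card_lessThan card_mono distinct_card finite_lessThan)
  qed
  then have "{length p - 1 | p. is_dag_path \<pi> p} \<subseteq> {..length \<pi>}" by fastforce
  then have "finite {length p - 1 | p. is_dag_path \<pi> p}"
    using finite_subset by blast
  then show ?thesis
    unfolding ref_depth_def using assms(2) by (intro Max_ge) auto
qed

lemma ref_width_ge:
  assumes "k < length \<pi>"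
  shows "width (fst (\<pi> ! k)) \<le> ref_width \<pi>"
  unfolding ref_width_def using assms by (intro Max_ge) auto

text \<open>
  The adversary of the width-bounded query game: \<open>G d A \<sigma>\<close> says that the adversary can survive
  \<open>d\<close> more queries when the variables in \<open>A\<close> are answered by \<open>\<sigma>\<close>.
\<close>

lemma ref_depth_ge_adversary:
  assumes start: "G d {} \<sigma>0"
    and query: "\<And>d A \<sigma> x. G (Suc d) A \<sigma> \<Longrightarrow> finite A \<Longrightarrow> card A \<le> W \<Longrightarrow>
        \<exists>\<tau>. (\<forall>y\<in>A. \<tau> y = \<sigma> y) \<and> G d (insert x A) \<tau>"
    and forget: "\<And>d A B \<sigma>. G d A \<sigma> \<Longrightarrow> B \<subseteq> A \<Longrightarrow> G d B \<sigma>"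
    and safe: "\<And>d A \<sigma> C. G d A \<sigma> \<Longrightarrow> C \<in> F \<Longrightarrow> var ` C \<subseteq> A \<Longrightarrow> \<not> falsified \<sigma> C"
    and \<pi>: "is_refutation F \<pi>" "ref_width \<pi> \<le> W"
  shows "d \<le> ref_depth \<pi>"
proof -
  have line: "is_clause (fst (\<pi> ! k)) \<and>
        (case snd (\<pi> ! k) of
           None \<Rightarrow> fst (\<pi> ! k) \<in> F
         | Some (i, j) \<Rightarrow>
             i < k \<and> j < k \<and> resolves (fst (\<pi> ! i)) (fst (\<pi> ! j)) (fst (\<pi> ! k)))"
    if "k < length \<pi>" for k
    using \<pi>(1) that unfolding is_refutation_def by blast
  \<comment> \<open>The path is followed backwards from the empty clause: the adversary answers the
    pivot, the premise falsified under that answer comes next, and all other variables are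
    forgotten.\<close>
  have path: "\<exists>p. is_dag_path \<pi> p \<and> last p = k \<and> length p = Suc d"
    if "k < length \<pi>" "falsified \<sigma> (fst (\<pi> ! k))" "G d (var ` fst (\<pi> ! k)) \<sigma>" for k d \<sigma>
    using that
  proof (induction d arbitrary: k \<sigma>)
    case 0
    then show ?case by (intro exI[of _ "[k]"]) (auto simp: is_dag_path_def)
  next
    case (Suc d)
    let ?R = "fst (\<pi> ! k)"
    from Suc.prems have "?R \<notin> F" using safe by blast
    with line[OF Suc.prems(1)] obtain i j where
      ij: "snd (\<pi> ! k) = Some (i, j)" "i < k" "j < k" "resolves (fst (\<pi> ! i)) (fst (\<pi> ! j)) ?R"
      by (auto split: option.splits)
    then obtain x C D where x: "fst (\<pi> ! i) = insert (Pos x) C"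
        "fst (\<pi> ! j) = insert (Neg x) D" "?R = C \<union> D"
      unfolding resolves_def by blast
    have "finite ?R" using line[OF Suc.prems(1)] by (simp add: is_clause_def)
    then have "card (var ` ?R) \<le> W" "finite (var ` ?R)"
      using card_image_le[of ?R var] ref_width_ge[OF Suc.prems(1)] \<pi>(2) by (auto simp: width_def)
    then obtain \<tau> where \<tau>: "\<forall>y\<in>var ` ?R. \<tau> y = \<sigma> y" "G d (insert x (var ` ?R)) \<tau>"
      using query Suc.prems(3) by blast
    then have f: "falsified \<tau> C" "falsified \<tau> D"
      using Suc.prems(2) x(3) falsified_cong[of ?R \<tau> \<sigma>] by auto
    define l where "l = (if \<tau> x = 0 then i else j)"
    have l: "l < length \<pi>" "falsified \<tau> (fst (\<pi> ! l))" "premise_edge \<pi> l k"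
      "var ` fst (\<pi> ! l) \<subseteq> insert x (var ` ?R)"
      using ij x f Suc.prems(1) by (auto simp: l_def premise_edge_def)
    then have "G d (var ` fst (\<pi> ! l)) \<tau>" using forget \<tau>(2) by blast
    with Suc.IH l obtain p where p: "is_dag_path \<pi> p" "last p = l" "length p = Suc d" by blast
    then have "is_dag_path \<pi> (p @ [k])"
      using l Suc.prems(1) by (auto simp: is_dag_path_def successively_append_iff)
    with p show ?case by (intro exI[of _ "p @ [k]"]) auto
  qed
  have "length \<pi> - 1 < length \<pi>" "fst (\<pi> ! (length \<pi> - 1)) = {}"
    using \<pi>(1) by (auto simp: is_refutation_def last_conv_nth)
  with path[of "length \<pi> - 1" \<sigma>0 d] start obtain p where "is_dag_path \<pi> p" "length p = Suc d"
    by auto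
  with ref_depth_ge[OF \<pi>(1)] show ?thesis by fastforce
qed

section \<open>Parity constraints\<close>

text \<open>The clause over \<open>X\<close> that is falsified exactly by the assignments agreeing
  with \<open>a\<close> on \<open>X\<close>; a parity constraint forbids each assignment of the
  wrong parity in this way.\<close>

definition assignment_clause :: "('a \<Rightarrow> bit) \<Rightarrow> 'a set \<Rightarrow> 'a clause" where
  "assignment_clause a X = (\<lambda>x. if a x = 1 then Neg x else Pos x) ` X"

definition parity_clauses :: "'a set \<Rightarrow> bit \<Rightarrow> 'a cnf" where
  "parity_clauses X b = {assignment_clause a X | a. sum a X \<noteq> b}"

lemma var_assignment_clause [simp]: "var ` assignment_clause a X = X"
proof -
  have "var ` assignment_clause a X = (\<lambda>x. x) ` X"
    unfolding assignment_clause_def image_image by (intro image_cong) auto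
  then show ?thesis by simp
qed

lemma falsified_assignment_clause: "falsified \<sigma> (assignment_clause a X) \<longleftrightarrow> (\<forall>x\<in>X. \<sigma> x = a x)"
proof -
  have "lit_false \<sigma> (if a x = 1 then Neg x else Pos x) \<longleftrightarrow> \<sigma> x = a x" for x
    by (cases "a x"; cases "\<sigma> x") simp_all
  then show ?thesis by (simp only: assignment_clause_def falsified_def ball_simps)
qed

lemma assignment_clause_props:
  assumes "finite X"
  shows "finite (assignment_clause a X)" "is_clause (assignment_clause a X)"
    "card (assignment_clause a X) = card X"
proof -
  have "inj_on (\<lambda>x. if a x = 1 then Neg x else Pos x) X"
    by (rule inj_onI) (metis literal.sel)
  then show card: "card (assignment_clause a X) = card X"
    unfolding assignment_clause_def by (rule card_image)
  show fin: "finite (assignment_clause a X)"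
    using assms unfolding assignment_clause_def by (rule finite_imageI)
  have "inj_on var (assignment_clause a X)"
    using card fin by (intro eq_card_imp_inj_on) auto
  with fin show "is_clause (assignment_clause a X)" by (simp add: is_clause_def)
qed

lemma parity_clause_not_falsified:
  assumes "C \<in> parity_clauses X b" "sum \<sigma> X = b"
  shows "\<not> falsified \<sigma> C"
proof
  assume "falsified \<sigma> C"
  moreover obtain a where "C = assignment_clause a X" "sum a X \<noteq> b"
    using assms(1) unfolding parity_clauses_def by blast
  ultimately have "sum \<sigma> X = sum a X" "sum a X \<noteq> b"
    by (auto simp only: falsified_assignment_clause intro!: sum.cong)
  then show False using assms(2) by simp
qed

lemma refutable_parity:
  assumes "parity_clauses X b \<subseteq> F" "finite X" "card X \<le> W" "X \<subseteq> A" "sum \<sigma> X \<noteq> b"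
  shows "refutable F W A \<sigma>"
proof (rule refutable_axiom)
  have "assignment_clause \<sigma> X \<in> parity_clauses X b"
    using assms(5) unfolding parity_clauses_def by blast
  then show "assignment_clause \<sigma> X \<in> F" using assms(1) by blast
qed (use assms(2-4) in \<open>simp_all add: assignment_clause_props falsified_assignment_clause\<close>)

lemma parity_clauses_bound:
  assumes "finite X"
  shows "finite (parity_clauses X b)" "card (parity_clauses X b) \<le> 2 ^ card X"
proof -
  have *: "parity_clauses X b \<subseteq> (\<lambda>Y. assignment_clause (\<lambda>x. of_bool (x \<in> Y)) X) ` Pow X"
  proof
    fix C assume "C \<in> parity_clauses X b"
    then obtain a where a: "C = assignment_clause a X" by (auto simp: parity_clauses_def)
    have "C = assignment_clause (\<lambda>x. of_bool (x \<in> {x\<in>X. a x = 1})) X"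
      unfolding a assignment_clause_def by (intro image_cong) auto
    then show "C \<in> (\<lambda>Y. assignment_clause (\<lambda>x. of_bool (x \<in> Y)) X) ` Pow X" by blast
  qed
  show "finite (parity_clauses X b)" using finite_subset[OF *] assms by simp
  have "card (parity_clauses X b) \<le> card (Pow X)"
    using assms by (intro surj_card_le[OF _ *]) simp
  then show "card (parity_clauses X b) \<le> 2 ^ card X" using assms by (simp add: card_Pow)
qed

lemma cnf_vars_parity_clauses:
  assumes "finite X" "x \<in> X"
  shows "x \<in> cnf_vars (parity_clauses X 0)"
proof -
  have "sum (\<lambda>y. of_bool (y = x) :: bit) X = 1" using assms by (simp add: sum.delta)
  then have "assignment_clause (\<lambda>y. of_bool (y = x)) X \<in> parity_clauses X 0"
    unfolding parity_clauses_def by (intro CollectI exI[of _ "\<lambda>y. of_bool (y = x)"]) simp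
  then show ?thesis unfolding cnf_vars_def
    using assms(2) var_assignment_clause[of "\<lambda>y. of_bool (y = x)" X] by blast
qed

lemma cnf_size_parity_clauses:
  assumes "finite X"
  shows "cnf_size (parity_clauses X b) \<le> 2 ^ card X * card X"
proof -
  have "cnf_size (parity_clauses X b) = (\<Sum>C\<in>parity_clauses X b. card X)"
    unfolding cnf_size_def width_def
    using assms by (intro sum.cong) (auto simp: parity_clauses_def assignment_clause_props)
  then show ?thesis using parity_clauses_bound[OF assms, of b] by simp
qed

lemma cnf_size_Un: "finite F \<Longrightarrow> finite F' \<Longrightarrow> cnf_size (F \<union> F') \<le> cnf_size F + cnf_size F'"
  unfolding cnf_size_def by (simp add: sum_Un_nat)

lemma cnf_size_UN:
  assumes "finite J" "\<And>j. j \<in> J \<Longrightarrow> finite (F j)"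
  shows "cnf_size (\<Union>j\<in>J. F j) \<le> (\<Sum>j\<in>J. cnf_size (F j))"
  using assms
proof (induction J)
  case (insert j J)
  then have "cnf_size (F j \<union> (\<Union>j\<in>J. F j)) \<le> cnf_size (F j) + cnf_size (\<Union>j\<in>J. F j)"
    by (intro cnf_size_Un) auto
  with insert show ?case by simp
qed (simp add: cnf_size_def)

section \<open>Congruences\<close>

lemma cong_abs_less_imp_eq:
  fixes a b d :: int
  assumes "[a = b] (mod d)" "\<bar>a - b\<bar> < d"
  shows "a = b"
proof -
  have "d dvd a - b" using assms(1) by (simp add: cong_iff_dvd_diff)
  then show ?thesis using assms(2) zdvd_imp_le[of d "\<bar>a - b\<bar>"] by (cases "a = b") auto
qed

lemma chinese_remainder_int:
  fixes m u :: "'i \<Rightarrow> int"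
  assumes "finite A" "\<And>i j. i \<in> A \<Longrightarrow> j \<in> A \<Longrightarrow> i \<noteq> j \<Longrightarrow> coprime (m i) (m j)"
  shows "\<exists>x. \<forall>i\<in>A. [x = u i] (mod m i)"
  using assms
proof (induction A)
  case (insert i A)
  then obtain x where x: "\<forall>j\<in>A. [x = u j] (mod m j)" by auto
  have "coprime (m i) (\<Prod>j\<in>A. m j)"
    using insert.hyps insert.prems by (intro prod_coprime_right) auto
  then obtain y where y: "[y = u i] (mod m i)" "[y = x] (mod (\<Prod>j\<in>A. m j))"
    using binary_chinese_remainder_int by blast
  have "[y = u j] (mod m j)" if "j \<in> A" for j
  proof -
    have "m j dvd (\<Prod>j\<in>A. m j)" using that insert.hyps by (intro dvd_prodI) auto
    then show ?thesis using y x that cong_dvd_modulus cong_trans by blast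
  qed
  with y show ?case by auto
qed simp

lemma cong_prod_coprime:
  fixes m :: "'i \<Rightarrow> int"
  assumes "finite A" "\<And>i j. i \<in> A \<Longrightarrow> j \<in> A \<Longrightarrow> i \<noteq> j \<Longrightarrow> coprime (m i) (m j)"
    "\<And>i. i \<in> A \<Longrightarrow> [x = y] (mod m i)"
  shows "[x = y] (mod (\<Prod>i\<in>A. m i))"
  using assms
proof (induction A)
  case (insert i A)
  have "coprime (m i) (\<Prod>j\<in>A. m j)"
    using insert.hyps insert.prems by (intro prod_coprime_right) auto
  moreover have "[x = y] (mod (\<Prod>i\<in>A. m i))" using insert by auto
  ultimately show ?case using insert by (simp add: coprime_cong_mult)
qed simp

section \<open>The compressed Tseitin cylinder\<close>

text \<open>The families consist of formulas over natural numbers, so horizontal, vertical and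
  padding variables are coded with distinct tags.\<close>

definition hvar :: "nat \<Rightarrow> int \<Rightarrow> nat" where "hvar i z = prod_encode (0, prod_encode (i, int_encode z))"
definition vvar :: "nat \<Rightarrow> int \<Rightarrow> nat" where "vvar e z = prod_encode (1, prod_encode (e, int_encode z))"
definition pvar :: "nat \<Rightarrow> nat \<Rightarrow> nat" where "pvar b i = prod_encode (2 + b, prod_encode (i, 0))"

lemma var_simps [simp]:
  "hvar i z = hvar i' z' \<longleftrightarrow> i = i' \<and> z = z'" "vvar i z = vvar i' z' \<longleftrightarrow> i = i' \<and> z = z'"
  "pvar b i = pvar b' i' \<longleftrightarrow> b = b' \<and> i = i'"
  "hvar i z \<noteq> vvar e y" "vvar e y \<noteq> hvar i z" "hvar i z \<noteq> pvar b j" "pvar b j \<noteq> hvar i z"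
  "vvar i z \<noteq> pvar b j" "pvar b j \<noteq> vvar i z"
  by (auto simp: hvar_def vvar_def pvar_def int_encode_eq)

definition assign :: "(nat \<Rightarrow> int \<Rightarrow> bit) \<Rightarrow> (nat \<Rightarrow> int \<Rightarrow> bit) \<Rightarrow> bit \<Rightarrow> nat \<Rightarrow> bit" where
  "assign h v b x = (case prod_decode x of (\<kappa>, y) \<Rightarrow> case prod_decode y of (i, z) \<Rightarrow>
     if \<kappa> = 0 then h i (int_decode z) else if \<kappa> = 1 then v i (int_decode z) else b)"

lemma assign_simps [simp]:
  "assign h v b (hvar i z) = h i z" "assign h v b (vvar e z) = v e z" "assign h v b (pvar j i) = b"
  by (simp_all add: assign_def hvar_def vvar_def pvar_def)

lemma assign_eq_0:
  assumes "\<And>i z. x = hvar i z \<Longrightarrow> h i z = 0" "\<And>e z. x = vvar e z \<Longrightarrow> v e z = 0"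
  shows "assign h v 0 x = 0"
proof -
  obtain \<kappa> y i z where y: "prod_decode x = (\<kappa>, y)" "prod_decode y = (i, z)"
    by (metis surj_pair)
  then have "x = prod_encode (\<kappa>, prod_encode (i, int_encode (int_decode z)))"
    by (metis int_decode_inverse prod_decode_inverse)
  then show ?thesis using assms[of i "int_decode z"]
    by (auto simp: assign_def hvar_def vvar_def)
qed

text \<open>An arc of the cyclic order on the rows: any two members are joined inside
  \<open>J\<close> along one of the two ways around the cycle.\<close>

definition arc_like :: "nat \<Rightarrow> nat set \<Rightarrow> bool" where
  "arc_like k J \<longleftrightarrow> (\<forall>i\<in>J. \<forall>i'\<in>J. i < i' \<longrightarrow> {i..i'} \<subseteq> J \<or> {..<k} - {i<..<i'} \<subseteq> J)"

text \<open>Shifts that get compared differ by at most \<open>4 * s\<close>, so their residues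
  modulo \<open>g0\<close> determine them. \<open>I_card\<close> is there because up to
  \<open>s\<close> rows may contain more than one queried edge, and every factor must be visible in
  some other row. \<open>I_miss\<close> keeps the moduli below half of \<open>G\<close>, and
  \<open>M\<close> exceeds the number of remembered variables.\<close>

locale compressed_cylinder =
  fixes k m s M :: nat and g0 :: int and g :: "nat \<Rightarrow> int" and I :: "nat \<Rightarrow> nat set"
  assumes k: "2 \<le> k"
    and g0: "4 * int s < g0" "2 \<le> g0"
    and g: "\<And>j. j < m \<Longrightarrow> 2 \<le> g j"
    and coprime0: "\<And>j. j < m \<Longrightarrow> coprime g0 (g j)"
    and coprime: "\<And>i j. i < m \<Longrightarrow> j < m \<Longrightarrow> i \<noteq> j \<Longrightarrow> coprime (g i) (g j)"
    and I_sub: "\<And>j. j < m \<Longrightarrow> I j \<subseteq> {..<k}"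
    and I_card: "\<And>j. j < m \<Longrightarrow> s < card (I j)"
    and I_arc: "\<And>j. j < m \<Longrightarrow> arc_like k (I j)"
    and I_miss: "\<And>i. i < k \<Longrightarrow> \<exists>j<m. i \<notin> I j"
    and M: "k + s < M"
begin

section \<open>Moduli and representatives of edges\<close>

definition pre :: "nat \<Rightarrow> nat" where "pre i = (if i = 0 then k - 1 else i - 1)"
definition nxt :: "nat \<Rightarrow> nat" where "nxt i = (if i = k - 1 then 0 else Suc i)"

definition p :: "nat \<Rightarrow> int" where "p i = g0 * (\<Prod>j\<in>{j. j < m \<and> i \<in> I j}. g j)"
text \<open>Vertical edge \<open>e\<close> joins the rows \<open>e\<close> and \<open>nxt e\<close>;
  by coprimality this is the greatest common divisor of their moduli.\<close>

definition q :: "nat \<Rightarrow> int" where "q e = g0 * (\<Prod>j\<in>{j. j < m \<and> e \<in> I j \<and> nxt e \<in> I j}. g j)"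
definition G :: int where "G = g0 * (\<Prod>j<m. g j)"
text \<open>Half of \<open>G\<close>, so that the columns 0 and \<open>T\<close> are at least
  \<open>T\<close> apart modulo \<open>G\<close> whichever way around.\<close>

definition T :: int where "T = G div 2"

text \<open>Column \<open>t\<close> ranges over \<open>{- M..T + M}\<close>; only the columns in \<open>{0..T}\<close> are compressed.\<close>

definition hrep :: "nat \<Rightarrow> int \<Rightarrow> int" where "hrep i t = (if 0 \<le> t \<and> t \<le> T then t mod p i else t)"
definition vrep :: "nat \<Rightarrow> int \<Rightarrow> int" where "vrep e t = (if 0 \<le> t \<and> t < T then t mod q e else t)"
definition H :: "nat \<Rightarrow> int \<Rightarrow> nat" where "H i t = hvar i (hrep i t)"
definition V :: "nat \<Rightarrow> int \<Rightarrow> nat" where "V e t = vvar e (vrep e t)"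

text \<open>\<open>H i t\<close> enters column \<open>t\<close> and \<open>H i (t + 1)\<close>
  leaves it. The columns \<open>0..<T\<close> therefore touch the horizontal edges
  \<open>0..T\<close> but only the vertical edges \<open>0..<T\<close>, which accounts for the
  different ranges in \<open>hrep\<close> and \<open>vrep\<close>.\<close>

definition vertex :: "nat \<Rightarrow> int \<Rightarrow> nat set" where
  "vertex i t = {H i t, H i (t + 1), V (pre i) t, V i t}"

definition formula :: "nat cnf" where
  "formula = (\<Union>i<k. \<Union>t\<in>{- int M..<T + int M}. parity_clauses (vertex i t) 0) \<union>
     (\<Union>i<k. parity_clauses {H i (- int M)} 0 \<union> parity_clauses {H i (T + int M)} (of_bool (i = 0)))"

lemma pre_less [simp]: "i < k \<Longrightarrow> pre i < k" and nxt_less [simp]: "i < k \<Longrightarrow> nxt i < k"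
  and pre_neq: "i < k \<Longrightarrow> pre i \<noteq> i" and nxt_pre [simp]: "i < k \<Longrightarrow> nxt (pre i) = i"
  and pre_nxt [simp]: "i < k \<Longrightarrow> pre (nxt i) = i"
  using k by (auto simp: pre_def nxt_def)

lemma sum_pre: "(\<Sum>i<k. f (pre i)) = (\<Sum>i<k. f i)"
  by (rule sum.reindex_bij_witness[of _ nxt pre]) auto

lemma sum_pre_add: "(\<Sum>i<k. f (pre i) + f i) = (0 :: bit)"
  by (simp add: sum.distrib sum_pre)

lemma k_pos: "0 < k" using k by simp

lemma prod_g_ge1: "A \<subseteq> {..<m} \<Longrightarrow> 1 \<le> (\<Prod>j\<in>A. g j)"
  using g by (intro prod_ge_1) force

lemma q_dvd_p: "e < k \<Longrightarrow> q e dvd p e" "i < k \<Longrightarrow> q (pre i) dvd p i"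
  unfolding p_def q_def
  by (intro mult_dvd_mono dvd_refl prod_dvd_prod_subset; auto)+

lemma p_ge: "g0 \<le> p i" and q_ge: "g0 \<le> q e" and G_ge: "g0 \<le> G"
proof -
  have *: "g0 \<le> g0 * (\<Prod>j\<in>A. g j)" if "A \<subseteq> {..<m}" for A
    using mult_left_mono[OF prod_g_ge1[OF that], of g0] g0 by simp
  show "g0 \<le> p i" "g0 \<le> q e" "g0 \<le> G" unfolding p_def q_def G_def by (rule *; auto)+
qed

lemma p_ge2: "2 \<le> p i" and q_pos: "0 < q e" and G_pos: "0 < G"
  using p_ge[of i] q_ge[of e] G_ge g0 by linarith+

text \<open>Row \<open>i\<close> omits a factor, and that factor is at least 2. A full period thus
  fits into the compressed columns, so representatives of compressed edges do not run into the
  tails.\<close>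

lemma p_le_T: assumes "i < k" shows "p i \<le> T"
proof -
  obtain j where j: "j < m" "i \<notin> I j" using I_miss assms by blast
  let ?A = "{j. j < m \<and> i \<in> I j}"
  have "(\<Prod>j\<in>insert j ?A. g j) dvd (\<Prod>j<m. g j)"
    using j by (intro prod_dvd_prod_subset) auto
  then have "(\<Prod>j\<in>insert j ?A. g j) \<le> (\<Prod>j<m. g j)"
    using prod_g_ge1[of "{..<m}"] by (intro zdvd_imp_le) auto
  moreover have "(\<Prod>j\<in>insert j ?A. g j) = g j * (\<Prod>j\<in>?A. g j)"
    using j by (subst prod.insert) auto
  moreover have "2 * (\<Prod>j\<in>?A. g j) \<le> g j * (\<Prod>j\<in>?A. g j)"
    using g[OF j(1)] order_trans[OF zero_le_one prod_g_ge1[of ?A]] by (intro mult_right_mono) auto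
  ultimately have "2 * (\<Prod>j\<in>?A. g j) \<le> (\<Prod>j<m. g j)" by linarith
  then have "g0 * (2 * (\<Prod>j\<in>?A. g j)) \<le> G"
    unfolding G_def using g0 by (intro mult_left_mono) auto
  then show ?thesis unfolding T_def p_def by (simp add: algebra_simps)
qed

lemma q_le_T: assumes "e < k" shows "q e \<le> T"
  using zdvd_imp_le[OF q_dvd_p(1)[OF assms]] p_le_T[OF assms] p_ge2[of e] by linarith

lemma T_pos: "0 < T"
  using p_le_T[OF k_pos] p_ge2[of 0] by linarith

lemma hrep_in: "i < k \<Longrightarrow> 0 \<le> t \<Longrightarrow> t \<le> T \<Longrightarrow> 0 \<le> hrep i t \<and> hrep i t < p i"
  using p_ge2[of i] by (simp add: hrep_def)

lemma vrep_in: "e < k \<Longrightarrow> 0 \<le> t \<Longrightarrow> t < T \<Longrightarrow> 0 \<le> vrep e t \<and> vrep e t < q e"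
  using q_pos[of e] by (simp add: vrep_def)

text \<open>Were the two horizontal edges of a vertex identified, they would cancel in its parity
  constraint; \<open>p i \<ge> 2\<close> prevents this.\<close>

lemma hrep_neq: assumes "i < k" shows "hrep i t \<noteq> hrep i (t + 1)"
proof (cases "0 \<le> t \<and> t < T")
  case True
  have "t mod p i \<noteq> (t + 1) mod p i"
  proof
    assume "t mod p i = (t + 1) mod p i"
    then have "p i dvd (t + 1) - t" by (metis mod_eq_dvd_iff)
    then show False using p_ge2[of i] zdvd_imp_le[of "p i" 1] by simp
  qed
  with True show ?thesis by (simp add: hrep_def)
next
  case False
  then show ?thesis
    using hrep_in[OF assms, of t] hrep_in[OF assms, of "t + 1"] p_le_T[OF assms]
    by (auto simp: hrep_def split: if_splits)
qed

lemma sum_vertex: assumes "i < k"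
  shows "sum \<sigma> (vertex i t) = (\<sigma> (H i t) + \<sigma> (H i (t + 1)) + (\<sigma> (V (pre i) t) + \<sigma> (V i t)) :: bit)"
    and "card (vertex i t) = 4"
  using hrep_neq[OF assms, of t] pre_neq[OF assms] unfolding vertex_def
  by (auto simp: H_def V_def add.assoc)

text \<open>
  The adversary hides the violated constraints in a single column \<open>x\<close> of one of the two tails;
  \<open>fine \<sigma> x\<close> says that all other constraints hold.
\<close>

definition tail :: "bool \<Rightarrow> int set" where
  "tail r = (if r then {T..<T + int M} else {- int M..<0})"

definition fine :: "(nat \<Rightarrow> bit) \<Rightarrow> int \<Rightarrow> bool" where
  "fine \<sigma> x \<longleftrightarrow>
     (\<forall>i<k. \<forall>t\<in>{- int M..<T + int M} - {x}.
        \<sigma> (H i t) + \<sigma> (H i (t + 1)) + (\<sigma> (V (pre i) t) + \<sigma> (V i t)) = 0) \<and>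
     (\<forall>i<k. \<sigma> (H i (- int M)) = 0 \<and> \<sigma> (H i (T + int M)) = of_bool (i = 0)) \<and>
     (\<forall>b i. \<sigma> (pvar b i) = 1)"

definition clamp :: "int \<Rightarrow> int" where "clamp t = max 0 (min T t)"

text \<open>Homogeneous solutions of the constraints, constant on both tails.\<close>

definition hsol :: "(nat \<Rightarrow> bit) \<Rightarrow> (nat \<Rightarrow> int \<Rightarrow> bit) \<Rightarrow> nat \<Rightarrow> int \<Rightarrow> bit" where
  "hsol c f i t = c i + (f (pre i) (clamp t) + f i (clamp t))"
definition vsol :: "(nat \<Rightarrow> int \<Rightarrow> bit) \<Rightarrow> nat \<Rightarrow> int \<Rightarrow> bit" where
  "vsol f e t = f e (clamp t) + f e (clamp (t + 1))"
definition periodic :: "(nat \<Rightarrow> int \<Rightarrow> bit) \<Rightarrow> bool" where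
  "periodic f \<longleftrightarrow> (\<forall>e<k. \<forall>a b. [a = b] (mod q e) \<longrightarrow> f e a = f e b)"

text \<open>The periods of \<open>f\<close> in both faces next to row \<open>i\<close> divide
  \<open>p i\<close>, so a homogeneous solution takes equal values on identified edges and is a
  legitimate change of the compressed variables.\<close>

lemma hsol_hrep: assumes "periodic f" "i < k" shows "hsol c f i (hrep i t) = hsol c f i t"
proof (cases "0 \<le> t \<and> t \<le> T")
  case True
  then have "clamp (hrep i t) = t mod p i" "clamp t = t"
    using hrep_in[OF assms(2), of t] p_le_T[OF assms(2)] by (auto simp: clamp_def hrep_def)
  moreover have "f e (t mod p i) = f e t" if "q e dvd p i" "e < k" for e
  proof -
    have "[t mod p i = t] (mod q e)"
      using that by (metis cong_dvd_modulus cong_mod_left cong_refl)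
    then show ?thesis using assms(1) that by (simp add: periodic_def)
  qed
  ultimately show ?thesis
    using assms(2) q_dvd_p by (simp add: hsol_def)
qed (auto simp: hrep_def)

lemma vsol_vrep: assumes "periodic f" "e < k" shows "vsol f e (vrep e t) = vsol f e t"
proof (cases "0 \<le> t \<and> t < T")
  case True
  then have "clamp (vrep e t) = t mod q e" "clamp t = t" "clamp (t + 1) = t + 1"
    "clamp (vrep e t + 1) = t mod q e + 1"
    using vrep_in[OF assms(2), of t] q_le_T[OF assms(2)] by (auto simp: clamp_def vrep_def)
  moreover have t: "[t mod q e = t] (mod q e)" by (simp only: cong_mod_left cong_refl)
  moreover have "[t mod q e + 1 = t + 1] (mod q e)" by (rule cong_add[OF t cong_refl])
  ultimately show ?thesis
    using assms by (simp add: vsol_def periodic_def)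
qed (auto simp: vrep_def)

text \<open>Here \<open>f\<close> is a set of faces of the cylinder: \<open>f e t\<close> is the
  face between the rows \<open>e\<close> and \<open>nxt e\<close> and the columns
  \<open>t - 1\<close> and \<open>t\<close>. The solution is the boundary of this set plus the
  complete rows selected by \<open>c\<close>, hence a cycle.\<close>

lemma sol_vertex: "hsol c f i t + hsol c f i (t + 1) = vsol f (pre i) t + vsol f i t"
proof -
  have "(c :: bit) + (a + b) + (c + (a' + b')) = (a + a') + (b + b')" for a a' b b' c
    by (cases a; cases a'; cases b; cases b'; cases c) simp_all
  then show ?thesis by (simp add: hsol_def vsol_def)
qed

text \<open>Each face borders two horizontal edges of its column, so faces cancel and only the
  complete rows contribute.\<close>

lemma sum_hsol: "(\<Sum>i<k. hsol c f i t) = (\<Sum>i<k. c i)"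
proof -
  have "(\<Sum>i<k. hsol c f i t) = (\<Sum>i<k. c i) + (\<Sum>i<k. f (pre i) (clamp t) + f i (clamp t))"
    by (simp add: hsol_def sum.distrib)
  then show ?thesis using sum_pre_add[of "\<lambda>i. f i (clamp t)"] by simp
qed

section \<open>Moving the violated column\<close>

lemma fine_column_parity:
  assumes "fine \<sigma> x" "- int M \<le> x" "x < T + int M"
  shows "(\<Sum>i<k. \<sigma> (H i x) + \<sigma> (H i (x + 1))) = 1"
proof -
  define P where "P t = (\<Sum>i<k. \<sigma> (H i t))" for t
  have step: "P (t + 1) = P t" if "- int M \<le> t" "t < T + int M" "t \<noteq> x" for t
  proof -
    have "P t + P (t + 1) = (\<Sum>i<k. \<sigma> (V (pre i) t) + \<sigma> (V i t))"
      unfolding P_def sum.distrib[symmetric]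
      using assms(1) that by (intro sum.cong) (auto simp: fine_def bit_add_eq_0_iff)
    also have "\<dots> = 0" by (rule sum_pre_add)
    finally show ?thesis by (simp add: bit_add_eq_0_iff)
  qed
  have "P (- int M + int n) = 0" if "- int M + int n \<le> x" for n
    using that
  proof (induction n)
    case 0
    show ?case using assms(1) by (simp add: P_def fine_def)
  next
    case (Suc n)
    then show ?case using step[of "- int M + int n"] assms(3) by (simp add: algebra_simps)
  qed
  from this[of "nat (x + int M)"] have "P x = 0" using assms(2) by simp
  have "P (T + int M - int n) = 1" if "x < T + int M - int n" for n
    using that
  proof (induction n)
    case 0
    have "P (T + int M) = (\<Sum>i<k. of_bool (i = 0))"
      unfolding P_def using assms(1) by (intro sum.cong) (auto simp: fine_def)
    also have "\<dots> = 1" using k_pos by (simp add: sum.delta)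
    finally show ?case by simp
  next
    case (Suc n)
    then show ?case using step[of "T + int M - int (Suc n)"] assms(2) by (simp add: algebra_simps)
  qed
  from this[of "nat (T + int M - (x + 1))"] have "P (x + 1) = 1" using assms(3) by simp
  with \<open>P x = 0\<close> show ?thesis by (simp add: P_def sum.distrib)
qed

text \<open>Prefix sums solve the equations along the cycle, and the hypothesis closes it at row 0.
  This is how the vertical edges are chosen in the column that is to be repaired.\<close>

lemma cyclic_potential:
  fixes D :: "nat \<Rightarrow> bit"
  assumes "(\<Sum>i<k. D i) = 0"
  shows "\<exists>w. \<forall>i<k. w (pre i) + w i = D i"
proof -
  define w where "w e = (\<Sum>l\<in>{1..e}. D l)" for e
  have "w (pre i) + w i = D i" if "i < k" for i
  proof (cases i)
    case 0
    have "{..<k} = insert 0 {1..k - 1}" using k_pos by auto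
    then have "(\<Sum>i<k. D i) = D 0 + w (k - 1)" by (simp add: w_def)
    then show ?thesis using assms 0 by (simp add: pre_def w_def bit_add_eq_0_iff)
  next
    case (Suc l)
    then show ?thesis by (simp add: pre_def w_def)
  qed
  then show ?thesis by blast
qed

lemma tail_cases: "x \<in> tail r \<Longrightarrow> - int M \<le> x \<and> x < T + int M \<and> (x < 0 \<or> T \<le> x)"
  using T_pos by (auto simp: tail_def split: if_splits)

text \<open>The end points lie in the tails, so identified edges are either all between them or all
  outside; a change may be cut off at \<open>x\<close> and \<open>y\<close> without contradicting
  the identification.\<close>

lemma hrep_between:
  assumes "x \<in> tail r" "y \<in> tail r'" "i < k"
  shows "x < hrep i t \<and> hrep i t \<le> y \<longleftrightarrow> x < t \<and> t \<le> y"
  using tail_cases[OF assms(1)] tail_cases[OF assms(2)] hrep_in[OF assms(3), of t] p_le_T[OF assms(3)]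
  by (cases "0 \<le> t \<and> t \<le> T") (auto simp: hrep_def)

lemma vrep_between:
  assumes "x \<in> tail r" "y \<in> tail r'" "e < k"
  shows "x < vrep e t \<and> vrep e t < y \<longleftrightarrow> x < t \<and> t < y" "vrep e t = x \<longleftrightarrow> t = x"
  using tail_cases[OF assms(1)] tail_cases[OF assms(2)] vrep_in[OF assms(3), of t] q_le_T[OF assms(3)]
  by (cases "0 \<le> t \<and> t < T"; auto simp: vrep_def)+

text \<open>
  Adding a homogeneous solution between the columns \<open>x\<close> and \<open>y\<close>, and correcting the vertical
  edges in column \<open>x\<close>, moves the violated constraints from column \<open>x\<close> to column \<open>y\<close>.
\<close>

lemma fine_move:
  assumes fine: "fine \<sigma> x" and x: "x \<in> tail r" and y: "y \<in> tail r'" and "x \<noteq> y"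
    and f: "periodic f" and c: "(\<Sum>i<k. c i) = 1"
    and hA: "\<And>i z. i < k \<Longrightarrow> hvar i z \<in> A \<Longrightarrow> min x y < z \<Longrightarrow> z \<le> max x y \<Longrightarrow> hsol c f i z = 0"
    and vA: "\<And>e z. e < k \<Longrightarrow> vvar e z \<in> A \<Longrightarrow> min x y < z \<Longrightarrow> z < max x y \<Longrightarrow> vsol f e z = 0"
    and xA: "\<And>e. e < k \<Longrightarrow> vvar e x \<notin> A"
  shows "\<exists>\<tau>. (\<forall>v\<in>A. \<tau> v = \<sigma> v) \<and> fine \<tau> y"
proof -
  define t1 where "t1 = min x y"
  define t2 where "t2 = max x y"
  have t12: "t1 < t2" using \<open>x \<noteq> y\<close> by (auto simp: t1_def t2_def)
  have tails: "\<exists>r. t1 \<in> tail r" "\<exists>r. t2 \<in> tail r" using x y by (auto simp: t1_def t2_def min_def max_def)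
  define hd where "hd i z = (if i < k \<and> t1 < z \<and> z \<le> t2 then hsol c f i z else 0)" for i z
  have hd: "hd i (hrep i t) = (if t1 < t \<and> t \<le> t2 then hsol c f i t else 0)" if "i < k" for i t
    using tails hrep_between[OF _ _ that, of t1 _ t2 _ t] hsol_hrep[OF f that, of c t] that
    by (auto simp: hd_def)
  \<comment> \<open>Of the two horizontal sides of column \<open>x\<close> only the one facing
    \<open>y\<close> is changed, by an odd number of edges; this repairs the parity of the
    column.\<close>
  have P: "(\<Sum>i<k. hd i (hrep i x) + hd i (hrep i (x + 1))) = 1"
  proof -
    have "(\<Sum>i<k. hd i (hrep i x) + hd i (hrep i (x + 1))) =
      (\<Sum>i<k. if x = t1 then hsol c f i (x + 1) else hsol c f i x)"
      using t12 by (intro sum.cong) (auto simp: hd t1_def t2_def)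
    also have "\<dots> = 1" using c by (cases "x = t1") (simp_all add: sum_hsol)
    finally show ?thesis .
  qed
  define D where "D i = (\<sigma> (H i x) + \<sigma> (H i (x + 1))) + (hd i (hrep i x) + hd i (hrep i (x + 1)))" for i
  have "(\<Sum>i<k. D i) = 0"
    unfolding D_def sum.distrib[of "\<lambda>i. \<sigma> (H i x) + \<sigma> (H i (x + 1))"]
    using fine_column_parity[OF fine] tail_cases[OF x] P by simp
  then obtain w where w: "\<And>i. i < k \<Longrightarrow> w (pre i) + w i = D i"
    using cyclic_potential by blast
  \<comment> \<open>In column \<open>x\<close> the summand \<sigma> cancels the old value, so that
    the new value is \<open>w e\<close>.\<close>
  define vd where "vd e z = (if e < k \<and> z = x then w e + \<sigma> (vvar e x)
    else if e < k \<and> t1 < z \<and> z < t2 then vsol f e z else 0)" for e z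
  have xt: "\<not> (t1 < x \<and> x < t2)" by (auto simp: t1_def t2_def)
  have vd: "vd e (vrep e t) = (if t = x then w e + \<sigma> (V e x)
      else if t1 < t \<and> t < t2 then vsol f e t else 0)" if "e < k" for e t
  proof -
    have "vrep e x = x" using vrep_between(2)[OF x y that, of x] by simp
    then show ?thesis
      using tails vrep_between(1)[OF _ _ that, of t1 _ t2 _ t] vsol_vrep[OF f that, of t] that
        vrep_between(2)[OF x y that, of t]
      by (auto simp: vd_def V_def)
  qed
  define \<tau> where "\<tau> v = \<sigma> v + assign hd vd 0 v" for v
  have \<tau>H: "\<tau> (H i t) = \<sigma> (H i t) + hd i (hrep i t)" for i t by (simp add: \<tau>_def H_def)
  have \<tau>V: "\<tau> (V i t) = \<sigma> (V i t) + vd i (vrep i t)" for i t by (simp add: \<tau>_def V_def)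
  have "\<tau> v = \<sigma> v" if "v \<in> A" for v
  proof -
    have "assign hd vd 0 v = 0"
    proof (rule assign_eq_0)
      show "hd i z = 0" if "v = hvar i z" for i z
        using hA[of i z] \<open>v \<in> A\<close> that by (auto simp: hd_def t1_def t2_def)
      show "vd e z = 0" if "v = vvar e z" for e z
        using vA[of e z] xA[of e] \<open>v \<in> A\<close> that by (auto simp: vd_def t1_def t2_def)
    qed
    then show ?thesis by (simp add: \<tau>_def)
  qed
  moreover have "fine \<tau> y"
    unfolding fine_def
  proof (intro conjI allI impI ballI)
    fix i t assume i: "i < k" and t: "t \<in> {- int M..<T + int M} - {y}"
    show "\<tau> (H i t) + \<tau> (H i (t + 1)) + (\<tau> (V (pre i) t) + \<tau> (V i t)) = 0"
    proof (cases "t = x")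
      case True
      have "\<tau> (H i x) + \<tau> (H i (x + 1)) = D i"
        by (simp add: \<tau>H D_def add_ac)
      moreover have "\<tau> (V e x) = w e" if "e < k" for e
        using that by (simp add: \<tau>V vd add.commute[of "w e"])
      ultimately show ?thesis using w[OF i] i True by simp
    next
      case False
      have inner: "t1 < t \<and> t < t2 \<longleftrightarrow> t1 < t \<and> t \<le> t2" "t1 < t + 1 \<and> t + 1 \<le> t2 \<longleftrightarrow> t1 < t \<and> t < t2"
        using False t by (auto simp: t1_def t2_def)
      have 0: "\<sigma> (H i t) + \<sigma> (H i (t + 1)) + (\<sigma> (V (pre i) t) + \<sigma> (V i t)) = 0"
        using fine i t False by (simp add: fine_def)
      have "hd i (hrep i t) + hd i (hrep i (t + 1)) = vd (pre i) (vrep (pre i) t) + vd i (vrep i t)"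
        using inner i False by (auto simp: hd vd sol_vertex)
      moreover have "a + b + (c + d) = 0 \<Longrightarrow> a' + b' = c' + d' \<Longrightarrow>
        (a + a') + (b + b') + ((c + c') + (d + d')) = 0" for a b c d a' b' c' d' :: bit
        by (cases a; cases b; cases c; cases d; cases a'; cases b'; cases c'; cases d') simp_all
      ultimately show ?thesis unfolding \<tau>H \<tau>V using 0 by blast
    qed
  next
    fix i assume i: "i < k"
    have "\<not> t1 < - int M" "\<not> T + int M \<le> t2" using tails tail_cases by force+
    then show "\<tau> (H i (- int M)) = 0" "\<tau> (H i (T + int M)) = of_bool (i = 0)"
      using fine i unfolding \<tau>H by (auto simp: hd fine_def)
  next
    fix b i show "\<tau> (pvar b i) = 1" using fine by (simp add: \<tau>_def fine_def)
  qed
  ultimately show ?thesis by blast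
qed


subsection \<open>Locating a crossing set of variables\<close>

text \<open>
  A crossing set of variables determines the parity of every column among the homogeneous
  solutions.  Each row must then contain one of its variables, and the rows which contain only
  one agree on the time that the set sits at, up to \<open>s\<close>.
\<close>

definition crossing :: "nat set \<Rightarrow> bool" where
  "crossing A \<longleftrightarrow> (\<nexists>c f. periodic f \<and> (\<Sum>i<k. c i) = 1 \<and>
     (\<forall>i<k. \<forall>z. hvar i z \<in> A \<longrightarrow> hsol c f i z = 0) \<and>
     (\<forall>e<k. \<forall>z. vvar e z \<in> A \<longrightarrow> vsol f e z = 0))"

definition row :: "nat set \<Rightarrow> nat \<Rightarrow> int set" where "row A i = {z. hvar i z \<in> A}"
definition vert :: "nat set \<Rightarrow> (nat \<times> int) set" where "vert A = {(e, z). vvar e z \<in> A}"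
definition single :: "nat set \<Rightarrow> nat set" where "single A = {i. i < k \<and> card (row A i) = 1}"
text \<open>A variable knows only the representative of its column, so a position matters modulo
  \<open>p i\<close>; edges of the tails count as sitting at the nearer end.\<close>

definition pos :: "nat set \<Rightarrow> nat \<Rightarrow> int" where "pos A i = clamp (the_elem (row A i))"

lemma crossing_mono: "crossing A \<Longrightarrow> A \<subseteq> B \<Longrightarrow> crossing B"
  unfolding crossing_def by blast

lemma finite_row: "finite A \<Longrightarrow> finite (row A i)"
  unfolding row_def using finite_vimageI[of A "hvar i"] by (simp add: vimage_def inj_def)

lemma finite_vert: "finite A \<Longrightarrow> finite (vert A)"
  unfolding vert_def using finite_vimageI[of A "\<lambda>(e, z). vvar e z"]
  by (simp add: vimage_def inj_def case_prod_unfold prod_eq_iff)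

lemma row_mono: "A \<subseteq> B \<Longrightarrow> row A i \<subseteq> row B i"
  unfolding row_def by blast

lemma count_rows:
  assumes "finite A"
  shows "(\<Sum>i<k. card (row A i)) + card (vert A) \<le> card A"
proof -
  have "(\<Sum>i<k. card (row A i)) = card (SIGMA i:{..<k}. row A i)"
    by (simp add: finite_row[OF assms])
  also have "\<dots> = card ((\<lambda>(i, z). hvar i z) ` (SIGMA i:{..<k}. row A i))"
    by (rule card_image[symmetric]) (auto simp: inj_on_def)
  finally have 1: "(\<Sum>i<k. card (row A i)) = \<dots>" .
  have 2: "card (vert A) = card ((\<lambda>(e, z). vvar e z) ` vert A)"
    by (rule card_image[symmetric]) (auto simp: inj_on_def)
  have "card ((\<lambda>(i, z). hvar i z) ` (SIGMA i:{..<k}. row A i)) + card ((\<lambda>(e, z). vvar e z) ` vert A)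
     = card ((\<lambda>(i, z). hvar i z) ` (SIGMA i:{..<k}. row A i) \<union> (\<lambda>(e, z). vvar e z) ` vert A)"
    using assms by (intro card_Un_disjoint[symmetric]) (auto simp: finite_row finite_vert)
  also have "\<dots> \<le> card A"
    using assms by (intro card_mono) (auto simp: row_def vert_def)
  finally show ?thesis using 1 2 by simp
qed

text \<open>An untouched row, taken as a complete horizontal line, is itself an odd homogeneous
  solution.\<close>

lemma crossing_row:
  assumes "crossing A" "i < k"
  shows "row A i \<noteq> {}"
proof
  assume "row A i = {}"
  then have "\<exists>c f. periodic f \<and> (\<Sum>i<k. c i) = 1 \<and>
     (\<forall>i<k. \<forall>z. hvar i z \<in> A \<longrightarrow> hsol c f i z = 0) \<and>
     (\<forall>e<k. \<forall>z. vvar e z \<in> A \<longrightarrow> vsol f e z = 0)"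
    using assms(2) by (intro exI[of _ "\<lambda>l. of_bool (l = i)"] exI[of _ "\<lambda>_ _. 0"])
      (auto simp: row_def periodic_def hsol_def vsol_def sum.delta)
  then show False using assms(1) unfolding crossing_def by blast
qed

text \<open>Each row uses up at least one of the \<open>k + s\<close> variables; only
  \<open>s\<close> remain for vertical edges and for further edges in a row.\<close>

lemma crossing_counts:
  assumes "crossing A" "finite A" "card A \<le> k + s"
  shows "card (vert A) \<le> s" "card ({..<k} - single A) \<le> s"
proof -
  have ge: "1 \<le> card (row A i)" if "i < k" for i
    using crossing_row[OF assms(1) that] finite_row[OF assms(2), of i] by (simp add: Suc_le_eq card_gt_0_iff)
  have "k = (\<Sum>i<k. 1)" by simp
  also have "\<dots> \<le> (\<Sum>i<k. card (row A i))" using ge by (intro sum_mono) auto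
  finally show "card (vert A) \<le> s" using count_rows[OF assms(2)] assms(3) by linarith
  have "{..<k} \<inter> {i. i \<notin> single A} = {..<k} - single A" by blast
  then have "k + card ({..<k} - single A) = (\<Sum>i<k. 1 + of_bool (i \<notin> single A))"
    by (subst sum.distrib) simp
  also have "\<dots> \<le> (\<Sum>i<k. card (row A i))"
    using ge by (intro sum_mono) (force simp: single_def)
  finally show "card ({..<k} - single A) \<le> s"
    using count_rows[OF assms(2)] assms(3) by linarith
qed

lemma single_row: "i \<in> single A \<Longrightarrow> \<exists>z. row A i = {z} \<and> pos A i = clamp z"
  unfolding single_def pos_def by (auto simp: card_1_singleton_iff)

text \<open>\<open>E\<close> is the edge set of a path in the cycle of rows, with end points \<open>i\<close> and \<open>i'\<close>.\<close>

definition joins :: "nat set \<Rightarrow> nat \<Rightarrow> nat \<Rightarrow> bool" where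
  "joins E i i' \<longleftrightarrow> E \<subseteq> {..<k} \<and> (\<forall>l<k. (pre l \<in> E) \<noteq> (l \<in> E) \<longleftrightarrow> l = i \<or> l = i')"

text \<open>Pigeonhole: the \<open>s + 1\<close> candidates are distinct modulo \<open>d\<close>,
  and each vertical edge excludes at most one of them.\<close>

lemma free_residue:
  fixes b d \<epsilon> :: int and A :: "nat set"
  assumes "finite A" "card (vert A) \<le> s" "int s < d" "\<epsilon> = 1 \<or> \<epsilon> = -1"
  shows "\<exists>a. 0 \<le> a \<and> a \<le> int s \<and> (\<forall>(e, z)\<in>vert A. \<not> [b + \<epsilon> * a = z] (mod d))"
proof (rule ccontr)
  assume "\<not> ?thesis"
  then have "\<forall>a\<in>{0..int s}. \<exists>v\<in>vert A. [b + \<epsilon> * a = snd v] (mod d)" by fastforce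
  then obtain h where h: "\<And>a. a \<in> {0..int s} \<Longrightarrow> h a \<in> vert A \<and> [b + \<epsilon> * a = snd (h a)] (mod d)"
    by metis
  have "inj_on h {0..int s}"
  proof (rule inj_onI)
    fix a a' assume a: "a \<in> {0..int s}" "a' \<in> {0..int s}" "h a = h a'"
    then have "[b + \<epsilon> * a = b + \<epsilon> * a'] (mod d)"
      using h by (metis cong_sym cong_trans)
    then have "[\<epsilon> * a = \<epsilon> * a'] (mod d)" by (simp add: cong_add_lcancel)
    then have "\<epsilon> * a = \<epsilon> * a'"
      using assms a by (intro cong_abs_less_imp_eq[of _ _ d]) auto
    then show "a = a'" using assms(4) by auto
  qed
  then have "card {0..int s} \<le> card (vert A)"
    using h assms(1) by (intro card_inj_on_le[of h]) (auto simp: finite_vert)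
  then show False using assms(2) by simp
qed

text \<open>
  If the two rows were far apart modulo \<open>d\<close>, the indicator function of an arc of residues around
  the position in row \<open>i'\<close>, with ends avoiding the vertical edges in \<open>A\<close>, would define a
  homogeneous solution of odd parity that vanishes on \<open>A\<close>.
\<close>

lemma crossing_joined_rows:
  assumes A: "crossing A" "finite A" "card A \<le> k + s"
    and i: "i \<in> single A" "i' \<in> single A" "i \<noteq> i'"
    and E: "joins E i i'" "\<And>e. e \<in> E \<Longrightarrow> d dvd q e" and d: "int s < d"
  shows "\<exists>\<eta>. \<bar>\<eta>\<bar> \<le> int s \<and> [pos A i = pos A i' + \<eta>] (mod d)"
proof (rule ccontr)
  assume contra: "\<not> ?thesis"
  let ?r = "pos A i'"
  obtain z z' where z: "row A i = {z}" "pos A i = clamp z" "row A i' = {z'}" "?r = clamp z'"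
    using single_row i by meson
  note vert = crossing_counts(1)[OF A]
  obtain a where a: "0 \<le> a" "a \<le> int s" "\<forall>(e, z)\<in>vert A. \<not> [?r + a = z] (mod d)"
    using free_residue[OF A(2) vert d, of 1 ?r] by auto
  \<comment> \<open>A vertical edge in column \<open>y\<close> compares the faces \<open>y\<close>
    and \<open>y + 1\<close>, so the left end of the arc is crossed one column before it: the search
    starts at \<open>?r - 1\<close>.\<close>
  obtain b where b: "0 \<le> b" "b \<le> int s" "\<forall>(e, z)\<in>vert A. \<not> [?r - 1 - b = z] (mod d)"
    using free_residue[OF A(2) vert d, of "-1" "?r - 1"] by auto
  define h :: "int \<Rightarrow> bit" where "h x = of_bool (\<exists>y. - b \<le> y \<and> y \<le> a \<and> [x = ?r + y] (mod d))" for x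
  have h_cong: "h x = h x'" if "[x = x'] (mod d)" for x x'
    using that unfolding h_def by (metis cong_sym cong_trans)
  have h_i: "h (pos A i) = 0"
    using contra a b by (force simp: h_def)
  have h_i': "h ?r = 1"
    using a b by (auto simp: h_def intro!: exI[of _ 0])
  have h_step: "h x = h (x + 1)"
    if "\<not> [?r + a = x] (mod d)" "\<not> [?r - 1 - b = x] (mod d)" for x
  proof -
    have "\<exists>y. - b \<le> y \<and> y \<le> a \<and> [x + 1 = ?r + y] (mod d)"
      if y: "- b \<le> y" "y \<le> a" "[x = ?r + y] (mod d)" for y
    proof (intro exI[of _ "y + 1"] conjI)
      have "y \<noteq> a" using y \<open>\<not> [?r + a = x] (mod d)\<close> cong_sym by blast
      then show "y + 1 \<le> a" using y by simp
      show "[x + 1 = ?r + (y + 1)] (mod d)" using cong_add[OF y(3) cong_refl[of 1]] by (simp add: add_ac)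
    qed (use y in simp)
    moreover have "\<exists>y. - b \<le> y \<and> y \<le> a \<and> [x = ?r + y] (mod d)"
      if y: "- b \<le> y" "y \<le> a" "[x + 1 = ?r + y] (mod d)" for y
    proof (intro exI[of _ "y - 1"] conjI)
      have *: "[x = ?r + (y - 1)] (mod d)" using cong_diff[OF y(3) cong_refl[of 1]] by (simp add: algebra_simps)
      have "y \<noteq> - b"
      proof
        assume "y = - b"
        then have "[x = ?r - 1 - b] (mod d)" using * by (simp add: algebra_simps)
        then show False using \<open>\<not> [?r - 1 - b = x] (mod d)\<close> cong_sym by blast
      qed
      then show "- b \<le> y - 1" using y by simp
      show "[x = ?r + (y - 1)] (mod d)" by (rule *)
    qed (use y in simp)
    ultimately have "(\<exists>y. - b \<le> y \<and> y \<le> a \<and> [x = ?r + y] (mod d)) \<longleftrightarrow>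
        (\<exists>y. - b \<le> y \<and> y \<le> a \<and> [x + 1 = ?r + y] (mod d))" by blast
    then show ?thesis by (simp only: h_def)
  qed
  \<comment> \<open>The complete row \<open>i'\<close> plus the boundary of the arc on the faces in
    \<open>E\<close>. In row \<open>i'\<close> the two cancel at the position, in row
    \<open>i\<close> the arc misses the position, and in other rows the boundary has no horizontal
    edges.\<close>
  define f where "f e = (if e \<in> E then h else (\<lambda>_. 0))" for e
  define c :: "nat \<Rightarrow> bit" where "c l = of_bool (l = i')" for l
  have ik: "i < k" "i' < k" using i by (auto simp: single_def)
  have "periodic f"
    unfolding periodic_def
  proof (intro allI impI)
    fix e x x' assume "[x = x'] (mod q e)"
    then have "h x = h x'" if "e \<in> E" using E(2)[OF that] by (intro h_cong) (rule cong_dvd_modulus)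
    then show "f e x = f e x'" by (simp add: f_def)
  qed
  moreover have "(\<Sum>l<k. c l) = 1" using ik by (simp add: c_def sum.delta)
  moreover have "hsol c f l y = 0" if "l < k" "hvar l y \<in> A" for l y
  proof -
    have "(pre l \<in> E) \<noteq> (l \<in> E) \<longleftrightarrow> l = i \<or> l = i'" using E(1) that(1) by (simp add: joins_def)
    then have edges: "f (pre l) x + f l x = (if l = i \<or> l = i' then h x else 0)" for x
      by (cases "pre l \<in> E"; cases "l \<in> E") (simp_all add: f_def)
    have "y \<in> row A l" using that by (simp add: row_def)
    moreover have "hsol c f l y = of_bool (l = i') + (if l = i \<or> l = i' then h (clamp y) else 0)"
      by (simp add: hsol_def edges c_def)
    ultimately show ?thesis
      using z h_i h_i' i(3) by auto
  qed
  moreover have "vsol f e y = 0" if "e < k" "vvar e y \<in> A" for e y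
  proof (cases "e \<in> E")
    case True
    have ey: "(e, y) \<in> vert A" using that by (simp add: vert_def)
    show ?thesis
    proof (cases "0 \<le> y \<and> y < T")
      case T: True
      have "h y = h (y + 1)" using a(3) b(3) ey by (intro h_step) auto
      with T True show ?thesis by (simp add: vsol_def f_def clamp_def)
    next
      case False
      then have "clamp (y + 1) = clamp y" using T_pos by (auto simp: clamp_def)
      then show ?thesis by (simp add: vsol_def)
    qed
  qed (simp add: vsol_def f_def)
  ultimately show False using A(1) unfolding crossing_def by blast
qed

lemma joins_interval:
  assumes "i < i'" "i' < k"
  shows "joins {i..<i'} i i'" "joins ({..<k} - {i..<i'}) i i'"
  using assms k by (auto simp: joins_def pre_def)

lemma joins_sym: "joins E i i' \<Longrightarrow> joins E i' i"
  by (auto simp: joins_def)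

lemma arc_joins:
  assumes "arc_like k J" "i \<in> J" "i' \<in> J" "i < i'" "J \<subseteq> {..<k}"
  shows "\<exists>E. joins E i i' \<and> (\<forall>e\<in>E. e \<in> J \<and> nxt e \<in> J)"
proof -
  have i': "i' < k" using assms by auto
  consider "{i..i'} \<subseteq> J" | "{..<k} - {i<..<i'} \<subseteq> J" using assms unfolding arc_like_def by blast
  then show ?thesis
  proof cases
    case 1
    then show ?thesis
      using joins_interval(1)[OF assms(4) i'] i'
      by (intro exI[of _ "{i..<i'}"]) (auto simp: nxt_def subset_iff)
  next
    case 2
    have "e \<in> J \<and> nxt e \<in> J" if "e \<in> {..<k} - {i..<i'}" for e
    proof -
      have "e < k" "e < i \<or> i' \<le> e" using that by auto
      then have "e \<in> {..<k} - {i<..<i'}" "nxt e \<in> {..<k} - {i<..<i'}"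
        using assms(4) i' by (auto simp: nxt_def)
      then show ?thesis using 2 by blast
    qed
    then show ?thesis using joins_interval(2)[OF assms(4) i'] by blast
  qed
qed

lemma g_dvd_q:
  assumes "j < m" "e \<in> I j" "nxt e \<in> I j"
  shows "g0 * g j dvd q e"
  unfolding q_def using assms by (intro mult_dvd_mono dvd_refl dvd_prodI) auto

text \<open>Modulo \<open>g0\<close> any path of rows may be used, modulo \<open>g0 * g j\<close>
  one inside \<open>I j\<close>. The two shifts agree modulo \<open>g0\<close> and are at most
  \<open>s\<close>, hence equal, so a single shift serves all common factors.\<close>

lemma crossing_rows:
  assumes A: "crossing A" "finite A" "card A \<le> k + s"
    and i: "i \<in> single A" "i' \<in> single A"
  shows "\<exists>\<eta>. \<bar>\<eta>\<bar> \<le> int s \<and> [pos A i = pos A i' + \<eta>] (mod g0) \<and>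
    (\<forall>j<m. i \<in> I j \<longrightarrow> i' \<in> I j \<longrightarrow> [pos A i = pos A i' + \<eta>] (mod g j))"
proof (cases "i = i'")
  case True
  then show ?thesis by (intro exI[of _ 0]) auto
next
  case False
  have ik: "i < k" "i' < k" using i by (auto simp: single_def)
  have "\<exists>E. joins E i i'"
    using joins_interval(1)[of i i'] joins_sym[OF joins_interval(1)[of i' i]] ik False
    by (metis linorder_neq_iff)
  then obtain E where "joins E i i'" by blast
  then obtain \<eta> where \<eta>: "\<bar>\<eta>\<bar> \<le> int s" "[pos A i = pos A i' + \<eta>] (mod g0)"
    using crossing_joined_rows[OF A i False, of E g0] g0 by (auto simp: q_def)
  have "[pos A i = pos A i' + \<eta>] (mod g j)" if j: "j < m" "i \<in> I j" "i' \<in> I j" for j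
  proof -
    obtain E where E: "joins E i i'" "\<forall>e\<in>E. e \<in> I j \<and> nxt e \<in> I j"
    proof (cases "i < i'")
      case True
      then show ?thesis using arc_joins[OF I_arc[OF j(1)] j(2,3)] I_sub[OF j(1)] that by blast
    next
      case f: False
      then have "i' < i" using False by simp
      then show ?thesis
        using arc_joins[OF I_arc[OF j(1)] j(3,2)] I_sub[OF j(1)] that joins_sym by blast
    qed
    have "g0 * 1 \<le> g0 * g j" using g0 g[OF j(1)] by (intro mult_left_mono) auto
    then have "int s < g0 * g j" using g0 by linarith
    then obtain \<eta>' where \<eta>': "\<bar>\<eta>'\<bar> \<le> int s" "[pos A i = pos A i' + \<eta>'] (mod g0 * g j)"
      using crossing_joined_rows[OF A i False E(1), of "g0 * g j"] E(2) g_dvd_q[OF j(1)] by blast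
    have "[pos A i = pos A i' + \<eta>'] (mod g0)"
      by (rule cong_dvd_modulus[OF \<eta>'(2) dvd_triv_left])
    moreover have "[pos A i = pos A i' + \<eta>'] (mod g j)"
      by (rule cong_dvd_modulus[OF \<eta>'(2) dvd_triv_right])
    moreover have "\<eta>' = \<eta>"
    proof (rule cong_abs_less_imp_eq[of _ _ g0])
      have "[pos A i' + \<eta>' = pos A i' + \<eta>] (mod g0)"
        by (rule cong_trans[OF cong_sym[OF calculation(1)] \<eta>(2)])
      then show "[\<eta>' = \<eta>] (mod g0)" by (simp add: cong_add_lcancel)
      show "\<bar>\<eta>' - \<eta>\<bar> < g0" using \<eta>(1) \<eta>'(1) g0 by linarith
    qed
    ultimately show ?thesis by simp
  qed
  with \<eta> show ?thesis by blast
qed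

text \<open>The times at which a crossing set may be said to sit, closed under adding multiples of
  \<open>G\<close>.\<close>

definition Loc :: "nat set \<Rightarrow> int set" where
  "Loc A = {t. \<forall>i\<in>single A. \<exists>\<eta>. \<bar>\<eta>\<bar> \<le> int s \<and> [pos A i = t + \<eta>] (mod p i)}"

lemma single_meets:
  assumes "crossing A" "finite A" "card A \<le> k + s" "j < m"
  shows "single A \<inter> I j \<noteq> {}"
proof
  assume "single A \<inter> I j = {}"
  then have "I j \<subseteq> {..<k} - single A" using I_sub[OF assms(4)] by blast
  then have "card (I j) \<le> card ({..<k} - single A)" by (intro card_mono) auto
  then show False using I_card[OF assms(4)] crossing_counts(2)[OF assms(1-3)] by linarith
qed

lemma m_pos: "0 < m"
  using I_miss[OF k_pos] by auto

lemma cong_p: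
  assumes "[x = y] (mod g0)" "\<And>j. j < m \<Longrightarrow> i \<in> I j \<Longrightarrow> [x = y] (mod g j)"
  shows "[x = y] (mod p i)"
  unfolding p_def
proof (rule coprime_cong_mult)
  show "coprime g0 (\<Prod>j\<in>{j. j < m \<and> i \<in> I j}. g j)" using coprime0 by (intro prod_coprime_right) auto
  show "[x = y] (mod (\<Prod>j\<in>{j. j < m \<and> i \<in> I j}. g j))"
    by (rule cong_prod_coprime) (use assms(2) coprime in \<open>auto simp only: mem_Collect_eq finite_Collect_conjI finite_Collect_less_nat\<close>)
qed (rule assms(1))

lemma cong_G:
  assumes "[x = y] (mod g0)" "\<And>j. j < m \<Longrightarrow> [x = y] (mod g j)"
  shows "[x = y] (mod G)"
  unfolding G_def
proof (rule coprime_cong_mult)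
  show "coprime g0 (\<Prod>j<m. g j)" using coprime0 by (intro prod_coprime_right) auto
  show "[x = y] (mod (\<Prod>j<m. g j))"
    by (rule cong_prod_coprime) (use assms(2) coprime in \<open>auto simp only: lessThan_iff finite_lessThan\<close>)
qed (rule assms(1))

text \<open>All shifts are measured modulo \<open>g0\<close> from one row \<open>i0\<close>. After
  subtracting them, the residue required modulo \<open>g j\<close> no longer depends on the row
  \<open>r j\<close> chosen to represent that factor.\<close>

lemma Loc_nonempty:
  assumes A: "crossing A" "finite A" "card A \<le> k + s"
  shows "Loc A \<noteq> {}"
proof -
  obtain i0 where i0: "i0 \<in> single A" using single_meets[OF A m_pos] by blast
  obtain \<epsilon> where \<epsilon>: "\<And>i. i \<in> single A \<Longrightarrow> \<bar>\<epsilon> i\<bar> \<le> int s \<and> [pos A i = pos A i0 + \<epsilon> i] (mod g0)"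
  proof -
    have "\<forall>i. \<exists>\<eta>. i \<in> single A \<longrightarrow> \<bar>\<eta>\<bar> \<le> int s \<and> [pos A i = pos A i0 + \<eta>] (mod g0)"
      using crossing_rows[OF A _ i0] by blast
    from choice[OF this] show ?thesis using that by blast
  qed
  obtain r where r: "\<And>j. j < m \<Longrightarrow> r j \<in> single A \<inter> I j"
  proof -
    have "\<forall>j. \<exists>i. j < m \<longrightarrow> i \<in> single A \<inter> I j" using single_meets[OF A] by blast
    from choice[OF this] show ?thesis using that by blast
  qed
  define gg where "gg j = (case j of 0 \<Rightarrow> g0 | Suc j \<Rightarrow> g j)" for j
  define u where "u j = (case j of 0 \<Rightarrow> pos A i0 | Suc j \<Rightarrow> pos A (r j) - \<epsilon> (r j))" for j
  have "coprime (gg i) (gg j)" if "i \<in> {..m}" "j \<in> {..m}" "i \<noteq> j" for i j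
    using that coprime0[of "i - 1"] coprime0[of "j - 1"] coprime[of "i - 1" "j - 1"]
    by (cases i; cases j) (simp_all add: gg_def coprime_commute)
  then have "\<exists>t. \<forall>j\<in>{..m}. [t = u j] (mod gg j)"
    by (rule chinese_remainder_int[OF finite_atMost])
  then obtain t where t: "\<forall>j\<in>{..m}. [t = u j] (mod gg j)" by blast
  have t0: "[t = pos A i0] (mod g0)" using bspec[OF t, of 0] by (simp add: gg_def u_def)
  have tj: "[t = pos A (r j) - \<epsilon> (r j)] (mod g j)" if "j < m" for j
  proof -
    have "[t = u (Suc j)] (mod gg (Suc j))" using t that by simp
    then show ?thesis by (simp only: gg_def u_def nat.case)
  qed
  have "[pos A i = t + \<epsilon> i] (mod p i)" if i: "i \<in> single A" for i
  proof (rule cong_p)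
    have "[t + \<epsilon> i = pos A i0 + \<epsilon> i] (mod g0)" by (rule cong_add[OF t0 cong_refl])
    from cong_trans[OF conjunct2[OF \<epsilon>[OF i]] cong_sym[OF this]]
    show "[pos A i = t + \<epsilon> i] (mod g0)" .
  next
    fix j assume j: "j < m" "i \<in> I j"
    have rj: "r j \<in> single A" "r j \<in> I j" using r[OF j(1)] by auto
    obtain \<eta> where \<eta>: "\<bar>\<eta>\<bar> \<le> int s" "[pos A i = pos A (r j) + \<eta>] (mod g0)"
        "[pos A i = pos A (r j) + \<eta>] (mod g j)"
      using crossing_rows[OF A i rj(1)] j rj(2) by blast
    have "\<eta> = \<epsilon> i - \<epsilon> (r j)"
    proof (rule cong_abs_less_imp_eq[of _ _ g0])
      have "[pos A (r j) + \<eta> = pos A i0 + \<epsilon> i] (mod g0)"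
        by (rule cong_trans[OF cong_sym[OF \<eta>(2)] conjunct2[OF \<epsilon>[OF i]]])
      from cong_diff[OF this conjunct2[OF \<epsilon>[OF rj(1)]]]
      show "[\<eta> = \<epsilon> i - \<epsilon> (r j)] (mod g0)" by simp
      show "\<bar>\<eta> - (\<epsilon> i - \<epsilon> (r j))\<bar> < g0" using \<eta>(1) \<epsilon>[OF i] \<epsilon>[OF rj(1)] g0 by linarith
    qed
    moreover have "[t + \<epsilon> i = pos A (r j) - \<epsilon> (r j) + \<epsilon> i] (mod g j)"
      by (rule cong_add[OF tj[OF j(1)] cong_refl])
    moreover from calculation have "pos A (r j) - \<epsilon> (r j) + \<epsilon> i = pos A (r j) + \<eta>" by simp
    ultimately have "[t + \<epsilon> i = pos A (r j) + \<eta>] (mod g j)" by (simp only:)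
    from cong_trans[OF \<eta>(3) cong_sym[OF this]] show "[pos A i = t + \<epsilon> i] (mod g j)" .
  qed
  then have "t \<in> Loc A" unfolding Loc_def using \<epsilon> by blast
  then show ?thesis by blast
qed

text \<open>In each single row two such times differ by a shift of at most \<open>2 * s\<close>. The
  residue modulo \<open>g0\<close> forces the same shift in all rows, and every factor occurs in one
  of them.\<close>

lemma Loc_unique:
  assumes A: "crossing A" "finite A" "card A \<le> k + s" and t: "t \<in> Loc A" "t' \<in> Loc A"
  shows "\<exists>\<eta>. \<bar>\<eta>\<bar> \<le> 2 * int s \<and> [t = t' + \<eta>] (mod G)"
proof -
  have diff: "\<exists>\<eta>. \<bar>\<eta>\<bar> \<le> 2 * int s \<and> [t = t' + \<eta>] (mod p i)" if i: "i \<in> single A" for i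
  proof -
    obtain a where a: "\<bar>a\<bar> \<le> int s" "[pos A i = t + a] (mod p i)"
      using t(1) i unfolding Loc_def by blast
    obtain b where b: "\<bar>b\<bar> \<le> int s" "[pos A i = t' + b] (mod p i)"
      using t(2) i unfolding Loc_def by blast
    have "[t + a - a = t' + b - a] (mod p i)"
      by (rule cong_diff[OF cong_trans[OF cong_sym[OF a(2)] b(2)] cong_refl])
    moreover have "t + a - a = t" "t' + b - a = t' + (b - a)" by simp_all
    ultimately have "[t = t' + (b - a)] (mod p i)" by (simp only:)
    moreover have "\<bar>b - a\<bar> \<le> 2 * int s" using a(1) b(1) by linarith
    ultimately have "\<bar>b - a\<bar> \<le> 2 * int s \<and> [t = t' + (b - a)] (mod p i)" by (rule conjI[rotated])
    then show ?thesis by (rule exI[of _ "b - a"])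
  qed
  obtain i0 where i0: "i0 \<in> single A" using single_meets[OF A m_pos] by blast
  obtain \<eta> where \<eta>: "\<bar>\<eta>\<bar> \<le> 2 * int s" "[t = t' + \<eta>] (mod p i0)" using diff[OF i0] by blast
  have g0p: "g0 dvd p i" for i by (simp add: p_def)
  have \<eta>0: "[t = t' + \<eta>] (mod g0)" by (rule cong_dvd_modulus[OF \<eta>(2) g0p])
  have "[t = t' + \<eta>] (mod g j)" if j: "j < m" for j
  proof -
    obtain i where i: "i \<in> single A" "i \<in> I j" using single_meets[OF A j] by blast
    obtain \<eta>' where \<eta>': "\<bar>\<eta>'\<bar> \<le> 2 * int s" "[t = t' + \<eta>'] (mod p i)" using diff[OF i(1)] by blast
    have "\<eta>' = \<eta>"
    proof (rule cong_abs_less_imp_eq[of _ _ g0])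
      have "[t = t' + \<eta>'] (mod g0)" by (rule cong_dvd_modulus[OF \<eta>'(2) g0p])
      from cong_trans[OF cong_sym[OF this] \<eta>0] have "[t' + \<eta>' = t' + \<eta>] (mod g0)" .
      then show "[\<eta>' = \<eta>] (mod g0)" by (simp add: cong_add_lcancel)
      show "\<bar>\<eta>' - \<eta>\<bar> < g0" using \<eta>(1) \<eta>'(1) g0 by linarith
    qed
    moreover have "g j dvd (\<Prod>j\<in>{j. j < m \<and> i \<in> I j}. g j)"
      using i(2) j by (intro dvd_prodI[of _ j g]) auto
    then have "g j dvd p i" unfolding p_def by (rule dvd_mult)
    with \<eta>'(2) have "[t = t' + \<eta>'] (mod g j)" by (rule cong_dvd_modulus)
    ultimately show ?thesis by (simp only:)
  qed
  with \<eta>0 have G: "[t = t' + \<eta>] (mod G)" by (rule cong_G)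
  show ?thesis by (rule exI[of _ \<eta>]) (rule conjI[OF \<eta>(1) G])
qed

text \<open>All rows of \<open>A\<close> are already nonempty, so a row that is single in
  \<open>B\<close> has the same edge in \<open>A\<close>; passing to \<open>B\<close> only drops
  conditions.\<close>

lemma Loc_mono:
  assumes "crossing A" "A \<subseteq> B" "finite B"
  shows "Loc A \<subseteq> Loc B"
proof -
  have *: "i \<in> single A \<and> pos A i = pos B i" if i: "i \<in> single B" for i
  proof -
    obtain z where z: "row B i = {z}" using single_row i by blast
    have "row A i \<noteq> {}" using crossing_row[OF assms(1)] i by (auto simp: single_def)
    then have "row A i = {z}" using row_mono[OF assms(2), of i] z by auto
    then show ?thesis using z i by (simp add: single_def pos_def)
  qed
  show ?thesis
  proof
    fix t assume t: "t \<in> Loc A"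
    have "\<exists>\<eta>. \<bar>\<eta>\<bar> \<le> int s \<and> [pos B i = t + \<eta>] (mod p i)" if "i \<in> single B" for i
    proof -
      have "i \<in> single A" and eq: "pos A i = pos B i" using *[OF that] by blast+
      then have "\<exists>\<eta>. \<bar>\<eta>\<bar> \<le> int s \<and> [pos A i = t + \<eta>] (mod p i)" using t unfolding Loc_def by blast
      then show ?thesis unfolding eq .
    qed
    then show "t \<in> Loc B" unfolding Loc_def by blast
  qed
qed

subsection \<open>The adversary\<close>

definition near :: "int \<Rightarrow> int \<Rightarrow> int \<Rightarrow> bool" where
  "near x t b \<longleftrightarrow> (\<exists>\<eta>. \<bar>\<eta>\<bar> \<le> b \<and> [t = x + \<eta>] (mod G))"

lemma near_trans: assumes "near x t b" "near t u b'" shows "near x u (b + b')"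
proof -
  obtain a where a: "\<bar>a\<bar> \<le> b" "[t = x + a] (mod G)"
    using assms(1) unfolding near_def by blast
  obtain a' where a': "\<bar>a'\<bar> \<le> b'" "[u = t + a'] (mod G)"
    using assms(2) unfolding near_def by blast
  have "[u = x + a + a'] (mod G)"
    by (rule cong_trans[OF a'(2) cong_add[OF a(2) cong_refl]])
  then have "[u = x + (a + a')] (mod G)" by (simp only: add.assoc)
  moreover have "\<bar>a + a'\<bar> \<le> b + b'" using a(1) a'(1) by linarith
  ultimately have "\<bar>a + a'\<bar> \<le> b + b' \<and> [u = x + (a + a')] (mod G)" by (rule conjI[rotated])
  then show ?thesis unfolding near_def by (rule exI[of _ "a + a'"])
qed

lemma near_sym: assumes "near x t b" shows "near t x b"
proof -
  obtain a where a: "\<bar>a\<bar> \<le> b" "[t = x + a] (mod G)" using assms unfolding near_def by blast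
  have "[x + a - a = t - a] (mod G)" by (rule cong_diff[OF cong_sym[OF a(2)] cong_refl])
  moreover have "x + a - a = x" "t - a = t + - a" by simp_all
  ultimately have "[x = t + - a] (mod G)" by (simp only:)
  then show ?thesis unfolding near_def using a(1) by (intro exI[of _ "-a"]) simp
qed

lemma ends_not_near: assumes "b < T" shows "\<not> near 0 T b"
proof
  assume "near 0 T b"
  then obtain a where a: "\<bar>a\<bar> \<le> b" "[T = a] (mod G)" unfolding near_def by auto
  have "T + T \<le> G" unfolding T_def by simp
  then have "T = a" using a assms by (intro cong_abs_less_imp_eq[OF a(2)]) linarith
  then show False using a assms by linarith
qed

definition end_col :: "bool \<Rightarrow> int" where "end_col r = (if r then T else 0)"

text \<open>The violated column hides in tail \<open>r\<close>. One query moves the located time by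
  at most \<open>2 * s\<close>, so the distance to that end must grow with the number
  \<open>d\<close> of remaining queries. A set that does not cross leaves the tail open.\<close>

definition allowed :: "nat \<Rightarrow> bool \<Rightarrow> nat set \<Rightarrow> bool" where
  "allowed d r A \<longleftrightarrow> (crossing A \<longrightarrow> (\<forall>t\<in>Loc A. \<not> near (end_col r) t (2 * int s * (int d + 1))))"

definition survives :: "nat \<Rightarrow> nat set \<Rightarrow> (nat \<Rightarrow> bit) \<Rightarrow> bool" where
  "survives d A \<sigma> \<longleftrightarrow> finite A \<and> card A \<le> k + s \<and>
     (\<exists>r x. x \<in> tail r \<and> fine \<sigma> x \<and> (\<forall>e<k. vvar e x \<notin> A) \<and> allowed d r A)"

lemma free_column:
  assumes "finite A" "card A \<le> k + s"
  shows "\<exists>x\<in>tail r. \<forall>e<k. vvar e x \<notin> A"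
proof (rule ccontr)
  assume "\<not> ?thesis"
  then obtain h where h: "\<And>x. x \<in> tail r \<Longrightarrow> vvar (h x) x \<in> A" by metis
  have "card (tail r) \<le> card A"
    using h assms(1) by (intro card_inj_on_le[of "\<lambda>x. vvar (h x) x"]) (auto simp: inj_on_def)
  then show False using assms(2) M by (auto simp: tail_def split: if_splits)
qed

text \<open>A crossing set close to both ends would make 0 and \<open>T\<close> close to each other,
  by uniqueness of its time.\<close>

lemma allowed_exists:
  assumes B: "finite B" "card B \<le> k + s" and d: "4 * int s * (int d + 1) + 2 * int s < T"
  shows "\<exists>r. allowed d r B"
proof (rule ccontr)
  let ?b = "2 * int s * (int d + 1)"
  assume "\<nexists>r. allowed d r B"
  then have no: "\<not> allowed d False B" "\<not> allowed d True B" by blast+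
  then have cr: "crossing B" by (simp add: allowed_def)
  obtain t where t: "t \<in> Loc B" "near 0 t ?b"
    using no(1) by (auto simp: allowed_def end_col_def)
  obtain u where u: "u \<in> Loc B" "near T u ?b"
    using no(2) by (auto simp: allowed_def end_col_def)
  have "near t u (2 * int s)"
    using Loc_unique[OF cr B u(1) t(1)] by (simp only: near_def)
  then have "near 0 T (?b + 2 * int s + ?b)"
    by (rule near_trans[OF near_trans[OF t(2)] near_sym[OF u(2)]])
  then show False using ends_not_near[of "?b + 2 * int s + ?b"] d by (simp add: algebra_simps)
qed

text \<open>A time of \<open>A\<close> is also a time of \<open>B\<close>, and all times of
  \<open>B\<close> are within \<open>2 * s\<close> of it.\<close>

lemma allowed_persists:
  assumes "allowed (Suc d) r A" "crossing A" "A \<subseteq> B" and B: "finite B" "card B \<le> k + s"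
  shows "allowed d r B"
  unfolding allowed_def
proof (intro impI ballI notI)
  fix t assume t: "t \<in> Loc B" "near (end_col r) t (2 * int s * (int d + 1))"
  note crB = crossing_mono[OF assms(2,3)]
  have A: "finite A" "card A \<le> k + s"
    using finite_subset[OF assms(3) B(1)] card_mono[OF B(1) assms(3)] B(2) by auto
  obtain u where u: "u \<in> Loc A" using Loc_nonempty[OF assms(2) A] by blast
  then have "u \<in> Loc B" using Loc_mono[OF assms(2,3) B(1)] by blast
  then have "near t u (2 * int s)" using Loc_unique[OF crB B _ t(1)] by (simp only: near_def)
  with t(2) have "near (end_col r) u (2 * int s * (int d + 1) + 2 * int s)" by (rule near_trans)
  moreover have "2 * int s * (int d + 1) + 2 * int s = 2 * int s * (int (Suc d) + 1)"
    by (simp add: algebra_simps)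
  ultimately show False using assms(1,2) u unfolding allowed_def by metis
qed

text \<open>If \<open>A\<close> does not cross, an odd solution vanishing on it carries the
  violation to any tail. If it crosses, the violation stays in its tail and moves along one row that
  has no queried edge on the way.\<close>

lemma survives_query:
  assumes surv: "survives (Suc d) A \<sigma>" and A: "card A \<le> k + s - 1"
    and d: "4 * int s * (int d + 1) + 2 * int s < T"
  shows "\<exists>\<tau>. (\<forall>v\<in>A. \<tau> v = \<sigma> v) \<and> survives d (insert v0 A) \<tau>"
proof -
  define B where "B = insert v0 A"
  obtain r x where x: "x \<in> tail r" "fine \<sigma> x" "\<And>e. e < k \<Longrightarrow> vvar e x \<notin> A" "allowed (Suc d) r A"
    and fA: "finite A"
    using surv unfolding survives_def by blast
  have AB: "A \<subseteq> B" and B: "finite B" by (auto simp: B_def fA)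
  have "card B \<le> Suc (card A)" unfolding B_def using fA by (simp add: card_insert_if)
  then have B: "finite B" "card B \<le> k + s" using B A k_pos by linarith+
  obtain r' where r': "allowed d r' B" "crossing A \<Longrightarrow> r' = r"
  proof (cases "crossing A")
    case True
    then show ?thesis using that allowed_persists[OF x(4) True AB B] by blast
  next
    case False
    then show ?thesis using that allowed_exists[OF B d] by blast
  qed
  obtain y where y: "y \<in> tail r'" "\<forall>e<k. vvar e y \<notin> B" using free_column[OF B] by blast
  have "\<exists>\<tau>. (\<forall>v\<in>A. \<tau> v = \<sigma> v) \<and> fine \<tau> y"
  proof (cases "x = y")
    case True
    with x show ?thesis by blast
  next
    case neq: False
    show ?thesis
    proof (cases "crossing A")
      case False
      then obtain c f where "periodic f" "(\<Sum>i<k. c i) = 1"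
        "\<And>i z. i < k \<Longrightarrow> hvar i z \<in> A \<Longrightarrow> hsol c f i z = 0"
        "\<And>e z. e < k \<Longrightarrow> vvar e z \<in> A \<Longrightarrow> vsol f e z = 0"
        unfolding crossing_def by blast
      then show ?thesis using x by (intro fine_move[OF x(2,1) y(1) neq]) auto
    next
      case True
      have "r' = r" using r'(2) True by blast
      note crB = crossing_mono[OF True AB]
      \<comment> \<open>Otherwise every single row would have its edge inside the tail, which would
        locate \<open>B\<close> at the very end that it must avoid.\<close>
      have "\<exists>l\<in>single B. \<forall>z\<in>row B l. \<not> (min x y < z \<and> z \<le> max x y)"
      proof (rule ccontr)
        assume contra: "\<not> ?thesis"
        have "pos B l = end_col r" if l: "l \<in> single B" for l
        proof -
          obtain z where z: "row B l = {z}" "pos B l = clamp z" using single_row[OF l] by blast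
          then have "min x y < z" "z \<le> max x y" using contra l by force+
          then have "if r then T < z else z < 0"
            using x(1) y(1) \<open>r' = r\<close> by (auto simp: tail_def min_def max_def split: if_splits)
          then show ?thesis using z(2) T_pos by (auto simp: clamp_def end_col_def split: if_splits)
        qed
        then have "end_col r \<in> Loc B" by (auto simp: Loc_def intro!: exI[of _ 0])
        moreover have "near (end_col r) (end_col r) (2 * int s * (int d + 1))"
          by (auto simp: near_def intro!: exI[of _ 0])
        ultimately show False using r'(1) crB \<open>r' = r\<close> unfolding allowed_def by blast
      qed
      then obtain l where l: "l < k" "\<And>z. z \<in> row B l \<Longrightarrow> \<not> (min x y < z \<and> z \<le> max x y)"
        by (auto simp: single_def)
      show ?thesis
      proof (rule fine_move[OF x(2,1) y(1) neq, of "\<lambda>_ _. 0" "\<lambda>i. of_bool (i = l)"])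
        show "hsol (\<lambda>i. of_bool (i = l)) (\<lambda>_ _. 0) i z = 0"
          if "hvar i z \<in> A" "min x y < z" "z \<le> max x y" for i z
          using l(2)[of z] that AB by (auto simp: row_def hsol_def)
      qed (use x(3) l(1) in \<open>auto simp: periodic_def vsol_def sum.delta\<close>)
    qed
  qed
  then show ?thesis using y r'(1) B unfolding B_def survives_def by blast
qed

lemma survives_start: "\<exists>\<sigma>. survives d {} \<sigma>"
proof -
  \<comment> \<open>Row 0 carries 1 from column 0 onwards, so its vertex in column -1 is the only
    violated one.\<close>
  define \<sigma> where "\<sigma> = assign (\<lambda>i z. of_bool (i = 0 \<and> 0 \<le> z)) (\<lambda>_ _. 0) 1"
  have H: "\<sigma> (H i t) = of_bool (i = 0 \<and> 0 \<le> t)" if "i < k" for i t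
    using hrep_in[OF that, of t] by (auto simp: \<sigma>_def H_def hrep_def)
  have V: "\<sigma> (V e t) = 0" for e t by (simp add: \<sigma>_def V_def)
  have "fine \<sigma> (- 1)"
    unfolding fine_def using M T_pos by (auto simp: H V) (simp add: \<sigma>_def)
  moreover have "- 1 \<in> tail False" using M by (simp add: tail_def)
  moreover have "\<not> crossing {}" using crossing_row[OF _ k_pos] by (auto simp: row_def)
  ultimately show ?thesis unfolding survives_def allowed_def by auto
qed

lemma survives_mono: "survives d A \<sigma> \<Longrightarrow> B \<subseteq> A \<Longrightarrow> survives d B \<sigma>"
proof -
  assume A: "survives d A \<sigma>" and B: "B \<subseteq> A"
  have "finite A" using A by (simp add: survives_def)
  then have "finite B" "card B \<le> card A" using B finite_subset card_mono by blast+
  moreover have "allowed d r B" if "allowed d r A" for r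
    using that Loc_mono[OF _ B \<open>finite A\<close>] crossing_mono[OF _ B] unfolding allowed_def by blast
  ultimately show ?thesis using A B unfolding survives_def by (meson order_trans subsetD)
qed

text \<open>A clause of a vertex in the violated column mentions a vertical edge of that column, and
  none of those is in \<open>A\<close>; all other clauses hold under \<sigma>.\<close>

lemma survives_safe:
  assumes "survives d A \<sigma>" "var ` C \<subseteq> A"
    and C: "C \<in> formula \<union> E" and E: "\<And>C. C \<in> E \<Longrightarrow> \<exists>b i. Pos (pvar b i) \<in> C"
  shows "\<not> falsified \<sigma> C"
proof -
  obtain r x where x: "x \<in> tail r" "fine \<sigma> x" "\<And>e. e < k \<Longrightarrow> vvar e x \<notin> A"
    using assms(1) unfolding survives_def by blast
  consider i t where "i < k" "t \<in> {- int M..<T + int M}" "C \<in> parity_clauses (vertex i t) 0"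
    | i where "i < k" "C \<in> parity_clauses {H i (- int M)} 0"
    | i where "i < k" "C \<in> parity_clauses {H i (T + int M)} (of_bool (i = 0))"
    | "C \<in> E"
    using C unfolding formula_def by blast
  then show ?thesis
  proof cases
    case 1
    obtain a where "C = assignment_clause a (vertex i t)"
      using 1(3) unfolding parity_clauses_def by blast
    then have "var ` C = vertex i t" by simp
    then have "V i t \<in> A" using assms(2) by (auto simp: vertex_def)
    then have "t \<noteq> x" using x(3)[OF 1(1)] vrep_between(2)[OF x(1) x(1) 1(1), of x] by (auto simp: V_def)
    then show ?thesis
      using x(2) 1 by (intro parity_clause_not_falsified[OF 1(3)]) (simp add: sum_vertex fine_def)
  next
    case 2
    then show ?thesis using x(2) by (intro parity_clause_not_falsified[OF 2(2)]) (simp add: fine_def)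
  next
    case 3
    then show ?thesis using x(2) by (intro parity_clause_not_falsified[OF 3(2)]) (simp add: fine_def)
  next
    case 4
    then obtain b i where "Pos (pvar b i) \<in> C" using E by blast
    moreover have "\<sigma> (pvar b i) = 1" using x(2) unfolding fine_def by blast
    ultimately show ?thesis unfolding falsified_def by (metis lit_false_simps(1) zero_neq_one)
  qed
qed

theorem ref_depth_formula:
  assumes \<pi>: "is_refutation (formula \<union> E) \<pi>" "ref_width \<pi> \<le> k + s - 1"
    and E: "\<And>C. C \<in> E \<Longrightarrow> \<exists>b i. Pos (pvar b i) \<in> C"
    and d: "4 * int s * (int d + 1) + 2 * int s < T"
  shows "d \<le> ref_depth \<pi>"
proof -
  define Gd where "Gd d' A \<sigma> \<longleftrightarrow> d' \<le> d \<and> survives d' A \<sigma>" for d' A \<sigma>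
  obtain \<sigma>0 where s0: "survives d {} \<sigma>0" using survives_start by blast
  show ?thesis
  proof (rule ref_depth_ge_adversary[of Gd d \<sigma>0, OF _ _ _ _ \<pi>])
    show "Gd d {} \<sigma>0" using s0 by (simp add: Gd_def)
  next
    fix d' A \<sigma> x assume *: "Gd (Suc d') A \<sigma>" "card A \<le> k + s - 1"
    then have "4 * int s * (int d' + 1) \<le> 4 * int s * (int d + 1)"
      by (intro mult_left_mono) (auto simp: Gd_def)
    then show "\<exists>\<tau>. (\<forall>y\<in>A. \<tau> y = \<sigma> y) \<and> Gd d' (insert x A) \<tau>"
      using * survives_query[of d' A \<sigma> x] d by (auto simp: Gd_def)
  next
    show "Gd d' B \<sigma>" if "Gd d' A \<sigma>" "B \<subseteq> A" for d' A B \<sigma>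
      using that survives_mono by (auto simp: Gd_def)
  next
    show "\<not> falsified \<sigma> C" if "Gd d' A \<sigma>" "C \<in> formula \<union> E" "var ` C \<subseteq> A" for d' A \<sigma> C
      using that survives_safe[OF _ _ _ E] unfolding Gd_def by blast
  qed
qed


subsection \<open>A narrow refutation\<close>

text \<open>
  The sweep keeps one variable of each row: those of the rows below \<open>i\<close> have moved from column
  \<open>t\<close> to column \<open>t + 1\<close>, and two vertical edges are cut.
\<close>

definition frontier :: "int \<Rightarrow> nat \<Rightarrow> nat set" where
  "frontier t i = (\<lambda>l. H l (if l < i then t + 1 else t)) ` {..<k} \<union> {V (k - 1) t, V (pre i) t}"

definition column :: "int \<Rightarrow> nat set" where "column t = (\<lambda>l. H l t) ` {..<k}"

lemma column_bounds: "finite (column t)" "card (column t) \<le> k"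
  using card_image_le[of "{..<k}" "\<lambda>l. H l t"] by (auto simp: column_def)

lemma frontier_bounds: "finite (frontier t i)" "card (frontier t i) \<le> k + 2"
proof -
  show "finite (frontier t i)" by (simp add: frontier_def)
  have "card (frontier t i) \<le> card ((\<lambda>l. H l (if l < i then t + 1 else t)) ` {..<k}) + card {V (k - 1) t, V (pre i) t}"
    unfolding frontier_def by (rule card_Un_le)
  also have "\<dots> \<le> k + 2"
    using card_image_le[of "{..<k}" "\<lambda>l. H l (if l < i then t + 1 else t)"]
    by (intro add_mono) (auto simp: card_insert_if)
  finally show "card (frontier t i) \<le> k + 2" .
qed

lemma vertex_clauses: "i < k \<Longrightarrow> - int M \<le> t \<Longrightarrow> t < T + int M \<Longrightarrow> parity_clauses (vertex i t) 0 \<subseteq> formula"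
  unfolding formula_def by fastforce

lemma end_clauses:
  assumes "i < k"
  shows "parity_clauses {H i (- int M)} 0 \<subseteq> formula"
    "parity_clauses {H i (T + int M)} (of_bool (i = 0)) \<subseteq> formula"
  unfolding formula_def using assms by blast+

text \<open>Querying \<open>V i t\<close> and \<open>H i (t + 1)\<close> completes the vertex of row
  \<open>i\<close>. The bound concerns the set before a query: at most \<open>k + 2\<close> frontier
  variables, and one more when the second edge is asked, hence \<open>k + 3\<close>.\<close>

lemma refutable_frontier:
  assumes t: "- int M \<le> t" "t < T + int M"
    and next_column: "\<And>\<sigma>. (\<Sum>l<k. \<sigma> (H l (t + 1))) = 0 \<Longrightarrow> refutable formula (k + 3) (column (t + 1)) \<sigma>"
    and i: "i \<le> k"
    and parity: "(\<Sum>l<k. \<sigma> (H l (if l < i then t + 1 else t))) = \<sigma> (V (k - 1) t) + \<sigma> (V (pre i) t)"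
  shows "refutable formula (k + 3) (frontier t i) \<sigma>"
  using i parity
proof (induction "k - i" arbitrary: i \<sigma>)
  case 0
  \<comment> \<open>\<open>pre k\<close> is \<open>k - 1\<close>, so the two cut edges coincide and
    cancel.\<close>
  then have "i = k" by simp
  have "(\<Sum>l<k. \<sigma> (H l (t + 1))) = (\<Sum>l<k. \<sigma> (H l (if l < i then t + 1 else t)))"
    using \<open>i = k\<close> by (intro sum.cong) auto
  also have "\<dots> = 0" unfolding 0(3) using \<open>i = k\<close> k_pos by (simp add: pre_def)
  finally have "refutable formula (k + 3) (column (t + 1)) \<sigma>" by (rule next_column)
  moreover have "column (t + 1) \<subseteq> frontier t i"
    using \<open>i = k\<close> by (auto simp: column_def frontier_def)
  ultimately show ?case by (rule refutable_mono)
next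
  case (Suc n)
  then have i: "i < k" by simp
  let ?A1 = "insert (V i t) (frontier t i)"
  let ?A2 = "insert (H i (t + 1)) ?A1"
  have card1: "card ?A1 \<le> k + 3"
    using frontier_bounds[of t i] by (simp add: card_insert_if)
  show ?case
  proof (rule refutable_query_extend)
    fix \<tau> assume \<tau>: "\<forall>y\<in>frontier t i. \<tau> y = \<sigma> y"
    show "refutable formula (k + 3) ?A1 \<tau>"
    proof (rule refutable_query_extend)
      fix \<rho> assume \<rho>: "\<forall>y\<in>?A1. \<rho> y = \<tau> y"
      have \<rho>\<sigma>: "\<rho> y = \<sigma> y" if "y \<in> frontier t i" for y using \<rho> \<tau> that by simp
      show "refutable formula (k + 3) ?A2 \<rho>"
      proof (cases "sum \<rho> (vertex i t) = 0")
        case False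
        show ?thesis
        proof (rule refutable_parity[OF vertex_clauses[OF i t] _ _ _ False])
          show "card (vertex i t) \<le> k + 3" using k sum_vertex(2)[OF i] by simp
          show "finite (vertex i t)" by (simp add: vertex_def)
          show "vertex i t \<subseteq> ?A2" using i by (auto simp: vertex_def frontier_def)
        qed
      next
        case True
        have split: "(\<Sum>l<k. f l) = f i + (\<Sum>l\<in>{..<k} - {i}. f l)" for f :: "nat \<Rightarrow> bit"
          using i by (simp add: sum.remove[of "{..<k}" i])
        have "(\<Sum>l<k. \<rho> (H l (if l < Suc i then t + 1 else t))) =
           \<rho> (H i (t + 1)) + (\<Sum>l\<in>{..<k} - {i}. \<rho> (H l (if l < i then t + 1 else t)))"
          unfolding split by (intro arg_cong2[of _ _ _ _ "(+)"] sum.cong) auto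
        also have "\<dots> = (\<rho> (H i t) + \<rho> (H i (t + 1))) + (\<Sum>l<k. \<rho> (H l (if l < i then t + 1 else t)))"
          unfolding split[of "\<lambda>l. \<rho> (H l (if l < i then t + 1 else t))"] by (simp add: add_ac)
        also have "(\<Sum>l<k. \<rho> (H l (if l < i then t + 1 else t))) = \<sigma> (V (k - 1) t) + \<sigma> (V (pre i) t)"
          unfolding Suc(4)[symmetric] by (intro sum.cong refl \<rho>\<sigma>) (auto simp: frontier_def)
        also have "\<dots> = \<rho> (V (k - 1) t) + \<rho> (V (pre i) t)"
          using \<rho>\<sigma> by (simp add: frontier_def)
        also have "\<rho> (H i t) + \<rho> (H i (t + 1)) = \<rho> (V (pre i) t) + \<rho> (V i t)"
          using True unfolding sum_vertex(1)[OF i] by (simp add: bit_add_eq_0_iff)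
        finally have "(\<Sum>l<k. \<rho> (H l (if l < Suc i then t + 1 else t))) =
          \<rho> (V (k - 1) t) + \<rho> (V (pre (Suc i)) t)"
          by (simp add: pre_def add_ac)
        moreover have "n = k - Suc i" "Suc i \<le> k" using Suc(2) i by auto
        ultimately have ref: "refutable formula (k + 3) (frontier t (Suc i)) \<rho>" by (intro Suc(1))
        have "H l (if l < Suc i then t + 1 else t) \<in> ?A2" if "l < k" for l
        proof (cases "l = i")
          case False
          then have "(if l < Suc i then t + 1 else t) = (if l < i then t + 1 else t)" by auto
          moreover have "H l (if l < i then t + 1 else t) \<in> frontier t i"
            using that unfolding frontier_def by blast
          ultimately show ?thesis by simp
        qed simp
        then have "(\<lambda>l. H l (if l < Suc i then t + 1 else t)) ` {..<k} \<subseteq> ?A2" by blast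
        moreover have "{V (k - 1) t, V (pre (Suc i)) t} \<subseteq> ?A2" by (simp add: pre_def frontier_def)
        ultimately have "frontier t (Suc i) \<subseteq> ?A2"
          unfolding frontier_def[of t "Suc i"] by blast
        with ref show ?thesis by (rule refutable_mono)
      qed
    qed (use card1 frontier_bounds in auto)
  qed (use frontier_bounds[of t i] in auto)
qed

lemma refutable_column:
  assumes "- int M \<le> t" "t \<le> T + int M" "(\<Sum>l<k. \<sigma> (H l t)) = 0"
  shows "refutable formula (k + 3) (column t) \<sigma>"
  using assms
proof (induction "nat (T + int M - t)" arbitrary: t \<sigma>)
  case 0
  then have t: "t = T + int M" by simp
  have "\<exists>l<k. \<sigma> (H l t) \<noteq> of_bool (l = 0)"
  proof (rule ccontr)
    assume "\<not> ?thesis"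
    then have "(\<Sum>l<k. \<sigma> (H l t)) = (\<Sum>l<k. of_bool (l = 0))" by (intro sum.cong) auto
    then show False using 0 k_pos by (simp add: sum.delta)
  qed
  then obtain l where l: "l < k" "\<sigma> (H l t) \<noteq> of_bool (l = 0)" by blast
  show ?case
  proof (rule refutable_parity[OF end_clauses(2)[OF l(1)]])
    show "{H l (T + int M)} \<subseteq> column t" using l t by (auto simp: column_def)
    show "sum \<sigma> {H l (T + int M)} \<noteq> of_bool (l = 0)" using l t by (simp only: sum.insert) auto
  qed auto
next
  case (Suc n)
  then have t: "- int M \<le> t" "t < T + int M" by auto
  have nxt: "refutable formula (k + 3) (column (t + 1)) \<tau>" if "(\<Sum>l<k. \<tau> (H l (t + 1))) = 0" for \<tau>
    using Suc(2) t that by (intro Suc(1)) auto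
  show ?case
  proof (rule refutable_query_extend[of _ _ _ _ "V (k - 1) t"])
    fix \<tau> assume \<tau>: "\<forall>y\<in>column t. \<tau> y = \<sigma> y"
    have "(\<Sum>l<k. \<tau> (H l t)) = (\<Sum>l<k. \<sigma> (H l t))"
      using \<tau> by (intro sum.cong) (auto simp: column_def)
    then have "refutable formula (k + 3) (frontier t 0) \<tau>"
      using Suc.prems by (intro refutable_frontier[OF t nxt]) (auto simp: pre_def)
    moreover have "frontier t 0 \<subseteq> insert (V (k - 1) t) (column t)"
      by (auto simp: frontier_def column_def pre_def)
    ultimately show "refutable formula (k + 3) (insert (V (k - 1) t) (column t)) \<tau>"
      by (rule refutable_mono)
  qed (use column_bounds[of t] in auto)
qed

lemma refutable_first_column:
  assumes "j \<le> k"
  shows "refutable formula (k + 3) ((\<lambda>l. H l (- int M)) ` {..<j}) \<sigma>"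
  using assms
proof (induction "k - j" arbitrary: j \<sigma>)
  case (0 j \<sigma>)
  then have j: "j = k" by simp
  show ?case
  proof (cases "\<exists>l<k. \<sigma> (H l (- int M)) \<noteq> 0")
    case True
    then obtain l where l: "l < k" "\<sigma> (H l (- int M)) \<noteq> 0" by blast
    show ?thesis
    proof (rule refutable_parity[OF end_clauses(1)[OF l(1)]])
      show "{H l (- int M)} \<subseteq> (\<lambda>l. H l (- int M)) ` {..<j}" using l j by auto
      show "sum \<sigma> {H l (- int M)} \<noteq> 0" using l by simp
    qed auto
  next
    case False
    then have "(\<Sum>l<k. \<sigma> (H l (- int M))) = 0" by (intro sum.neutral) auto
    then show ?thesis using refutable_column[of "- int M" \<sigma>] j T_pos by (simp add: column_def)
  qed
next
  case (Suc n j \<sigma>)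
  show ?case
  proof (rule refutable_query_extend[of _ _ _ _ "H j (- int M)"])
    fix \<tau>
    have "refutable formula (k + 3) ((\<lambda>l. H l (- int M)) ` {..<Suc j}) \<tau>"
      using Suc(2) by (intro Suc(1)) auto
    then show "refutable formula (k + 3) (insert (H j (- int M)) ((\<lambda>l. H l (- int M)) ` {..<j})) \<tau>"
      by (simp add: lessThan_Suc)
  next
    show "card ((\<lambda>l. H l (- int M)) ` {..<j}) \<le> k + 3"
      using card_image_le[of "{..<j}" "\<lambda>l. H l (- int M)"] Suc(3) by simp
  qed simp
qed

theorem derivable_empty_formula: "derivable formula (k + 3) {}"
  using refutable_first_column[of 0] by (intro refutable_empty[of _ _ "\<lambda>_. 0"]) simp

subsection \<open>The size of the formula\<close>

text \<open>The number of horizontal variables. It bounds the size from above and the number of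
  variables from below, up to constants.\<close>

definition volume :: nat where "volume = (\<Sum>i<k. nat (p i) + 2 * M)"

definition reps :: "nat \<Rightarrow> int set" where "reps i = {- int M..<p i} \<union> {T..<T + int M}"

text \<open>The moduli of the adjacent vertical edges divide \<open>p i\<close>, so entire
  constraints coincide modulo \<open>p i\<close>; the size does not depend on
  \<open>T\<close>.\<close>

lemma vertex_rep: assumes "i < k" "0 \<le> t" "t < T" shows "vertex i t = vertex i (t mod p i)"
proof -
  have "0 < p i" using p_ge2[of i] by simp
  then have "0 \<le> t mod p i" "t mod p i < p i" by (rule pos_mod_sign, rule pos_mod_bound)
  then have r: "0 \<le> t mod p i" "t mod p i < p i" "p i \<le> T" "t mod p i < T" "t mod p i + 1 \<le> T"
    using p_le_T[OF assms(1)] by linarith+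
  have "t mod q e = t mod p i mod q e" if "q e dvd p i" for e
    using that by (simp add: mod_mod_cancel)
  moreover have "(t + 1) mod p i = (t mod p i + 1) mod p i" by (simp add: mod_add_left_eq)
  ultimately show ?thesis
    using assms r q_dvd_p unfolding vertex_def H_def V_def hrep_def vrep_def by simp
qed

lemma formula_reps:
  "(\<Union>t\<in>{- int M..<T + int M}. parity_clauses (vertex i t) 0) = (\<Union>t\<in>reps i. parity_clauses (vertex i t) 0)"
  if "i < k"
proof
  show "(\<Union>t\<in>reps i. parity_clauses (vertex i t) 0) \<subseteq> (\<Union>t\<in>{- int M..<T + int M}. parity_clauses (vertex i t) 0)"
    using p_le_T[OF that] T_pos by (intro UN_mono) (auto simp: reps_def)
  show "(\<Union>t\<in>{- int M..<T + int M}. parity_clauses (vertex i t) 0) \<subseteq> (\<Union>t\<in>reps i. parity_clauses (vertex i t) 0)"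
  proof (rule UN_least)
    fix t assume t: "t \<in> {- int M..<T + int M}"
    show "parity_clauses (vertex i t) 0 \<subseteq> (\<Union>t\<in>reps i. parity_clauses (vertex i t) 0)"
    proof (cases "0 \<le> t \<and> t < T")
      case True
      have "0 < p i" using p_ge2[of i] by simp
      then have "0 \<le> t mod p i" "t mod p i < p i" by (rule pos_mod_sign, rule pos_mod_bound)
      then have "t mod p i \<in> reps i" unfolding reps_def by simp
      then have "parity_clauses (vertex i (t mod p i)) 0 \<subseteq> (\<Union>t\<in>reps i. parity_clauses (vertex i t) 0)"
        by (rule UN_upper)
      moreover have "vertex i t = vertex i (t mod p i)"
        using True by (intro vertex_rep[OF that]) auto
      ultimately show ?thesis by (simp only:)
    next
      case False
      then have "t \<in> reps i" using t p_ge2[of i] by (auto simp: reps_def)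
      then show ?thesis by (rule UN_upper)
    qed
  qed
qed

lemma finite_reps: "finite (reps i)" and card_reps: "card (reps i) \<le> nat (p i) + 2 * M"
proof -
  show "finite (reps i)" by (simp add: reps_def)
  have "card (reps i) \<le> card {- int M..<p i} + card {T..<T + int M}"
    unfolding reps_def by (rule card_Un_le)
  then show "card (reps i) \<le> nat (p i) + 2 * M" using p_ge2[of i] by simp
qed

lemma formula_alt: "formula = (\<Union>i<k. (\<Union>t\<in>reps i. parity_clauses (vertex i t) 0) \<union>
    (parity_clauses {H i (- int M)} 0 \<union> parity_clauses {H i (T + int M)} (of_bool (i = 0))))"
proof -
  have "formula = (\<Union>i<k. (\<Union>t\<in>{- int M..<T + int M}. parity_clauses (vertex i t) 0) \<union>
    (parity_clauses {H i (- int M)} 0 \<union> parity_clauses {H i (T + int M)} (of_bool (i = 0))))"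
    unfolding formula_def by blast
  also have "\<dots> = (\<Union>i<k. (\<Union>t\<in>reps i. parity_clauses (vertex i t) 0) \<union>
    (parity_clauses {H i (- int M)} 0 \<union> parity_clauses {H i (T + int M)} (of_bool (i = 0))))"
    using formula_reps by (intro SUP_cong) auto
  finally show ?thesis .
qed

lemma finite_vertex: "finite (vertex i t)" by (simp add: vertex_def)

lemma is_kcnf_formula: "is_kcnf 4 formula"
  unfolding is_kcnf_def
proof (intro conjI ballI)
  show "finite formula"
    unfolding formula_alt using finite_vertex
    by (intro finite_UN_I finite_UnI finite_reps parity_clauses_bound) auto
  fix C assume "C \<in> formula"
  then consider i t where "i < k" "C \<in> parity_clauses (vertex i t) 0"
    | x b where "C \<in> parity_clauses {x} b"
    unfolding formula_def by blast
  then obtain X b where X: "C \<in> parity_clauses X b" "finite X" "card X \<le> 4"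
  proof cases
    case 1
    then show ?thesis using that[of "vertex i t" 0] finite_vertex sum_vertex(2)[of i t] by simp
  next
    case 2
    then show ?thesis using that[of "{x}" b] by simp
  qed
  then obtain a where "C = assignment_clause a X" unfolding parity_clauses_def by blast
  then show "is_clause C" "width C \<le> 4"
    using X assignment_clause_props[OF X(2), of a] by (simp_all add: width_def)
qed

text \<open>A vertex has at most \<open>2 ^ 4\<close> clauses of 4 literals, which gives 64; the end
  clauses of a row are absorbed by raising this to 65.\<close>

lemma cnf_size_formula: "cnf_size formula \<le> 65 * volume"
proof -
  have fin: "finite ((\<Union>t\<in>reps i. parity_clauses (vertex i t) 0))" for i
    using finite_vertex by (intro finite_UN_I finite_reps parity_clauses_bound)
  have fin': "finite (parity_clauses {H i (- int M)} 0 \<union> parity_clauses {H i (T + int M)} (of_bool (i = 0)))" for i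
    by (intro finite_UnI parity_clauses_bound) auto
  have "cnf_size ((\<Union>t\<in>reps i. parity_clauses (vertex i t) 0) \<union>
    (parity_clauses {H i (- int M)} 0 \<union> parity_clauses {H i (T + int M)} (of_bool (i = 0))))
    \<le> 65 * (nat (p i) + 2 * M)" if i: "i < k" for i
  proof -
    have "cnf_size (parity_clauses (vertex i t) 0) \<le> 64" for t
      using cnf_size_parity_clauses[OF finite_vertex, of i t 0] sum_vertex(2)[OF i] by simp
    then have "(\<Sum>t\<in>reps i. cnf_size (parity_clauses (vertex i t) 0)) \<le> (\<Sum>t\<in>reps i. 64)"
      by (intro sum_mono)
    then have 1: "cnf_size (\<Union>t\<in>reps i. parity_clauses (vertex i t) 0) \<le> 64 * (nat (p i) + 2 * M)"
      using cnf_size_UN[of "reps i" "\<lambda>t. parity_clauses (vertex i t) 0"] finite_vertex card_reps[of i]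
      by (force simp: finite_reps parity_clauses_bound)
    have "cnf_size (parity_clauses {H i (- int M)} 0 \<union> parity_clauses {H i (T + int M)} (of_bool (i = 0))) \<le> 2 + 2"
      using cnf_size_parity_clauses[of "{H i (- int M)}" 0]
        cnf_size_parity_clauses[of "{H i (T + int M)}" "of_bool (i = 0)"]
      by (intro order_trans[OF cnf_size_Un add_mono] parity_clauses_bound) auto
    moreover have "4 \<le> nat (p i) + 2 * M" using p_ge2[of i] M k by linarith
    moreover have "a \<le> u + v \<Longrightarrow> u \<le> 64 * x \<Longrightarrow> v \<le> 2 + 2 \<Longrightarrow> 4 \<le> x \<Longrightarrow> a \<le> 65 * x" for a u v x :: nat
      by linarith
    ultimately show ?thesis
      using cnf_size_Un[OF fin fin', of i i] 1 by blast
  qed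
  then have "(\<Sum>i<k. cnf_size ((\<Union>t\<in>reps i. parity_clauses (vertex i t) 0) \<union>
    (parity_clauses {H i (- int M)} 0 \<union> parity_clauses {H i (T + int M)} (of_bool (i = 0)))))
    \<le> (\<Sum>i<k. 65 * (nat (p i) + 2 * M))" by (intro sum_mono) auto
  then show ?thesis
    unfolding volume_def sum_distrib_left formula_alt
    using fin fin' by (intro order_trans[OF cnf_size_UN]) auto
qed

lemma cnf_vars_formula: "volume \<le> card (cnf_vars formula)"
proof -
  have fin: "finite (cnf_vars formula)"
    using is_kcnf_formula by (auto simp: cnf_vars_def is_kcnf_def is_clause_def)
  define Z where "Z i = {- int M..<p i} \<union> {T<..T + int M}" for i
  have card_Z: "card (Z i) = nat (p i) + 2 * M" if "i < k" for i
  proof -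
    have "card (Z i) = card {- int M..<p i} + card {T<..T + int M}"
      unfolding Z_def using p_le_T[OF that] by (intro card_Un_disjoint) auto
    then show ?thesis using p_ge2[of i] by simp
  qed
  have "hvar i z \<in> cnf_vars formula" if i: "i < k" and z: "z \<in> Z i" for i z
  proof -
    have Hz: "H i z = hvar i z" using z p_le_T[OF i] by (auto simp: H_def hrep_def Z_def)
    show ?thesis
    proof (cases "z = T + int M")
      case True
      have "assignment_clause (\<lambda>_. of_bool (i \<noteq> 0)) {H i z} \<in> parity_clauses {H i z} (of_bool (i = 0))"
        unfolding parity_clauses_def by (intro CollectI exI[of _ "\<lambda>_. of_bool (i \<noteq> 0)"]) auto
      then have "assignment_clause (\<lambda>_. of_bool (i \<noteq> 0)) {H i z} \<in> formula"
        using end_clauses(2)[OF i] True by blast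
      then have "var ` assignment_clause (\<lambda>_. of_bool (i \<noteq> 0)) {H i z} \<subseteq> cnf_vars formula"
        unfolding cnf_vars_def by blast
      then show ?thesis using Hz by simp
    next
      case False
      then have "- int M \<le> z" "z < T + int M" using z p_le_T[OF i] T_pos M by (auto simp: Z_def)
      then have "cnf_vars (parity_clauses (vertex i z) 0) \<subseteq> cnf_vars formula"
        using vertex_clauses[OF i] unfolding cnf_vars_def by blast
      moreover have "H i z \<in> cnf_vars (parity_clauses (vertex i z) 0)"
        by (intro cnf_vars_parity_clauses finite_vertex) (simp add: vertex_def)
      ultimately show ?thesis using Hz by auto
    qed
  qed
  then have "(\<lambda>(i, z). hvar i z) ` (SIGMA i:{..<k}. Z i) \<subseteq> cnf_vars formula" by auto
  then have "card ((\<lambda>(i, z). hvar i z) ` (SIGMA i:{..<k}. Z i)) \<le> card (cnf_vars formula)"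
    by (rule card_mono[OF fin])
  moreover have "card ((\<lambda>(i, z). hvar i z) ` (SIGMA i:{..<k}. Z i)) = card (SIGMA i:{..<k}. Z i)"
    by (rule card_image) (auto simp: inj_on_def)
  moreover have "card (SIGMA i:{..<k}. Z i) = (\<Sum>i<k. card (Z i))"
    by (subst card_SigmaI) (auto simp: Z_def)
  moreover have "(\<Sum>i<k. card (Z i)) = volume"
    unfolding volume_def using card_Z by (intro sum.cong) auto
  ultimately show ?thesis by simp
qed

end

section \<open>Primes\<close>

text \<open>
  Nair's argument: the Leibniz triangle shows that \<open>j * (n choose j)\<close> divides
  \<open>Lcm {1..n}\<close>, which is therefore exponentially large.
\<close>

lemma leibniz_triangle:
  assumes "0 < j" "j < n"
  shows "1 / real (Suc j * (n choose Suc j)) =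
    1 / real (j * ((n - 1) choose j)) - 1 / real (j * (n choose j))"
proof -
  have a: "real (Suc j) * real (n choose Suc j) = (real n - real j) * real (n choose j)"
  proof -
    have "Suc j * (n choose Suc j) = (n - j) * (n choose j)"
      by (metis binomial_absorb_comp binomial_absorption diff_Suc_1 mult.commute assms(2) Suc_diff_Suc)
    then show ?thesis using assms(2) by (metis of_nat_diff less_imp_le of_nat_mult)
  qed
  have b: "(real n - real j) * real (n choose j) = real n * real ((n - 1) choose j)"
  proof -
    have "(n - j) * (n choose j) = n * ((n - 1) choose j)" by (rule binomial_absorb_comp)
    then show ?thesis using assms(2) by (metis of_nat_diff less_imp_le of_nat_mult)
  qed
  have pos: "real (n choose j) > 0" "real ((n - 1) choose j) > 0" "real n - real j > 0" "real j > 0"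
    using assms by auto
  have c: "1 / real ((n - 1) choose j) = real n / ((real n - real j) * real (n choose j))"
    using b pos by (simp add: field_simps)
  have "1 / real (j * ((n - 1) choose j)) - 1 / real (j * (n choose j)) =
    (1 / real j) * (real n / ((real n - real j) * real (n choose j)) - 1 / real (n choose j))"
    unfolding c[symmetric] by (simp add: right_diff_distrib)
  also have "\<dots> = 1 / ((real n - real j) * real (n choose j))"
    using pos by (simp add: field_simps)
  finally show ?thesis by (simp only: of_nat_mult a)
qed

text \<open>By \<open>leibniz_triangle\<close> the quotient of \<open>D\<close> by the new entry is
  a difference of two quotients that are integers by induction, for \<open>n - 1\<close> and
  \<open>n\<close>.\<close>

lemma mult_choose_dvd:
  fixes D :: nat
  assumes "0 < j" "j \<le> n" "\<And>i. i \<in> {1..n} \<Longrightarrow> i dvd D"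
  shows "j * (n choose j) dvd D"
  using assms
proof (induction j arbitrary: n rule: nat_induct_non_zero)
  case 1
  then show ?case by simp
next
  case (Suc j)
  have dvds: "j * ((n - 1) choose j) dvd D" "j * (n choose j) dvd D"
    using Suc.prems by (auto intro!: Suc.IH)
  have quot: "real D / real x \<in> \<int>" if "x dvd D" for x
    using that by (auto elim!: dvdE)
  have "real D / real (Suc j * (n choose Suc j)) =
      real D / real (j * ((n - 1) choose j)) - real D / real (j * (n choose j))"
  proof -
    have "1 / real (Suc j * (n choose Suc j)) =
        1 / real (j * ((n - 1) choose j)) - 1 / real (j * (n choose j))"
      using Suc by (intro leibniz_triangle) auto
    from arg_cong[OF this, of "\<lambda>x. real D * x"] show ?thesis
      by (simp only: right_diff_distrib times_divide_eq_right mult_1_right)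
  qed
  also have "\<dots> \<in> \<int>" by (intro Ints_diff quot dvds)
  finally have "real D / real (Suc j * (n choose Suc j)) \<in> \<int>" .
  then obtain z where z: "real D / real (Suc j * (n choose Suc j)) = of_int z" by (elim Ints_cases)
  have "0 < Suc j * (n choose Suc j)" using Suc.prems by simp
  then have "real D = of_int z * real (Suc j * (n choose Suc j))"
    using z by (simp add: field_simps del: of_nat_mult mult_Suc)
  then have "int D = z * int (Suc j * (n choose Suc j))"
    by (metis of_int_eq_iff of_int_mult of_int_of_nat_eq)
  then have "int (Suc j * (n choose Suc j)) dvd int D" by simp
  then show ?case by (simp only: int_dvd_int_iff)
qed

lemma two_power_le_Lcm: "2 ^ n \<le> (n + 1) * Lcm {1..n}" for n :: nat
proof -
  have pos: "0 < Lcm {1..n}" by (intro Nat.gr0I) (simp add: Lcm_0_iff)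
  have "n choose j \<le> Lcm {1..n}" if "j \<le> n" for j
  proof (cases "j = 0")
    case False
    then have "j * (n choose j) dvd Lcm {1..n}"
      using that by (intro mult_choose_dvd) auto
    then have "j * (n choose j) \<le> Lcm {1..n}" using pos by (intro dvd_imp_le)
    moreover have "n choose j \<le> j * (n choose j)" using False by simp
    ultimately show ?thesis by linarith
  qed (use pos in simp)
  then have "(\<Sum>j\<le>n. n choose j) \<le> (\<Sum>j\<le>n. Lcm {1..n})" by (intro sum_mono) auto
  then show ?thesis by (simp add: choose_row_sum)
qed

lemma prime_power_dvd_Lcm:
  fixes p :: nat
  assumes "prime p" "finite A" "A \<noteq> {}" "0 \<notin> A" "p ^ e dvd Lcm A"
  shows "\<exists>a\<in>A. p ^ e dvd a"
  using assms(2-)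
proof (induction A rule: finite_ne_induct)
  case (insert a A)
  have nz: "a \<noteq> 0" "Lcm A \<noteq> 0" using insert by (auto simp: Lcm_0_iff)
  then have "multiplicity p (lcm a (Lcm A)) = max (multiplicity p a) (multiplicity p (Lcm A))"
    by (intro multiplicity_lcm) (use assms(1) in auto)
  moreover have "e \<le> multiplicity p (lcm a (Lcm A))"
    using insert.prems nz assms(1) by (intro multiplicity_geI) auto
  ultimately have "e \<le> multiplicity p a \<or> e \<le> multiplicity p (Lcm A)" by linarith
  then have "p ^ e dvd a \<or> p ^ e dvd Lcm A" using multiplicity_dvd' by blast
  then show ?case using insert by auto
qed auto

text \<open>A prime power dividing the least common multiple divides one of the numbers up to
  \<open>n\<close>, so each prime contributes a factor of at most \<open>n\<close>.\<close>

lemma Lcm_le_power_primes: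
  fixes n :: nat
  assumes "0 < n"
  shows "Lcm {1..n} \<le> n ^ card {p. prime p \<and> p \<le> n}"
proof -
  let ?L = "Lcm {1..n}"
  have nz: "?L \<noteq> 0" by (simp add: Lcm_0_iff)
  have small: "p ^ multiplicity p ?L \<le> n" if "prime p" for p
  proof -
    have "\<exists>a\<in>{1..n}. p ^ multiplicity p ?L dvd a"
      using assms that by (intro prime_power_dvd_Lcm) (auto simp: multiplicity_dvd)
    then obtain a where a: "a \<in> {1..n}" "p ^ multiplicity p ?L dvd a" by blast
    then have "p ^ multiplicity p ?L \<le> a" by (intro dvd_imp_le) auto
    with a show ?thesis by simp
  qed
  have sub: "prime_factors ?L \<subseteq> {p. prime p \<and> p \<le> n}"
  proof
    fix p assume p: "p \<in> prime_factors ?L"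
    then have "prime p" "multiplicity p ?L \<noteq> 0"
      using nz by (auto simp: prime_factors_multiplicity)
    then show "p \<in> {p. prime p \<and> p \<le> n}"
      using small[of p] self_le_power[of p "multiplicity p ?L"] prime_ge_1_nat[of p] by auto
  qed
  have "?L = (\<Prod>p\<in>prime_factors ?L. p ^ multiplicity p ?L)"
    using nz by (simp add: prod_prime_factors)
  also have "\<dots> \<le> (\<Prod>p\<in>prime_factors ?L. n)"
    using small by (intro prod_mono) auto
  also have "\<dots> = n ^ card (prime_factors ?L)" by simp
  also have "\<dots> \<le> n ^ card {p. prime p \<and> p \<le> n}"
    using assms sub by (intro power_increasing card_mono) auto
  finally show ?thesis .
qed

text \<open>Comparing logarithms gives about \<open>x ^ 2 * ln 2 / ln (x ^ 2 + 1)\<close> primes up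
  to \<open>x ^ 2\<close>. The surplus over \<open>x\<close> pays for discarding small
  primes.\<close>

lemma many_primes: "\<forall>\<^sub>F x in sequentially. 2 * x < card {p :: nat. prime p \<and> p \<le> x ^ 2}"
proof -
  have "\<forall>\<^sub>F x :: nat in sequentially. (2 * real x + 1) * ln (real x ^ 2 + 1) < real x ^ 2 * ln 2"
    by real_asymp
  then show ?thesis
    using eventually_gt_at_top[of 0]
  proof eventually_elim
    case (elim x)
    let ?c = "card {p :: nat. prime p \<and> p \<le> x ^ 2}"
    have "2 ^ (x ^ 2) \<le> (x ^ 2 + 1) * Lcm {1..x ^ 2}" by (rule two_power_le_Lcm)
    also have "\<dots> \<le> (x ^ 2 + 1) * (x ^ 2) ^ ?c"
      using elim by (intro mult_left_mono Lcm_le_power_primes) auto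
    also have "\<dots> \<le> (x ^ 2 + 1) * (x ^ 2 + 1) ^ ?c"
      by (intro mult_left_mono power_mono) auto
    also have "\<dots> = (x ^ 2 + 1) ^ Suc ?c" by simp
    finally have "real (2 ^ (x ^ 2)) \<le> real ((x ^ 2 + 1) ^ Suc ?c)" by (rule of_nat_mono)
    then have "ln (real (2 ^ (x ^ 2))) \<le> ln (real ((x ^ 2 + 1) ^ Suc ?c))"
      by (intro ln_mono) (simp_all only: of_nat_0_less_iff zero_less_power zero_less_numeral
          add_pos_pos zero_less_one add_nonneg_pos zero_le)
    then have le: "real x ^ 2 * ln 2 \<le> (real ?c + 1) * ln (real x ^ 2 + 1)"
      by (simp only: of_nat_power ln_realpow of_nat_add of_nat_1 of_nat_numeral of_nat_Suc)
        (simp add: ln_realpow add.commute algebra_simps)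
    show ?case
    proof (rule ccontr)
      assume "\<not> 2 * x < ?c"
      then have "real ?c + 1 \<le> 2 * real x + 1" by simp
      then have "(real ?c + 1) * ln (real x ^ 2 + 1) \<le> (2 * real x + 1) * ln (real x ^ 2 + 1)"
        by (intro mult_right_mono) auto
      with le elim show False by linarith
    qed
  qed
qed

section \<open>Padding to an exact width\<close>

lemma derivable_mono:
  assumes "derivable F W C" "F \<subseteq> F'" "W \<le> W'"
  shows "derivable F' W' C"
  using assms(1)
proof induction
  case (axiom_clause C)
  show ?case
    by (rule derivable.axiom_clause) (use axiom_clause assms(2,3) in auto)
next
  case (resolvent A B R)
  show ?case
    by (rule derivable.resolvent[OF resolvent.IH resolvent.hyps(3,4)]) (use resolvent.hyps(5) assms(3) in auto)
qed

text \<open>A chain in which every resolution step gains one literal, so a clause of width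
  \<open>w\<close> arises from clauses of width at most 3. Each clause has a positive literal, so
  setting all padding variables to 1 satisfies it.\<close>

definition pad :: "nat \<Rightarrow> nat cnf" where
  "pad w = {{Pos (pvar 1 0)}} \<union> (\<Union>j<w - 1. {{Neg (pvar 1 j), Pos (pvar 0 j), Pos (pvar 1 (Suc j))}})"

definition pad_clause :: "nat \<Rightarrow> nat clause" where
  "pad_clause j = insert (Pos (pvar 1 j)) ((\<lambda>l. Pos (pvar 0 l)) ` {..<j})"

lemma pad_clause_props: "is_clause (pad_clause j)" "width (pad_clause j) = Suc j"
proof -
  show "is_clause (pad_clause j)"
    by (auto simp: is_clause_def pad_clause_def inj_on_def)
  have "card ((\<lambda>l. Pos (pvar 0 l)) ` {..<j}) = j"
    by (subst card_image) (auto simp: inj_on_def)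
  then show "width (pad_clause j) = Suc j"
    unfolding width_def pad_clause_def by (subst card_insert_disjoint) auto
qed

lemma derivable_pad_clause:
  assumes "3 \<le> w" "j < w" "pad w \<subseteq> F"
  shows "derivable F w (pad_clause j)"
  using assms(2)
proof (induction j)
  case 0
  have "pad_clause 0 \<in> F" using assms(3) by (auto simp: pad_def pad_clause_def)
  then show ?case using pad_clause_props[of 0] assms(1) by (simp add: derivable.axiom_clause)
next
  case (Suc j)
  let ?E = "{Neg (pvar 1 j), Pos (pvar 0 j), Pos (pvar 1 (Suc j))}"
  have "?E \<in> pad w" unfolding pad_def using Suc.prems by (intro UnI2 UN_I[of j]) auto
  then have "?E \<in> F" using assms(3) by blast
  moreover have "is_clause ?E" by (auto simp: is_clause_def inj_on_def)
  moreover have "width ?E \<le> w" using assms(1) by (simp add: width_def)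
  ultimately have E: "derivable F w ?E" by (rule derivable.axiom_clause)
  have "resolves (pad_clause j) ?E (pad_clause (Suc j))"
    unfolding resolves_def
    by (rule exI[of _ "pvar 1 j"], rule exI[of _ "(\<lambda>l. Pos (pvar 0 l)) ` {..<j}"],
        rule exI[of _ "{Pos (pvar 0 j), Pos (pvar 1 (Suc j))}"])
      (auto simp: pad_clause_def lessThan_Suc)
  moreover have "derivable F w (pad_clause j)" using Suc by simp
  ultimately show ?case
    using derivable.resolvent[OF _ E] pad_clause_props[of "Suc j"] Suc.prems by simp
qed

lemma exact_width_refutation:
  assumes "3 \<le> w" "pad w \<subseteq> F" "derivable F w {}"
  shows "\<exists>\<pi>. is_refutation F \<pi> \<and> ref_width \<pi> = w"
proof (rule refutation_of_width[OF assms(3)])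
  show "derivable F w (pad_clause (w - 1))"
    using assms(1) by (intro derivable_pad_clause[OF assms(1) _ assms(2)]) simp
  show "width (pad_clause (w - 1)) = w" using assms(1) by (simp add: pad_clause_props)
qed

lemma pad_positive: "C \<in> pad w \<Longrightarrow> \<exists>b i. Pos (pvar b i) \<in> C"
  by (auto simp: pad_def)

lemma is_kcnf_pad: "is_kcnf 4 (pad w)"
  unfolding is_kcnf_def
proof (intro conjI ballI)
  show "finite (pad w)" by (simp add: pad_def)
  fix C assume "C \<in> pad w"
  then consider "C = {Pos (pvar 1 0)}"
    | j where "C = {Neg (pvar 1 j), Pos (pvar 0 j), Pos (pvar 1 (Suc j))}"
    unfolding pad_def by blast
  then show "is_clause C" "width C \<le> 4"
    by (cases; auto simp: is_clause_def inj_on_def width_def)+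
qed

lemma cnf_size_pad: "1 \<le> w \<Longrightarrow> cnf_size (pad w) \<le> 3 * w"
proof -
  assume w: "1 \<le> w"
  let ?E = "\<lambda>j. {Neg (pvar 1 j), Pos (pvar 0 j), Pos (pvar 1 (Suc j))}"
  have "cnf_size (pad w) \<le> cnf_size {{Pos (pvar 1 0)}} + cnf_size (\<Union>j<w - 1. {?E j})"
    unfolding pad_def by (rule cnf_size_Un) auto
  also have "cnf_size (\<Union>j<w - 1. {?E j}) \<le> (\<Sum>j<w - 1. cnf_size {?E j})"
    by (rule cnf_size_UN) auto
  also have "\<dots> = (\<Sum>j<w - 1. 3)" by (intro sum.cong) (auto simp: cnf_size_def width_def)
  finally show ?thesis using w by (simp add: cnf_size_def width_def)
qed

lemma is_kcnf_Un: "is_kcnf r F \<Longrightarrow> is_kcnf r F' \<Longrightarrow> is_kcnf r (F \<union> F')"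
  unfolding is_kcnf_def by blast

lemma card_cnf_vars_le: "is_kcnf r F \<Longrightarrow> card (cnf_vars F) \<le> cnf_size F"
proof -
  assume F: "is_kcnf r F"
  have "card (cnf_vars F) \<le> (\<Sum>C\<in>F. card (var ` C))"
    unfolding cnf_vars_def using F by (intro card_UN_le) (auto simp: is_kcnf_def)
  also have "\<dots> \<le> cnf_size F"
    unfolding cnf_size_def width_def using F
    by (intro sum_mono card_image_le) (auto simp: is_kcnf_def is_clause_def)
  finally show ?thesis .
qed

definition padded_cnf :: "nat \<Rightarrow> nat cnf \<Rightarrow> bool" where
  "padded_cnf w F \<longleftrightarrow> is_kcnf 4 F \<and> (\<exists>\<pi>. is_refutation F \<pi> \<and> ref_width \<pi> = w) \<and>
     w \<le> card (cnf_vars F) \<and> cnf_size F \<le> 70 * card (cnf_vars F)"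

lemma cylinder_cnf:
  assumes cyl: "compressed_cylinder k m s M g0 g I"
    and P: "\<And>i. i < k \<Longrightarrow> g0 * (\<Prod>j\<in>{j. j < m \<and> i \<in> I j}. g j) \<le> int P"
  shows "\<exists>F. padded_cnf (k + 3) F \<and> cnf_size F \<le> 70 * (k * (P + 2 * M)) \<and>
   (\<forall>\<pi> d. is_refutation F \<pi> \<longrightarrow> ref_width \<pi> \<le> k + s - 1 \<longrightarrow>
      4 * int s * (int d + 1) + 2 * int s < (g0 * (\<Prod>j<m. g j)) div 2 \<longrightarrow> d \<le> ref_depth \<pi>)"
proof -
  interpret compressed_cylinder k m s M g0 g I by (rule cyl)
  define F where "F = formula \<union> pad (k + 3)"
  have kcnf: "is_kcnf 4 F"
    unfolding F_def by (intro is_kcnf_Un is_kcnf_formula is_kcnf_pad)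
  have "derivable F (k + 3) {}"
    by (rule derivable_mono[OF derivable_empty_formula]) (auto simp: F_def)
  then have ref: "\<exists>\<pi>. is_refutation F \<pi> \<and> ref_width \<pi> = k + 3"
    by (intro exact_width_refutation) (auto simp: F_def)
  have "finite formula" "finite (pad (k + 3))" using is_kcnf_formula is_kcnf_pad by (auto simp: is_kcnf_def)
  then have "cnf_size F \<le> cnf_size formula + cnf_size (pad (k + 3))"
    unfolding F_def by (rule cnf_size_Un)
  also have "\<dots> \<le> 65 * volume + 3 * (k + 3)"
    using cnf_size_formula cnf_size_pad[of "k + 3"] by linarith
  finally have size: "cnf_size F \<le> 65 * volume + 3 * (k + 3)" .
  have "(\<Sum>i<k. 2 * M) \<le> volume" unfolding volume_def by (intro sum_mono) auto
  then have "k * (2 * M) \<le> volume" by simp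
  moreover have "2 * (2 * M) \<le> k * (2 * M)" using k by (intro mult_right_mono) auto
  ultimately have vol: "k + 3 \<le> volume" using M k by linarith
  have "cnf_vars formula \<subseteq> cnf_vars F" unfolding cnf_vars_def F_def by blast
  moreover have "finite (cnf_vars F)"
    using kcnf by (auto simp: cnf_vars_def is_kcnf_def is_clause_def)
  ultimately have vars: "volume \<le> card (cnf_vars F)"
    using cnf_vars_formula card_mono by (meson order_trans)
  have "volume \<le> (\<Sum>i<k. P + 2 * M)"
    unfolding volume_def using P by (intro sum_mono) (force simp: p_def nat_le_iff)
  then have vol': "volume \<le> k * (P + 2 * M)" by simp
  have depth: "d \<le> ref_depth \<pi>"
    if "is_refutation F \<pi>" "ref_width \<pi> \<le> k + s - 1"
      "4 * int s * (int d + 1) + 2 * int s < (g0 * (\<Prod>j<m. g j)) div 2" for \<pi> d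
    using ref_depth_formula[of "pad (k + 3)" \<pi> d] that pad_positive
    unfolding F_def T_def G_def by blast
  have "padded_cnf (k + 3) F"
    unfolding padded_cnf_def
  proof (intro conjI)
    show "k + 3 \<le> card (cnf_vars F)" using vol vars by (rule order_trans)
    have "3 * (k + 3) \<le> 3 * volume" using vol by (rule mult_le_mono2)
    then have "cnf_size F \<le> 70 * volume" using size by linarith
    then show "cnf_size F \<le> 70 * card (cnf_vars F)"
      using mult_le_mono2[OF vars, of 70] by (rule order_trans)
  qed (use kcnf ref in auto)
  moreover have "cnf_size F \<le> 70 * (k * (P + 2 * M))"
  proof -
    have "3 * (k + 3) \<le> 3 * volume" using vol by (rule mult_le_mono2)
    then have "cnf_size F \<le> 70 * volume" using size by linarith
    then show ?thesis using mult_le_mono2[OF vol', of 70] by (rule order_trans)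
  qed
  ultimately show ?thesis using depth by blast
qed

section \<open>Families of formulas\<close>

lemma w_param_bounds:
  "\<forall>\<^sub>F n in sequentially. sqrt (real n) \<le> real (w_param n - 3) \<and> w_param n - 3 \<le> n \<and> w_param n = (w_param n - 3) + 3"
proof -
  have "\<forall>\<^sub>F n :: nat in sequentially. sqrt (real n) \<le> real n / (2 * ln (real n)) - 1"
    by real_asymp
  moreover have "\<forall>\<^sub>F n :: nat in sequentially. real n / (2 * ln (real n)) \<le> real n"
    by real_asymp
  ultimately show ?thesis
  proof eventually_elim
    case (elim n)
    let ?x = "real n / (2 * ln (real n))"
    have "0 \<le> sqrt (real n)" by simp
    then have "0 \<le> ?x" using elim by linarith
    then have "real (nat \<lfloor>?x\<rfloor>) = of_int \<lfloor>?x\<rfloor>" by simp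
    then have "?x - 1 \<le> real (nat \<lfloor>?x\<rfloor>)" "real (nat \<lfloor>?x\<rfloor>) \<le> ?x" by linarith+
    moreover have "w_param n - 3 = nat \<lfloor>?x\<rfloor>" by (simp add: w_param_def)
    ultimately have "sqrt (real n) \<le> real (w_param n - 3)" "real (w_param n - 3) \<le> real n"
      using elim by linarith+
    then show ?case by (simp add: w_param_def)
  qed
qed

lemma filterlim_width_parameter: "filterlim (\<lambda>n. w_param n - 3) at_top sequentially"
  unfolding filterlim_at_top
proof
  fix Z :: nat
  have "\<forall>\<^sub>F n :: nat in sequentially. real Z \<le> sqrt (real n)" by real_asymp
  with w_param_bounds show "\<forall>\<^sub>F n in sequentially. Z \<le> w_param n - 3"
  proof eventually_elim
    case (elim n)
    then have "real Z \<le> real (w_param n - 3)" by linarith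
    then show ?case by simp
  qed
qed

text \<open>The construction works only for large \<open>k = w - 3\<close>. The finitely many other
  indices receive a trivial contradiction, padded to the exact width, since 4-CNFs and refutations
  are demanded there as well.\<close>

lemma refutable_family:
  assumes ev: "\<forall>\<^sub>F k in sequentially. \<exists>F. padded_cnf (k + 3) F \<and> R k F"
  shows "\<exists>F. linear_size_4cnf_family F (\<lambda>n. card (cnf_vars (F n))) \<and> has_width_w_refutations F \<and>
     (\<forall>\<^sub>F n in sequentially. R (w_param n - 3) (F n))"
proof -
  define Q where "Q n F \<longleftrightarrow> padded_cnf (w_param n) F \<and> R (w_param n - 3) F" for n F
  define S where "S n F \<longleftrightarrow> is_kcnf 4 F \<and> (\<exists>\<pi>. is_refutation F \<pi> \<and> ref_width \<pi> = w_param n)"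
    for n and F :: "nat cnf"
  have evQ: "\<forall>\<^sub>F n in sequentially. \<exists>F. Q n F"
    using eventually_compose_filterlim[OF ev filterlim_width_parameter] w_param_bounds
    by eventually_elim (auto simp: Q_def)
  have exS: "\<exists>F. S n F" for n
  proof -
    define F where "F = {{Pos 0}, {Neg 0}} \<union> pad (w_param n)"
    have w: "3 \<le> w_param n" by (simp add: w_param_def)
    have "derivable F (w_param n) {Pos 0}" "derivable F (w_param n) {Neg 0}"
      using w by (auto intro!: derivable.axiom_clause simp: F_def is_clause_def width_def)
    moreover have "resolves {Pos 0} {Neg 0} {}" unfolding resolves_def by auto
    ultimately have "derivable F (w_param n) {}"
      by (rule derivable.resolvent) (auto simp: is_clause_def width_def)
    then have "\<exists>\<pi>. is_refutation F \<pi> \<and> ref_width \<pi> = w_param n"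
      using w by (intro exact_width_refutation) (auto simp: F_def)
    moreover have "is_kcnf 4 F"
      unfolding F_def by (intro is_kcnf_Un is_kcnf_pad) (auto simp: is_kcnf_def is_clause_def width_def)
    ultimately show ?thesis unfolding S_def by blast
  qed
  have "\<exists>F. S n F \<and> ((\<exists>F. Q n F) \<longrightarrow> Q n F)" for n
  proof (cases "\<exists>F. Q n F")
    case True
    then show ?thesis unfolding Q_def S_def padded_cnf_def by blast
  qed (use exS in blast)
  then obtain F where F: "\<And>n. S n (F n)" "\<And>n. \<exists>F. Q n F \<Longrightarrow> Q n (F n)" by metis
  have evF: "\<forall>\<^sub>F n in sequentially. Q n (F n)"
    using evQ by eventually_elim (rule F(2))
  let ?N = "\<lambda>n. card (cnf_vars (F n))"
  have "linear_size_4cnf_family F ?N"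
    unfolding linear_size_4cnf_family_def
  proof (intro conjI allI)
    show "is_kcnf 4 (F n)" for n using F(1) by (simp add: S_def)
    have "\<forall>\<^sub>F n in sequentially. w_param n - 3 \<le> ?N n"
      using evF by eventually_elim (auto simp: Q_def padded_cnf_def)
    then show "filterlim ?N at_top sequentially"
      by (rule filterlim_at_top_mono[OF filterlim_width_parameter])
    show "(\<lambda>n. real (cnf_size (F n))) \<in> \<Theta>(\<lambda>n. real (?N n))"
    proof (rule bigthetaI)
      show "(\<lambda>n. real (cnf_size (F n))) \<in> O(\<lambda>n. real (?N n))"
      proof (rule bigoI)
        show "\<forall>\<^sub>F n in sequentially. norm (real (cnf_size (F n))) \<le> 70 * norm (real (?N n))"
          using evF by eventually_elim (auto simp: Q_def padded_cnf_def)
      qed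
      show "(\<lambda>n. real (cnf_size (F n))) \<in> \<Omega>(\<lambda>n. real (?N n))"
        using card_cnf_vars_le F(1) unfolding S_def
        by (intro landau_omega.bigI[of 1]) (auto intro!: always_eventually)
    qed
  qed auto
  moreover have "has_width_w_refutations F"
    unfolding has_width_w_refutations_def using F(1) by (auto simp: S_def)
  moreover have "\<forall>\<^sub>F n in sequentially. R (w_param n - 3) (F n)"
    using evF by eventually_elim (simp add: Q_def)
  ultimately show ?thesis by blast
qed

section \<open>Exponential depth\<close>

lemma real_div_nat_ge: "real a / real b - 1 \<le> real (a div b)"
  using floor_divide_of_nat_eq[of a b, where ?'a = real] by linarith

lemma exponential_instances:
  assumes s: "1 \<le> s"
  shows "\<forall>\<^sub>F k in sequentially. \<exists>F. padded_cnf (k + 3) F \<and> (real (cnf_size F) \<le> real k ^ 6 \<and>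
    (\<forall>\<pi>. is_refutation F \<pi> \<longrightarrow> ref_width \<pi> \<le> k + s - 1 \<longrightarrow> 2 ^ (k div (s + 1) div 2) \<le> ref_depth \<pi>))"
proof -
  have "\<forall>\<^sub>F k :: nat in sequentially. 70 * (real k * (real k ^ 4 + 2 * (real k + real s + 1))) \<le> real k ^ 6"
    by real_asymp
  then show ?thesis
    using many_primes eventually_ge_at_top[of "(s + 1) * (40 * s + 40)"]
  proof eventually_elim
    case (elim k)
    define m where "m = k div (s + 1)"
    have "(s + 1) * (40 * s + 40) div (s + 1) = 40 * s + 40"
      by (rule nonzero_mult_div_cancel_left) simp
    then have m_ge: "40 * s + 40 \<le> m"
      using div_le_mono[OF elim(3), of "s + 1"] by (simp only: m_def)
    have m_le: "m * (s + 1) \<le> k" unfolding m_def by (rule div_times_less_eq_dividend)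
    then have "m \<le> k" by (simp add: order_trans[of m "m * (s + 1)"])
    \<comment> \<open>Primes up to \<open>4 * s + 1\<close> are dropped, so that any remaining one,
      here \<open>f m\<close>, may serve as the common factor.\<close>
    define B where "B = {p :: nat. prime p \<and> p \<le> k ^ 2} - {..4 * s + 1}"
    have "card {p :: nat. prime p \<and> p \<le> k ^ 2} - card {..4 * s + 1} \<le> card B"
      unfolding B_def by (rule diff_card_le_card_Diff) simp
    then have "card {..m} \<le> card B" using elim(2) m_ge \<open>m \<le> k\<close> by simp
    moreover have "finite B" unfolding B_def by simp
    ultimately obtain f where f: "inj_on f {..m}" "f ` {..m} \<subseteq> B"
      using inj_on_iff_card_le[of "{..m}" B] by auto
    have fB: "prime (f j)" "f j \<le> k ^ 2" "4 * s + 1 < f j" if "j \<le> m" for j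
      using f(2) that unfolding B_def by auto
    define g where "g j = int (f j)" for j
    \<comment> \<open>Consecutive blocks of \<open>s + 1\<close> rows, the smallest size exceeding
      \<open>s\<close>; rows after the last complete block keep just the common factor
      \<open>g m\<close>.\<close>
    define I where "I j = {j * (s + 1)..<(j + 1) * (s + 1)}" for j
    have I_iff: "i \<in> I j \<longleftrightarrow> j = i div (s + 1)" for i j
      unfolding I_def using div_nat_eqI[of "s + 1" j i] div_times_less_eq_dividend[of i "s + 1"]
        dividend_less_div_times[of "s + 1" i] by (auto simp: algebra_simps)
    have cop: "coprime (g i) (g j)" if "i \<le> m" "j \<le> m" "i \<noteq> j" for i j
    proof -
      have "f i \<noteq> f j" using f(1) that by (auto simp: inj_on_def)
      then show ?thesis
        unfolding g_def using primes_coprime[OF fB(1) fB(1)] that by simp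
    qed
    have cyl: "compressed_cylinder k m s (k + s + 1) (g m) g I"
    proof
      show "2 \<le> k" using m_ge \<open>m \<le> k\<close> by linarith
      show "4 * int s < g m" "2 \<le> g m" using fB(3)[of m] s by (auto simp: g_def)
      show "2 \<le> g j" if "j < m" for j using fB(3)[of j] s that by (auto simp: g_def)
      show "coprime (g m) (g j)" if "j < m" for j using cop that by simp
      show "coprime (g i) (g j)" if "i < m" "j < m" "i \<noteq> j" for i j using cop that by simp
      show "I j \<subseteq> {..<k}" if "j < m" for j
      proof -
        have "(j + 1) * (s + 1) \<le> m * (s + 1)" using that by (intro mult_le_mono1) simp
        then show ?thesis unfolding I_def using m_le by auto
      qed
      show "s < card (I j)" if "j < m" for j by (simp add: I_def)
      show "arc_like k (I j)" if "j < m" for j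
        unfolding arc_like_def I_def by auto
      show "\<exists>j<m. i \<notin> I j" if "i < k" for i
      proof -
        have "i \<notin> I 0 \<or> i \<notin> I 1" using I_iff by auto
        moreover have "0 < m" "1 < m" using m_ge by linarith+
        ultimately show ?thesis by blast
      qed
      show "k + s < k + s + 1" by simp
    qed
    have P: "g m * (\<Prod>j\<in>{j. j < m \<and> i \<in> I j}. g j) \<le> int (k ^ 4)" for i
    proof -
      have le: "g j \<le> int (k ^ 2)" "1 \<le> g j" if "j \<le> m" for j
        using fB(2,3)[OF that] by (simp_all add: g_def)
      have "{j. j < m \<and> i \<in> I j} = {} \<or> {j. j < m \<and> i \<in> I j} = {i div (s + 1)} \<and> i div (s + 1) < m"
        unfolding I_iff by auto
      then have "(\<Prod>j\<in>{j. j < m \<and> i \<in> I j}. g j) \<le> int (k ^ 2)"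
      proof (elim disjE conjE)
        assume e: "{j. j < m \<and> i \<in> I j} = {}"
        show ?thesis unfolding e using le[of m] by simp
      next
        assume e: "{j. j < m \<and> i \<in> I j} = {i div (s + 1)}" "i div (s + 1) < m"
        show ?thesis unfolding e(1) using le[of "i div (s + 1)"] e(2) by simp
      qed
      then have "g m * (\<Prod>j\<in>{j. j < m \<and> i \<in> I j}. g j) \<le> int (k ^ 2) * int (k ^ 2)"
        using le[of m] le by (intro mult_mono prod_nonneg) (auto intro: order_trans[of 0 1])
      also have "int (k ^ 2) * int (k ^ 2) = int (k ^ 4)" by (simp add: power_add[symmetric])
      finally show ?thesis .
    qed
    obtain F where F: "padded_cnf (k + 3) F" "cnf_size F \<le> 70 * (k * (k ^ 4 + 2 * (k + s + 1)))"
      "\<And>\<pi> d. is_refutation F \<pi> \<Longrightarrow> ref_width \<pi> \<le> k + s - 1 \<Longrightarrow>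
      4 * int s * (int d + 1) + 2 * int s < (g m * (\<Prod>j<m. g j)) div 2 \<Longrightarrow> d \<le> ref_depth \<pi>"
      using cylinder_cnf[OF cyl P] by blast
    have "real (cnf_size F) \<le> real (70 * (k * (k ^ 4 + 2 * (k + s + 1))))"
      using F(2) by (rule of_nat_mono)
    also have "\<dots> \<le> real k ^ 6" using elim(1) by (simp add: algebra_simps)
    finally have size: "real (cnf_size F) \<le> real k ^ 6" .
    \<comment> \<open>About the square root of \<open>2 ^ m\<close>; the spare factor
      \<open>d\<close> absorbs the cost per round, which is linear in \<open>s\<close>.\<close>
    define d :: nat where "d = 2 ^ (m div 2)"
    have "(2 :: int) ^ m = (\<Prod>j<m. 2)" by simp
    also have "\<dots> \<le> (\<Prod>j<m. g j)"
    proof (intro prod_mono conjI)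
      show "2 \<le> g j" if "j \<in> {..<m}" for j using fB(3)[of j] s that by (auto simp: g_def)
    qed simp
    finally have prod: "(2 :: int) ^ m \<le> (\<Prod>j<m. g j)" .
    moreover have "2 \<le> g m" using fB(3)[of m] s by (simp add: g_def)
    ultimately have "2 * 2 ^ m \<le> g m * (\<Prod>j<m. g j)" by (intro mult_mono) auto
    then have G: "(2 :: int) ^ m \<le> (g m * (\<Prod>j<m. g j)) div 2" by simp
    have "m div 2 < d" unfolding d_def by (rule less_exp)
    then have d_ge: "20 * int s + 20 \<le> int d" using m_ge by linarith
    have "d * d = 2 ^ (m div 2 + m div 2)" by (simp add: d_def power_add)
    also have "\<dots> \<le> 2 ^ m" by (intro power_increasing) auto
    finally have "int (d * d) \<le> int (2 ^ m)" by (rule of_nat_mono)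
    then have "int d * int d \<le> 2 ^ m" by simp
    moreover have "(20 * int s + 20) * int d \<le> int d * int d"
      using d_ge by (intro mult_right_mono) auto
    moreover have "4 * int s * (int d + 1) + 2 * int s < (20 * int s + 20) * int d"
    proof -
      have "int s \<le> int s * int d" using d_ge mult_left_mono[of 1 "int d" "int s"] by simp
      then show ?thesis using d_ge by (simp add: algebra_simps)
    qed
    ultimately have "4 * int s * (int d + 1) + 2 * int s < (g m * (\<Prod>j<m. g j)) div 2"
      using G by linarith
    then have "d \<le> ref_depth \<pi>" if "is_refutation F \<pi>" "ref_width \<pi> \<le> k + s - 1" for \<pi>
      using F(3) that by blast
    then show ?case using F(1) size unfolding d_def m_def by blast
  qed
qed

lemma exponential_family:
  fixes C :: real
  shows "\<exists>(F :: nat \<Rightarrow> nat cnf) (N :: nat \<Rightarrow> nat).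
        linear_size_4cnf_family F N \<and> has_width_w_refutations F \<and>
        (\<exists>k::nat. (\<lambda>n. real (N n)) \<in> O(\<lambda>n. real n ^ k)) \<and>
        (\<exists>\<epsilon>>0. \<forall>\<^sub>F n in sequentially. \<forall>\<pi>.
           is_refutation (F n) \<pi> \<and> real (ref_width \<pi>) \<le> real (w_param n) + C \<longrightarrow>
           real (ref_depth \<pi>) \<ge> 2 powr (real (cnf_size (F n)) powr \<epsilon>))"
proof -
  \<comment> \<open>The width \<open>w_param n + C\<close> is \<open>k + 3 + C\<close>, which must
    not exceed \<open>k + s - 1\<close>.\<close>
  define s where "s = nat \<lceil>\<bar>C\<bar>\<rceil> + 4"
  have s: "1 \<le> s" "C \<le> real s - 4" by (auto simp: s_def) linarith
  define R where "R k F \<longleftrightarrow> real (cnf_size F) \<le> real k ^ 6 \<and>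
    (\<forall>\<pi>. is_refutation F \<pi> \<longrightarrow> ref_width \<pi> \<le> k + s - 1 \<longrightarrow> 2 ^ (k div (s + 1) div 2) \<le> ref_depth \<pi>)"
    for k and F :: "nat cnf"
  obtain F where F: "linear_size_4cnf_family F (\<lambda>n. card (cnf_vars (F n)))"
      "has_width_w_refutations F" "\<forall>\<^sub>F n in sequentially. R (w_param n - 3) (F n)"
    using refutable_family[of R] exponential_instances[OF s(1)] unfolding R_def by blast
  have kcnf: "is_kcnf 4 (F n)" for n using F(1) by (simp add: linear_size_4cnf_family_def)
  have "(\<lambda>n. real (card (cnf_vars (F n)))) \<in> O(\<lambda>n. real n ^ 6)"
  proof (rule bigoI)
    show "\<forall>\<^sub>F n in sequentially. norm (real (card (cnf_vars (F n)))) \<le> 1 * norm (real n ^ 6)"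
      using F(3) w_param_bounds
    proof eventually_elim
      case (elim n)
      have "real (card (cnf_vars (F n))) \<le> real (cnf_size (F n))"
        using card_cnf_vars_le[OF kcnf] by simp
      also have "\<dots> \<le> real (w_param n - 3) ^ 6" using elim by (simp add: R_def)
      also have "\<dots> \<le> real n ^ 6" using elim by (intro power_mono) auto
      finally show ?case by simp
    qed
  qed
  moreover have "\<forall>\<^sub>F n in sequentially. \<forall>\<pi>.
           is_refutation (F n) \<pi> \<and> real (ref_width \<pi>) \<le> real (w_param n) + C \<longrightarrow>
           real (ref_depth \<pi>) \<ge> 2 powr (real (cnf_size (F n)) powr (1 / 12))"
  proof -
    have "\<forall>\<^sub>F k :: nat in sequentially. sqrt (real k) \<le> (real k / (real s + 1) - 1) / 2 - 1"
      by real_asymp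
    from F(3) w_param_bounds eventually_compose_filterlim[OF this filterlim_width_parameter]
    show ?thesis
    proof eventually_elim
      case (elim n)
      define k where "k = w_param n - 3"
      have w: "w_param n = k + 3" using elim(2) by (simp add: k_def)
      show ?case
      proof (intro allI impI)
        fix \<pi> assume \<pi>: "is_refutation (F n) \<pi> \<and> real (ref_width \<pi>) \<le> real (w_param n) + C"
        then have "real (ref_width \<pi>) \<le> real k + real s - 1" using s(2) w by simp
        then have "ref_width \<pi> \<le> k + s - 1" using s(1) by linarith
        then have depth: "2 ^ (k div (s + 1) div 2) \<le> ref_depth \<pi>"
          using elim(1) \<pi> by (simp add: R_def k_def)
        have size: "real (cnf_size (F n)) \<le> real k ^ 6" using elim(1) by (simp add: R_def k_def)
        \<comment> \<open>The size is at most \<open>k ^ 6\<close>, so the exponent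
          \<open>1 / 12\<close> leaves \<open>sqrt k\<close>, which is eventually below
          \<open>k div (s + 1) div 2\<close>.\<close>
        have "real (cnf_size (F n)) powr (1 / 12) \<le> (real k ^ 6) powr (1 / 12)"
          using size by (intro powr_mono2) auto
        also have "\<dots> = sqrt (real k)"
        proof (cases "k = 0")
          case False
          then have "(real k ^ 6) powr (1 / 12) = (real k powr 6) powr (1 / 12)"
            by (subst powr_numeral) auto
          also have "\<dots> = real k powr (1 / 2)" unfolding powr_powr by simp
          finally show ?thesis using False by (simp add: powr_half_sqrt)
        qed simp
        also have "\<dots> \<le> (real k / (real s + 1) - 1) / 2 - 1" using elim(3) by (simp add: k_def)
        also have "\<dots> \<le> real (k div (s + 1) div 2)"
        proof -
          have "real k / (real s + 1) - 1 \<le> real (k div (s + 1))"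
            using real_div_nat_ge[of k "s + 1"] by (simp add: add.commute)
          moreover have "real (k div (s + 1)) / 2 - 1 \<le> real (k div (s + 1) div 2)"
            using real_div_nat_ge[of "k div (s + 1)" 2] by simp
          moreover have "u \<le> v \<Longrightarrow> v / 2 - 1 \<le> w \<Longrightarrow> u / 2 - 1 \<le> w" for u v w :: real by linarith
          ultimately show ?thesis by blast
        qed
        finally have "2 powr (real (cnf_size (F n)) powr (1 / 12)) \<le> 2 powr real (k div (s + 1) div 2)"
          by (intro powr_mono) auto
        also have "\<dots> = real (2 ^ (k div (s + 1) div 2))" by (simp add: powr_realpow)
        also have "\<dots> \<le> real (ref_depth \<pi>)" using depth by (rule of_nat_mono)
        finally show "real (ref_depth \<pi>) \<ge> 2 powr (real (cnf_size (F n)) powr (1 / 12))" .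
      qed
    qed
  qed
  ultimately show ?thesis
    using F(1,2) by (intro exI[of _ F] exI[of _ "\<lambda>n. card (cnf_vars (F n))"] conjI exI[of _ 6]
      exI[of _ "1 / 12 :: real"]) auto
qed

section \<open>Superlinear depth\<close>

text \<open>As in Goedel's beta function: a common divisor divides \<open>b - a\<close>, hence
  \<open>L\<close>, hence 1.\<close>

lemma coprime_progression:
  fixes a b n L :: nat
  assumes "a < b" "b \<le> n" "fact n dvd L"
  shows "coprime (1 + a * L) (1 + b * L)"
proof (rule coprimeI)
  fix c assume c: "c dvd 1 + a * L" "c dvd 1 + b * L"
  have "c dvd b * (1 + a * L) - a * (1 + b * L)" using c by (intro dvd_diff_nat dvd_mult)
  also have "b * (1 + a * L) - a * (1 + b * L) = b - a" by (simp add: algebra_simps)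
  also have "b - a dvd fact n" using assms by (intro dvd_fact) auto
  finally have "c dvd a * L" using assms(3) dvd_trans by (intro dvd_mult) blast
  then show "is_unit c" using c(1) dvd_diff_nat[OF c(1), of "a * L"] by simp
qed

text \<open>Each row omits one factor of at least \<open>k ^ 3\<close>, so the size is of order
  \<open>k * G / k ^ 3\<close>. As \<open>s \<le> 2 * k\<close>, the depth is of order
  \<open>G / k\<close>. This wins a factor of order \<open>k\<close>, and \<open>sqrt k\<close>
  remains after the constants.\<close>

lemma superlinear_instances:
  fixes \<delta> :: real
  assumes \<delta>: "0 < \<delta>" "\<delta> < 1"
  shows "\<exists>K. \<forall>\<^sub>F k in sequentially. \<exists>F. padded_cnf (k + 3) F \<and> (real (cnf_size F) \<le> real k ^ K \<and>
    (\<forall>\<pi>. is_refutation F \<pi> \<longrightarrow> real (ref_width \<pi>) \<le> (1 + \<delta>) * real (k + 3) \<longrightarrow>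
      sqrt (real k) * real (cnf_size F) \<le> real (ref_depth \<pi>)))"
proof -
  \<comment> \<open>A factor is omitted by about \<open>k / m\<close> rows and must still occur in
    more than \<open>s\<close>, roughly \<open>\<delta> * k\<close>, of them; this \<open>m\<close>
    uses up at most about half of the gap \<open>(1 - \<delta>) * k\<close>.\<close>
  define m :: nat where "m = nat \<lceil>2 / (1 - \<delta>)\<rceil> + 3"
  have m3: "3 \<le> m" by (simp add: m_def)
  have "2 / (1 - \<delta>) \<le> real m" unfolding m_def by linarith
  then have m_inv: "1 / real m \<le> (1 - \<delta>) / 2" using \<delta> m3 by (simp add: field_simps)
  \<comment> \<open>Chosen so that \<open>g j \<le> c * k ^ 3\<close>, which is at most
    \<open>k ^ 4\<close> once \<open>c \<le> k\<close>.\<close>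
  define c :: nat where "c = 2 * (m + 1) * fact (m + 1)"
  \<comment> \<open>The large constant gives \<open>sqrt k \<ge> 10000\<close>, more than the
    product \<open>140 * 64\<close> of the constants lost in size and depth.\<close>
  define k0 :: nat where "k0 = nat \<lceil>20 / (1 - \<delta>)\<rceil> + 100000000 + c"
  have "\<exists>F. padded_cnf (k + 3) F \<and> (real (cnf_size F) \<le> real k ^ (4 * (m + 1)) \<and>
    (\<forall>\<pi>. is_refutation F \<pi> \<longrightarrow> real (ref_width \<pi>) \<le> (1 + \<delta>) * real (k + 3) \<longrightarrow>
      sqrt (real k) * real (cnf_size F) \<le> real (ref_depth \<pi>)))" if k: "k0 \<le> k" for k
  proof -
    have k_big: "100000000 \<le> k" "c \<le> k" using k by (simp_all add: k0_def)
    have "20 / (1 - \<delta>) \<le> real k" using k unfolding k0_def by linarith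
    then have k16: "20 \<le> (1 - \<delta>) * real k" using \<delta> by (simp add: field_simps)
    define W where "W = nat \<lfloor>(1 + \<delta>) * real (k + 3)\<rfloor>"
    have "0 \<le> (1 + \<delta>) * real (k + 3)" using \<delta> by simp
    then have W_le: "real W \<le> (1 + \<delta>) * real (k + 3)" unfolding W_def by linarith
    have "real (k + 3) \<le> (1 + \<delta>) * real (k + 3)" using \<delta> by (simp add: algebra_simps)
    then have W_ge: "k + 3 \<le> W" unfolding W_def by (simp add: le_nat_floor)
    define s where "s = W + 1 - k"
    have s4: "4 \<le> s" and Ws: "W = k + s - 1" using W_ge by (auto simp: s_def)
    have "real s = real W + 1 - real k" using W_ge by (simp add: s_def)
    then have s_le: "real s \<le> \<delta> * real k + 7" using W_le \<delta> by (simp add: algebra_simps)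
    moreover have "\<delta> * real k \<le> real k" using \<delta> by (simp add: mult_left_le_one_le)
    moreover have "7 \<le> real k" using k_big by simp
    ultimately have "real s \<le> 2 * real k" by linarith
    then have "real s \<le> real (2 * k)" by simp
    then have s2: "s \<le> 2 * k" by (simp only: of_nat_le_iff)
    define b where "b = k div m + 1"
    have "real b \<le> real k / real m + 1" unfolding b_def using of_nat_div_le_of_nat[of k m, where ?'a = real] by simp
    also have "real k / real m \<le> real k * ((1 - \<delta>) / 2)"
      using mult_left_mono[OF m_inv, of "real k"] by simp
    finally have b_le: "real b \<le> real k * ((1 - \<delta>) / 2) + 1" by simp
    have "real k * ((1 - \<delta>) / 2) = (real k - \<delta> * real k) / 2"
      "(1 - \<delta>) * real k = real k - \<delta> * real k" by (simp_all add: algebra_simps)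
    then have "real b \<le> (real k - \<delta> * real k) / 2 + 1" "20 \<le> real k - \<delta> * real k"
      using b_le k16 by (simp_all only:)
    moreover have "u \<le> w + 7 \<Longrightarrow> v \<le> (z - w) / 2 + 1 \<Longrightarrow> 20 \<le> z - w \<Longrightarrow> u + v < z" for u v w z :: real
      by (simp add: field_simps)
    ultimately have "real s + real b < real k" using s_le by blast
    then have sb: "s + b < k" by linarith
    have kmb: "k < m * b"
      unfolding b_def using dividend_less_times_div[of m k] m3 by (simp add: algebra_simps)
    \<comment> \<open>The factorial makes the progression \<open>1 + (j + 1) * L\<close> pairwise
      coprime, the power of \<open>k\<close> makes its members large and of comparable size.\<close>
    define L where "L = fact (m + 1) * k ^ 3"
    define g where "g j = int (1 + (j + 1) * L)" for j
    define I where "I j = {..<k} - {j * b..<(j + 1) * b}" for j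
    have L_ge: "k ^ 3 \<le> L" 
      using mult_le_mono1[OF fact_ge_1, of "k ^ 3" "m + 1"] by (simp only: L_def mult_1)
    have g_ge: "int (k ^ 3) \<le> g j" for j
    proof -
      have "k ^ 3 \<le> 1 + (j + 1) * L" using L_ge by simp
      then show ?thesis unfolding g_def by (rule of_nat_mono)
    qed
    have k3: "100000000 * k \<le> k ^ 3"
    proof -
      have "100000000 * 1 \<le> k * k" using k_big by (intro mult_mono) auto
      then have "100000000 * 1 * k \<le> k * k * k" by (rule mult_le_mono1)
      then show ?thesis by (simp add: power3_eq_cube)
    qed
    have g_big: "100000000 * int k \<le> g j" for j
    proof -
      have "int (100000000 * k) \<le> int (k ^ 3)" using k3 by (rule of_nat_mono)
      then show ?thesis using g_ge[of j] by simp
    qed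
    have g2: "2 \<le> g j" for j using g_big[of j] k_big by simp
    have g_le: "g j \<le> int (k ^ 4)" if "j \<le> m" for j
    proof -
      have "1 + (j + 1) * L \<le> (m + 1) * L + (m + 1) * L"
      proof (intro add_mono mult_le_mono1)
        have "1 \<le> k ^ 3" using k_big by simp
        then have "1 * 1 \<le> (m + 1) * L" using L_ge by (intro mult_le_mono) linarith+
        then show "1 \<le> (m + 1) * L" by simp
      qed (use that in auto)
      also have "\<dots> = c * k ^ 3" by (simp add: c_def L_def algebra_simps)
      also have "\<dots> \<le> k * k ^ 3" using k_big by (intro mult_le_mono1)
      also have "\<dots> = k ^ 4" by (simp add: power_eq_if)
      finally show ?thesis unfolding g_def by (rule of_nat_mono)
    qed
    have cop: "coprime (g i) (g j)" if "i \<le> m" "j \<le> m" "i \<noteq> j" for i j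
    proof -
      have "fact (m + 1) dvd L" by (simp add: L_def)
      then have "i' < j' \<Longrightarrow> j' \<le> m \<Longrightarrow> coprime (1 + (i' + 1) * L) (1 + (j' + 1) * L)" for i' j'
        by (intro coprime_progression[of _ _ "m + 1"]) auto
      then have "coprime (1 + (i + 1) * L) (1 + (j + 1) * L)"
        using that by (metis coprime_commute linorder_neqE_nat)
      then show ?thesis unfolding g_def coprime_int_iff .
    qed
    have miss: "\<exists>j<m. i \<notin> I j" if "i < k" for i
    proof (intro exI[of _ "i div b"] conjI)
      show "i div b < m" using kmb that by (intro less_mult_imp_div_less) linarith
      show "i \<notin> I (i div b)"
        unfolding I_def using div_times_less_eq_dividend[of i b] dividend_less_div_times[of b i]
        by (auto simp: b_def algebra_simps)
    qed
    have cyl: "compressed_cylinder k m s (k + s + 1) (g m) g I"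
    proof
      show "2 \<le> k" using k_big by simp
      show "4 * int s < g m" using g_big[of m] s2 k_big by linarith
      show "2 \<le> g m" by (rule g2)
      show "2 \<le> g j" if "j < m" for j by (rule g2)
      show "coprime (g m) (g j)" if "j < m" for j using cop that by simp
      show "coprime (g i) (g j)" if "i < m" "j < m" "i \<noteq> j" for i j using cop that by simp
      show "I j \<subseteq> {..<k}" if "j < m" for j by (auto simp: I_def)
      show "s < card (I j)" if "j < m" for j
      proof -
        have "card {..<k} - card {j * b..<(j + 1) * b} \<le> card (I j)"
          unfolding I_def by (rule diff_card_le_card_Diff) simp
        then show ?thesis using sb by simp
      qed
      show "arc_like k (I j)" if "j < m" for j
        unfolding arc_like_def I_def by (auto simp: subset_iff)
      show "\<exists>j<m. i \<notin> I j" if "i < k" for i by (rule miss[OF that])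
      show "k + s < k + s + 1" by simp
    qed
    define G where "G = g m * (\<Prod>j<m. g j)"
    have G_alt: "G = (\<Prod>j\<le>m. g j)" unfolding G_def lessThan_Suc_atMost[symmetric] by simp
    have gpos: "1 \<le> g j" for j using g2[of j] by simp
    have G_ge: "int k ^ 12 \<le> G"
    proof -
      have "int k ^ 12 \<le> int k ^ (3 * (m + 1))" using m3 k_big by (intro power_increasing) auto
      also have "\<dots> = (\<Prod>j\<le>m. int (k ^ 3))" by (simp add: power_mult power_add)
      also have "\<dots> \<le> G" unfolding G_alt using g_ge by (intro prod_mono) auto
      finally show ?thesis .
    qed
    have G_le: "G \<le> int k ^ (4 * (m + 1))"
    proof -
      have "G \<le> (\<Prod>j\<le>m. int (k ^ 4))"
        unfolding G_alt using g_le gpos by (intro prod_mono) (auto intro: order_trans[of 0 1])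
      also have "\<dots> = int k ^ (4 * (m + 1))" by (simp add: power_mult power_add)
      finally show ?thesis .
    qed
    define P where "P = nat (G div int (k ^ 3))"
    have P: "g m * (\<Prod>j\<in>{j. j < m \<and> i \<in> I j}. g j) \<le> int P" if i: "i < k" for i
    proof -
      obtain j0 where j0: "j0 < m" "i \<notin> I j0" using miss[OF i] by blast
      let ?A = "{j. j < m \<and> i \<in> I j}"
      have "(\<Prod>j\<in>?A. g j) \<le> (\<Prod>j\<in>{..<m} - {j0}. g j)"
        using j0 gpos by (intro prod_mono2) (auto intro: order_trans[of 0 1])
      then have "g m * (\<Prod>j\<in>?A. g j) \<le> g m * (\<Prod>j\<in>{..<m} - {j0}. g j)"
        using gpos[of m] by (intro mult_left_mono) auto
      then have "(g m * (\<Prod>j\<in>?A. g j)) * int (k ^ 3) \<le> (g m * (\<Prod>j\<in>{..<m} - {j0}. g j)) * g j0"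
      proof (rule mult_mono[OF _ g_ge])
        have "0 \<le> g j" for j using gpos[of j] by simp
        then show "0 \<le> g m * (\<Prod>j\<in>{..<m} - {j0}. g j)" by (intro mult_nonneg_nonneg prod_nonneg)
      qed simp
      also have "\<dots> = G"
        unfolding G_def using j0(1) by (simp add: prod.remove[of "{..<m}" j0] mult_ac)
      finally have "(g m * (\<Prod>j\<in>?A. g j)) * int (k ^ 3) div int (k ^ 3) \<le> G div int (k ^ 3)"
        using k_big by (intro zdiv_mono1) auto
      then have "g m * (\<Prod>j\<in>?A. g j) \<le> G div int (k ^ 3)" using k_big by simp
      then show ?thesis unfolding P_def by linarith
    qed
    obtain F where F: "padded_cnf (k + 3) F" "cnf_size F \<le> 70 * (k * (P + 2 * (k + s + 1)))"
      "\<And>\<pi> d. is_refutation F \<pi> \<Longrightarrow> ref_width \<pi> \<le> k + s - 1 \<Longrightarrow>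
      4 * int s * (int d + 1) + 2 * int s < G div 2 \<Longrightarrow> d \<le> ref_depth \<pi>"
      using cylinder_cnf[OF cyl P] unfolding G_def by blast
    define x where "x = real k"
    define y where "y = real_of_int G"
    have x: "100000000 \<le> x" using k_big(1) unfolding x_def by simp
    have y: "x ^ 12 \<le> y"
    proof -
      have "real_of_int (int k ^ 12) \<le> y" using G_ge unfolding y_def by (simp only: of_int_le_iff)
      then show ?thesis by (simp add: x_def)
    qed
    have y9: "100000000 * x ^ 4 \<le> y"
    proof -
      have "100000000 * x ^ 4 \<le> x ^ 8 * x ^ 4"
      proof (intro mult_right_mono)
        have "x \<le> x ^ 8" using x by (intro self_le_power) auto
        then show "100000000 \<le> x ^ 8" using x by linarith
      qed (use x in simp)
      also have "\<dots> = x ^ 12" by (simp flip: power_add)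
      finally show ?thesis using y by linarith
    qed
    have y_pos: "0 < y"
    proof -
      have "0 < 100000000 * x ^ 4" using x by simp
      then show ?thesis using y9 by linarith
    qed
    have size: "real (cnf_size F) \<le> 140 * y / x ^ 2"
    proof -
      have "0 \<le> G" using G_ge by (rule order_trans[rotated]) simp
      moreover have "0 < int (k ^ 3)" using k_big by simp
      ultimately have "0 \<le> G div int (k ^ 3)" by (simp only: pos_imp_zdiv_nonneg_iff)
      then have "real P = real_of_int (G div int (k ^ 3))"
        unfolding P_def by (rule of_nat_nat)
      also have "\<dots> \<le> y / x ^ 3"
        using real_of_int_div4[of G "int (k ^ 3)"] by (simp add: x_def y_def)
      finally have P_le: "real P \<le> y / x ^ 3" .
      have "real (2 * (k + s + 1)) \<le> 8 * x" using s2 k_big unfolding x_def by simp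
      also have "8 * x \<le> y / x ^ 3"
      proof -
        have "8 * x * x ^ 3 \<le> 100000000 * x ^ 4" using x by (simp add: power_eq_if)
        then show ?thesis using y9 x by (simp add: field_simps)
      qed
      finally have M_le: "real (2 * (k + s + 1)) \<le> y / x ^ 3" .
      have "real (cnf_size F) \<le> real (70 * (k * (P + 2 * (k + s + 1))))" using F(2) by (rule of_nat_mono)
      also have "\<dots> = 70 * (x * (real P + real (2 * (k + s + 1))))"
        by (simp only: x_def of_nat_mult of_nat_add of_nat_numeral)
      also have "\<dots> \<le> 70 * (x * (y / x ^ 3 + y / x ^ 3))"
        using x P_le M_le by (intro mult_left_mono add_mono) auto
      also have "\<dots> = 140 * y / x ^ 2" using x by (simp add: power3_eq_cube power2_eq_square field_simps)
      finally show ?thesis .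
    qed
    have "140 * y / x ^ 2 \<le> y"
    proof -
      have "140 \<le> x ^ 2" using x self_le_power[of x 2] by simp
      then have "140 * y \<le> x ^ 2 * y" using y_pos by (intro mult_right_mono) auto
      then show ?thesis using x by (simp add: field_simps)
    qed
    moreover have "y \<le> real k ^ (4 * (m + 1))"
    proof -
      have "y \<le> real_of_int (int k ^ (4 * (m + 1)))" using G_le unfolding y_def by (simp only: of_int_le_iff)
      then show ?thesis by simp
    qed
    ultimately have poly: "real (cnf_size F) \<le> real k ^ (4 * (m + 1))" using size by linarith
    \<comment> \<open>Since \<open>4 * s \<le> 8 * k\<close>, these rounds cost about
      \<open>G / 4\<close>, safely below the available \<open>G div 2\<close>.\<close>
    define d where "d = nat (G div (32 * int k))"
    have G_big: "100000000 * int k \<le> G"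
    proof -
      have "int k \<le> int k ^ 11" using k_big by (intro self_le_power) auto
      then have "100000000 \<le> int k ^ 11" using k_big by linarith
      then have "100000000 * int k \<le> int k ^ 11 * int k" using k_big by (intro mult_right_mono) auto
      then show ?thesis using G_ge by (simp add: power_eq_if)
    qed
    have k32: "0 < 32 * int k" "0 \<le> G" using G_big k_big by linarith+
    then have d_int: "int d = G div (32 * int k)"
      unfolding d_def by (intro nat_0_le) (simp only: pos_imp_zdiv_nonneg_iff)
    have "32 * int k * int d \<le> G"
    proof -
      have "32 * int k * (G div (32 * int k)) + G mod (32 * int k) = G" by (rule mult_div_mod_eq)
      moreover have "0 \<le> G mod (32 * int k)" using k32(1) by (rule pos_mod_sign)
      ultimately show ?thesis unfolding d_int by linarith
    qed
    moreover have "4 * int s * (int d + 1) \<le> 8 * int k * (int d + 1)"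
      using s2 by (intro mult_right_mono) auto
    moreover have "8 * int k * (int d + 1) = 8 * (int k * int d) + 8 * int k" by (simp add: algebra_simps)
    moreover have "32 * int k * int d = 32 * (int k * int d)" by simp
    ultimately have "4 * int s * (int d + 1) + 2 * int s < G div 2"
      using G_big s2 k_big by linarith
    then have depth: "d \<le> ref_depth \<pi>"
      if "is_refutation F \<pi>" "real (ref_width \<pi>) \<le> (1 + \<delta>) * real (k + 3)" for \<pi>
    proof (intro F(3) that(1))
      have "ref_width \<pi> \<le> W" unfolding W_def using that(2) by (simp add: le_nat_floor)
      then show "ref_width \<pi> \<le> k + s - 1" using Ws by simp
    qed
    have "sqrt (real k) * real (cnf_size F) \<le> real d"
    proof -
      have "sqrt x * sqrt x = x" using x by simp
      moreover have "10000 \<le> sqrt x"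
        using x by (intro real_le_rsqrt) simp
      then have "10000 * sqrt x \<le> sqrt x * sqrt x" using x by (intro mult_right_mono) auto
      ultimately have sq: "10000 * sqrt x \<le> x" by simp
      have "sqrt x * real (cnf_size F) \<le> sqrt x * (140 * y / x ^ 2)"
        using size x by (intro mult_left_mono) auto
      also have "\<dots> = (140 * sqrt x) * (y / x ^ 2)" by simp
      also have "\<dots> \<le> (x / 64) * (y / x ^ 2)"
        using sq y_pos x by (intro mult_right_mono) auto
      also have "\<dots> = y / (64 * x)" using x by (simp add: power2_eq_square field_simps)
      also have "\<dots> \<le> y / (32 * x) - 1"
      proof -
        have "real_of_int (100000000 * int k) \<le> y"
          using G_big unfolding y_def by (simp only: of_int_le_iff)
        then have "100000000 * x \<le> y" by (simp add: x_def)
        then have "64 * x \<le> y" using x by linarith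
        then show ?thesis using x by (simp add: field_simps)
      qed
      also have "\<dots> \<le> real_of_int (G div (32 * int k))"
        using real_of_int_div3[of G "32 * int k"] by (simp add: x_def y_def)
      also have "\<dots> = real d" using d_int by (simp flip: d_int)
      finally show ?thesis by (simp add: x_def)
    qed
    then have "sqrt (real k) * real (cnf_size F) \<le> real (ref_depth \<pi>)"
      if "is_refutation F \<pi>" "real (ref_width \<pi>) \<le> (1 + \<delta>) * real (k + 3)" for \<pi>
      using depth[OF that] by linarith
    with F(1) poly show ?thesis by blast
  qed
  then show ?thesis unfolding eventually_sequentially by blast
qed

lemma superlinear_family:
  fixes \<delta> :: real
  assumes \<delta>: "0 < \<delta>" "\<delta> < 1"
  shows "\<exists>(F :: nat \<Rightarrow> nat cnf) (N :: nat \<Rightarrow> nat).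
        linear_size_4cnf_family F N \<and> has_width_w_refutations F \<and>
        (\<lambda>n. real (N n)) \<in> o(\<lambda>n. 2 powr (real n / 2)) \<and>
        (\<forall>c>0. \<forall>\<^sub>F n in sequentially. \<forall>\<pi>.
           is_refutation (F n) \<pi> \<and> real (ref_width \<pi>) \<le> (1 + \<delta>) * real (w_param n) \<longrightarrow>
           real (ref_depth \<pi>) \<ge> c * real (cnf_size (F n)))"
proof -
  obtain K where K: "\<forall>\<^sub>F k in sequentially. \<exists>F. padded_cnf (k + 3) F \<and> (real (cnf_size F) \<le> real k ^ K \<and>
    (\<forall>\<pi>. is_refutation F \<pi> \<longrightarrow> real (ref_width \<pi>) \<le> (1 + \<delta>) * real (k + 3) \<longrightarrow>
      sqrt (real k) * real (cnf_size F) \<le> real (ref_depth \<pi>)))"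
    using superlinear_instances[OF \<delta>] by blast
  define R where "R k F \<longleftrightarrow> real (cnf_size F) \<le> real k ^ K \<and>
    (\<forall>\<pi>. is_refutation F \<pi> \<longrightarrow> real (ref_width \<pi>) \<le> (1 + \<delta>) * real (k + 3) \<longrightarrow>
      sqrt (real k) * real (cnf_size F) \<le> real (ref_depth \<pi>))" for k and F :: "nat cnf"
  obtain F where F: "linear_size_4cnf_family F (\<lambda>n. card (cnf_vars (F n)))"
      "has_width_w_refutations F" "\<forall>\<^sub>F n in sequentially. R (w_param n - 3) (F n)"
    using refutable_family[of R] K unfolding R_def by blast
  have kcnf: "is_kcnf 4 (F n)" for n using F(1) by (simp add: linear_size_4cnf_family_def)
  have "(\<lambda>n. real (card (cnf_vars (F n)))) \<in> O(\<lambda>n. real n ^ K)"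
  proof (rule bigoI)
    show "\<forall>\<^sub>F n in sequentially. norm (real (card (cnf_vars (F n)))) \<le> 1 * norm (real n ^ K)"
      using F(3) w_param_bounds
    proof eventually_elim
      case (elim n)
      have "real (card (cnf_vars (F n))) \<le> real (cnf_size (F n))"
        using card_cnf_vars_le[OF kcnf] by simp
      also have "\<dots> \<le> real (w_param n - 3) ^ K" using elim by (simp add: R_def)
      also have "\<dots> \<le> real n ^ K" using elim by (intro power_mono) auto
      finally show ?case by simp
    qed
  qed
  also have "(\<lambda>n. real n ^ K) \<in> o(\<lambda>n. 2 powr (real n / 2))" by real_asymp
  finally have small: "(\<lambda>n. real (card (cnf_vars (F n)))) \<in> o(\<lambda>n. 2 powr (real n / 2))" .
  have "\<forall>\<^sub>F n in sequentially. \<forall>\<pi>.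
           is_refutation (F n) \<pi> \<and> real (ref_width \<pi>) \<le> (1 + \<delta>) * real (w_param n) \<longrightarrow>
           real (ref_depth \<pi>) \<ge> c * real (cnf_size (F n))" for c
  proof -
    have "\<forall>\<^sub>F k :: nat in sequentially. c \<le> sqrt (real k)" by real_asymp
    from F(3) w_param_bounds eventually_compose_filterlim[OF this filterlim_width_parameter]
    show ?thesis
    proof eventually_elim
      case (elim n)
      show ?case
      proof (intro allI impI)
        fix \<pi> assume \<pi>: "is_refutation (F n) \<pi> \<and> real (ref_width \<pi>) \<le> (1 + \<delta>) * real (w_param n)"
        have "c * real (cnf_size (F n)) \<le> sqrt (real (w_param n - 3)) * real (cnf_size (F n))"
          using elim(3) by (intro mult_right_mono) auto
        also have "\<dots> \<le> real (ref_depth \<pi>)"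
          using elim(1,2) \<pi> unfolding R_def by metis
        finally show "real (ref_depth \<pi>) \<ge> c * real (cnf_size (F n))" .
      qed
    qed
  qed
  then show ?thesis
    using F(1,2) small by (intro exI[of _ F] exI[of _ "\<lambda>n. card (cnf_vars (F n))"]) blast
qed

theorem mainTheorem4:
  fixes C \<delta> :: real
  assumes "0 < \<delta>" and "\<delta> < 1"
  shows
    "(\<exists>(F :: nat \<Rightarrow> nat cnf) (N :: nat \<Rightarrow> nat).
        linear_size_4cnf_family F N \<and> has_width_w_refutations F \<and>
        (\<exists>k::nat. (\<lambda>n. real (N n)) \<in> O(\<lambda>n. real n ^ k)) \<and>
        (\<exists>\<epsilon>>0. \<forall>\<^sub>F n in sequentially. \<forall>\<pi>.
           is_refutation (F n) \<pi> \<and> real (ref_width \<pi>) \<le> real (w_param n) + C \<longrightarrow>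
           real (ref_depth \<pi>) \<ge> 2 powr (real (cnf_size (F n)) powr \<epsilon>)))
     \<and>
     (\<exists>(F :: nat \<Rightarrow> nat cnf) (N :: nat \<Rightarrow> nat).
        linear_size_4cnf_family F N \<and> has_width_w_refutations F \<and>
        (\<lambda>n. real (N n)) \<in> o(\<lambda>n. 2 powr (real n / 2)) \<and>
        (\<forall>c>0. \<forall>\<^sub>F n in sequentially. \<forall>\<pi>.
           is_refutation (F n) \<pi> \<and> real (ref_width \<pi>) \<le> (1 + \<delta>) * real (w_param n) \<longrightarrow>
           real (ref_depth \<pi>) \<ge> c * real (cnf_size (F n))))"
  using exponential_family[of C] superlinear_family[OF assms] by (rule conjI)

end
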